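(* Let $\mathfrak{g}$ be a (possibly infinite-dimensional) Lie algebra over $\mathbb{C}$ with a non-degenerate symmetric invariant bilinear form $\langle\cdot,\cdot\rangle$, let $\Gamma$ be a group of automorphisms of $(\mathfrak{g},\langle\cdot,\cdot\rangle)$ such that for any $u,v\in\mathfrak{g}$, $[gu,v]=0$ and $\langle gu,v\rangle=0$ for all but finitely many $g\in\Gamma$, let $\Psi:\Gamma\to G$ be a group homomorphism, let $\phi=\Phi\circ\Psi$, and let $\ell\in\mathbb{C}$. Let $(W,Y_W)$ be any quasi module at infinity, with associated homomorphism $\Psi$, for the vertex $\Gamma$-algebra $V_{\hat{\mathfrak{g}^{o}}}(-\ell,0)$, where $\mathfrak{g}^o$ is the opposite Lie algebra of $\mathfrak{g}$, and suppose that $\Psi:\Gamma\to G$ is one-to-one. Then $W$ is a module for the Lie algebra $\hat{\mathfrak{g}}(\infty)[\Gamma]$ of level $\ell$ with $a_\Gamma(x)=Y_W(a,x)$ for $a\in\mathfrak{g}$; that is, there is a $\hat{\mathfrak{g}}(\infty)[\Gamma]$-module structure of level $\ell$ on $W$ for which $a_\Gamma(x)$ acts as $Y_W(a,x)$ for all $a\in\mathfrak{g}$.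
   Context: All vector spaces are over $\mathbb{C}$. For a vertex algebra $V$ write $Y(u,x)v=\sum_{n\in\mathbb{Z}}(u_nv)x^{-n-1}$, with vacuum vector $\mathbf{1}$. $G=\{\alpha x+\beta\mid \alpha\in\mathbb{C}^{\times},\beta\in\mathbb{C}\}$ is a group under composition; $\Phi:G\to\mathbb{C}^{\times}$, $\alpha x+\beta\mapsto\alpha$. For $g(x)=\alpha x+\beta\in G$ and $n\in\mathbb{Z}$, $g(x)^n=\sum_{i\ge0}\binom{n}{i}\alpha^{n-i}\beta^ix^{n-i}\in\mathbb{C}((x^{-1}))$; accordingly $p(g(t))\in\mathbb{C}((t^{-1}))$ for $p(t)\in\mathbb{C}((t^{-1}))$. For $g\in\Gamma$ write $g(x)=\Psi(g)(x)$ and $g^{-1}(x)=\Psi(g^{-1})(x)$. For a vector space $W$, $\mathcal{E}^{o}(W)=\mathrm{Hom}(W,W((x^{-1})))\subset(\mathrm{End}\,W)[[x,x^{-1}]]$. For $a(x)=\sum_n a_nx^{-n-1}\in\mathcal{E}^o(W)$ and $g\in G$, $a(g(x))=\sum_n a_n g(x)^{-n-1}$. $W((x_1^{-1},x_2^{-1}))$ is the space of series $\sum w_{m,n}x_1^mx_2^n$ with $m,n$ bounded above. The Lie algebra $\hat{\mathfrak g}(\infty)[\Gamma]$: on the vector space $\hat{\mathfrak{g}}(\infty)=\mathfrak{g}\otimes\mathbb{C}((t^{-1}))\oplus\mathbb{C}\mathbf{k}$ define a bilinear operation by $[a\otimes p,\mathbf{k}]_\Gamma=0=[\mathbf{k},a\otimes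 p]_\Gamma$, $[\mathbf k,\mathbf k]_\Gamma=0$ and $[a\otimes p(t),b\otimes q(t)]_\Gamma=\sum_{g\in\Gamma}\left([ga,b]\otimes p(g^{-1}(t))q(t)+\mathrm{Res}_t\,q(t)\frac{d}{dt}p(g^{-1}(t))\,\langle ga,b\rangle\mathbf{k}\right)$. The span of the vectors $ga\otimes p(t)-a\otimes p(g(t))$ ($g\in\Gamma$, $a\in\mathfrak g$, $p\in\mathbb{C}((t^{-1}))$) is a two-sided ideal and the quotient algebra, denoted $\hat{\mathfrak{g}}(\infty)[\Gamma]$, is a Lie algebra. Let $\pi:\hat{\mathfrak g}(\infty)\to\hat{\mathfrak g}(\infty)[\Gamma]$ be the quotient map and for $a\in\mathfrak{g}$ put $a_\Gamma(x)=\sum_{n\in\mathbb{Z}}\pi(a\otimes t^n)x^{-n-1}$. A module has level $\ell$ if (the image of) $\mathbf{k}$ acts as the scalar $\ell$. Affine vertex algebras: for a Lie algebra $\mathfrak{h}$ with symmetric invariant form, $\hat{\mathfrak{h}}=\mathfrak{h}\otimes\mathbb{C}[t,t^{-1}]\oplus\mathbb{C}\mathbf{k}$ with $\mathbf k$ central and $[a\otimes t^m,b\otimes t^n]=[a,b]\otimes t^{m+n}+m\delta_{m+n,0}\langle a,b\rangle\mathbf{k}$. For $\ell'\in\mathbb{C}$, $V_{\hat{\mathfrak{h}}}(\ell',0)=U(\hat{\mathfrak{h}})\otimes_{U(\mathfrak{h}\otimes\mathbb{C}[t]\oplus\mathbb{C}\mathbf{k})}\mathbb{C}_{\ell'}$,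 where $\mathfrak h\otimes\mathbb{C}[t]$ acts trivially and $\mathbf k$ acts as $\ell'$ on $\mathbb{C}_{\ell'}=\mathbb{C}$; $\mathbf 1=1\otimes1$; $a\in\mathfrak{h}$ is identified with $(a\otimes t^{-1})\mathbf 1$. It is the vertex algebra with vacuum $\mathbf 1$ and $Y(a,x)=\sum_n(a\otimes t^n)x^{-n-1}$ for $a\in\mathfrak{h}$, $\mathbb{Z}$-graded by $\deg\mathbf 1=0$, $\deg(\mathfrak h\otimes t^m)=-m$; $L(0)$ is the grading operator ($L(0)v=nv$ for $v$ of degree $n$). Here $\mathfrak{h}=\mathfrak{g}^o$: the space $\mathfrak{g}$ with bracket $[a,b]^o=[b,a]$ and the same form $\langle\cdot,\cdot\rangle$. $\Gamma$ acts on $V_{\hat{\mathfrak g^o}}(-\ell,0)$ by the induced grading-preserving vertex algebra automorphisms, and $V_{\hat{\mathfrak g^o}}(-\ell,0)$ is a vertex $\Gamma$-algebra with $\phi=\Phi\circ\Psi:\Gamma\to\mathbb{C}^\times$ and $L(g)=\phi(g)^{L(0)}g$. Vertex $\Gamma$-algebra: a vertex algebra $V$ with group homomorphisms $L:\Gamma\to GL(V)$, $\phi:\Gamma\to\mathbb{C}^\times$ such that $L(g)\mathbf 1=\mathbf 1$ and $L(g)Y(u,x)v=Y(L(g)u,\phi(g)x)L(g)v$. Quasi module at infinity for a vertex algebra $V$: a vector space $W$ with a linear map $Y_W(\cdot,x):V\to\mathcal{E}^o(W)$ such that $Y_W(\mathbf 1,x)=1_W$ and for any $u,v\in V$ there is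 a nonzero polynomial $p(x_1,x_2)$ with $p(x_1,x_2)Y_W(u,x_1)Y_W(v,x_2)\in\mathrm{Hom}(W,W((x_1^{-1},x_2^{-1})))$ and $\left(p(x_1,x_2)Y_W(u,x_1)Y_W(v,x_2)\right)|_{x_1=x_2+x_0}=p(x_0+x_2,x_2)Y_W(Y(u,x_0)v,x_2)$ (substitution expanded in nonnegative powers of $x_0$). For a subgroup $H$ of $G$, $U\subset\mathcal{E}^o(W)$ is $H$-local if for any $a(x),b(x)\in U$ there is a product $p(x_1,x_2)$ of linear polynomials $x_1-h(x_2)$ with $h\in H$ (repetitions allowed) such that $p(x_1,x_2)[a(x_1),b(x_2)]=0$. Quasi module at infinity for a vertex $\Gamma$-algebra $V$ with associated homomorphism $\Psi:\Gamma\to G$: a quasi module at infinity $(W,Y_W)$ for $V$ viewed as a vertex algebra such that $\phi=\Phi\circ\Psi$, $Y_W(L(g)v,x)=Y_W(v,\Psi(g)^{-1}(x))$ for $g\in\Gamma$, $v\in V$, and $\{Y_W(v,x)\mid v\in V\}$ is $\Psi(\Gamma)$-local. *)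

theory Defs
  imports
    Complex_Main
    "HOL-Library.Function_Algebras"
    "HOL-Library.Product_Plus"
    "HOL-Library.Poly_Mapping"
    "HOL-Computational_Algebra.Polynomial"
    "HOL-Algebra.Algebraic_Closure_Type"
begin

text \<open>
  Given vector spaces such as the Lie algebra and the module \<open>W\<close> are types with an explicit scalar
  multiplication \<open>s :: complex \<Rightarrow> 'a \<Rightarrow> 'a\<close> satisfying \<^locale>\<open>vector_space\<close>.
  Vector spaces constructed as quotients are records of cosets, in the sense of HOL-Algebra,
  over the following ring.
\<close>

abbreviation CC :: "complex ring" where
  "CC \<equiv> ring_of_type_algebra"


section \<open>Quotients\<close>

definition coset_of :: "'a::plus set \<Rightarrow> 'a \<Rightarrow> 'a set" where
  "coset_of N x = (\<lambda>n. x + n) ` N"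

definition quotient_space ::
    "(complex \<Rightarrow> 'a \<Rightarrow> 'a) \<Rightarrow> 'a::ab_group_add set \<Rightarrow> 'a set \<Rightarrow> (complex, 'a set) module" where
  "quotient_space s S N =
     \<lparr>carrier = coset_of N ` S, monoid.mult = undefined, one = undefined,
      ring.zero = N, add = (\<lambda>A B. {x + y | x y. x \<in> A \<and> y \<in> B}),
      Module.module.smult = (\<lambda>c A. {s c x + n | x n. x \<in> A \<and> n \<in> N})\<rparr>"

text \<open>For a bilinear operation \<open>b\<close>, the quotient algebra of \<open>S\<close> by an ideal \<open>N\<close>; its operation
  is stored in the multiplication field of the record.\<close>

definition quotient_algebra ::
    "(complex \<Rightarrow> 'a \<Rightarrow> 'a) \<Rightarrow> ('a \<Rightarrow> 'a \<Rightarrow> 'a) \<Rightarrow> 'a::ab_group_add set \<Rightarrow> 'a set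
       \<Rightarrow> (complex, 'a set) module" where
  "quotient_algebra s b S N =
     (quotient_space s S N)
       \<lparr>monoid.mult := (\<lambda>A B. {b x y + n | x y n. x \<in> A \<and> y \<in> B \<and> n \<in> N})\<rparr>"


section \<open>Lie algebras with a form, and their automorphisms\<close>

definition bilinear_map ::
    "(complex \<Rightarrow> 'a::ab_group_add \<Rightarrow> 'a) \<Rightarrow> (complex \<Rightarrow> 'b::ab_group_add \<Rightarrow> 'b)
       \<Rightarrow> ('a \<Rightarrow> 'a \<Rightarrow> 'b) \<Rightarrow> bool" where
  "bilinear_map s t b \<longleftrightarrow>
     (\<forall>x. Vector_Spaces.linear s t (b x)) \<and> (\<forall>y. Vector_Spaces.linear s t (\<lambda>x. b x y))"

definition lie_algebra ::
    "(complex \<Rightarrow> 'g::ab_group_add \<Rightarrow> 'g) \<Rightarrow> ('g \<Rightarrow> 'g \<Rightarrow> 'g) \<Rightarrow> bool" where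
  "lie_algebra s br \<longleftrightarrow>
     vector_space s \<and> bilinear_map s s br \<and> (\<forall>x. br x x = 0) \<and>
     (\<forall>x y z. br x (br y z) + br y (br z x) + br z (br x y) = 0)"

definition nondeg_sym_invariant_form ::
    "(complex \<Rightarrow> 'g::ab_group_add \<Rightarrow> 'g) \<Rightarrow> ('g \<Rightarrow> 'g \<Rightarrow> 'g) \<Rightarrow> ('g \<Rightarrow> 'g \<Rightarrow> complex) \<Rightarrow> bool" where
  "nondeg_sym_invariant_form s br form \<longleftrightarrow>
     bilinear_map s (*) form \<and>
     (\<forall>x y. form x y = form y x) \<and>
     (\<forall>x y z. form (br x y) z = form x (br y z)) \<and>
     (\<forall>x. (\<forall>y. form x y = 0) \<longrightarrow> x = 0)"

definition opposite_bracket :: "('g \<Rightarrow> 'g \<Rightarrow> 'g) \<Rightarrow> 'g \<Rightarrow> 'g \<Rightarrow> 'g" where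
  "opposite_bracket br x y = br y x"

definition aut_group ::
    "(complex \<Rightarrow> 'g::ab_group_add \<Rightarrow> 'g) \<Rightarrow> ('g \<Rightarrow> 'g \<Rightarrow> 'g) \<Rightarrow> ('g \<Rightarrow> 'g \<Rightarrow> complex)
       \<Rightarrow> ('g \<Rightarrow> 'g) monoid" where
  "aut_group s br form =
     \<lparr>carrier = {f. Vector_Spaces.linear s s f \<and> bij f \<and>
                   (\<forall>x y. f (br x y) = br (f x) (f y)) \<and>
                   (\<forall>x y. form (f x) (f y) = form x y)},
      monoid.mult = (\<circ>), monoid.one = id\<rparr>"

abbreviation sub_group :: "('g \<Rightarrow> 'g) monoid \<Rightarrow> ('g \<Rightarrow> 'g) set \<Rightarrow> ('g \<Rightarrow> 'g) monoid" where
  "sub_group A \<Gamma> \<equiv> A\<lparr>carrier := \<Gamma>\<rparr>"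


section \<open>The affine group and Laurent series at infinity\<close>

text \<open>The element \<open>\<alpha>x + \<beta>\<close> is the polynomial \<open>[:\<beta>, \<alpha>:]\<close>, and \<open>\<Phi>\<close> is \<^const>\<open>lead_coeff\<close>.\<close>

definition affine_group :: "complex poly monoid" where
  "affine_group = \<lparr>carrier = {p. degree p = 1}, monoid.mult = pcompose, monoid.one = [:0, 1:]\<rparr>"

text \<open>The coefficient of \<open>x^k\<close> in \<open>h(x)^n\<close>, where \<open>i = n - k\<close> is the summation index of the
  binomial expansion.\<close>

definition affine_pow :: "complex poly \<Rightarrow> int \<Rightarrow> int \<Rightarrow> complex" where
  "affine_pow h n k =
     (if k \<le> n
      then (of_int n gchoose nat (n - k)) * coeff h 1 powi k * coeff h 0 ^ nat (n - k)
      else 0)"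

text \<open>A formal series \<open>\<Sum>n. f n x^n\<close> is represented by its coefficient function \<open>f\<close>.
  \<open>laurent_inf\<close> is \<open>V((x^-1))\<close>.\<close>

definition laurent_inf :: "(int \<Rightarrow> 'a::zero) set" where
  "laurent_inf = {f. \<exists>N. \<forall>n>N. f n = 0}"

text \<open>\<open>f(h(x))\<close>, the Cauchy product with respect to a bilinear map \<open>b\<close>, and \<open>d/dx\<close>;
  for arguments in \<^const>\<open>laurent_inf\<close> all index sets are finite.\<close>

definition subst_affine ::
    "(complex \<Rightarrow> 'a \<Rightarrow> 'a) \<Rightarrow> (int \<Rightarrow> 'a::comm_monoid_add) \<Rightarrow> complex poly \<Rightarrow> int \<Rightarrow> 'a" where
  "subst_affine s f h k = (\<Sum>m | k \<le> m \<and> f m \<noteq> 0. s (affine_pow h m k) (f m))"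

definition cauchy_prod ::
    "('a \<Rightarrow> 'b \<Rightarrow> 'c) \<Rightarrow> (int \<Rightarrow> 'a::zero) \<Rightarrow> (int \<Rightarrow> 'b::zero) \<Rightarrow> int \<Rightarrow> 'c::comm_monoid_add" where
  "cauchy_prod b f f' k = (\<Sum>m | f m \<noteq> 0 \<and> f' (k - m) \<noteq> 0. b (f m) (f' (k - m)))"

definition formal_deriv :: "(complex \<Rightarrow> 'a \<Rightarrow> 'a) \<Rightarrow> (int \<Rightarrow> 'a) \<Rightarrow> int \<Rightarrow> 'a" where
  "formal_deriv s f n = s (of_int (n + 1)) (f (n + 1))"

definition res :: "(int \<Rightarrow> 'a) \<Rightarrow> 'a" where
  "res f = f (- 1)"


section \<open>The Lie algebra \<open>\<gg>^(\<infinity>)[\<Gamma>]\<close>\<close>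

type_synonym 'g ginf = "(int \<Rightarrow> 'g) \<times> complex"

definition ginf_scale :: "(complex \<Rightarrow> 'g \<Rightarrow> 'g) \<Rightarrow> complex \<Rightarrow> 'g ginf \<Rightarrow> 'g ginf" where
  "ginf_scale s c u = ((\<lambda>n. s c (fst u n)), c * snd u)"

definition tens :: "(complex \<Rightarrow> 'g \<Rightarrow> 'g) \<Rightarrow> 'g \<Rightarrow> (int \<Rightarrow> complex) \<Rightarrow> int \<Rightarrow> 'g" where
  "tens s a p = (\<lambda>n. s (p n) a)"

text \<open>
  The linear map \<open>a \<otimes> p \<mapsto> \<Sum>n. p n a t^n\<close> from the tensor product of \<open>\<gg>\<close> with \<open>\<complex>((t^-1))\<close> to
  \<open>\<gg>((t^-1))\<close> is injective (and not surjective if \<open>\<gg>\<close> has infinite dimension), so the tensor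
  product is realized as the span of the images of the pure tensors.
\<close>

definition ginf_carrier :: "(complex \<Rightarrow> 'g::ab_group_add \<Rightarrow> 'g) \<Rightarrow> 'g ginf set" where
  "ginf_carrier s =
     Modules.module.span (\<lambda>c f n. s c (f n)) {tens s a p | a p. p \<in> laurent_inf} \<times> UNIV"

text \<open>
  The summand of \<open>[u, v]\<^sub>\<Gamma>\<close> for \<open>g \<in> \<Gamma>\<close>, where \<open>h\<close> stands for \<open>\<Psi>(g\<^sup>-\<^sup>1)\<close>. On \<open>u = a \<otimes> p\<close>, \<open>v = b \<otimes> q\<close>
  it is \<open>[ga, b] \<otimes> p(h(t)) q(t) + Res (q(t) d/dt p(h(t))) \<langle>ga, b\<rangle> k\<close>; see \<open>Gamma_bracket_tens\<close> below.
\<close>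

definition Gamma_summand ::
    "(complex \<Rightarrow> 'g::ab_group_add \<Rightarrow> 'g) \<Rightarrow> ('g \<Rightarrow> 'g \<Rightarrow> 'g) \<Rightarrow> ('g \<Rightarrow> 'g \<Rightarrow> complex)
       \<Rightarrow> ('g \<Rightarrow> 'g) \<Rightarrow> complex poly \<Rightarrow> 'g ginf \<Rightarrow> 'g ginf \<Rightarrow> 'g ginf" where
  "Gamma_summand s br form g h u v =
     (let gu = subst_affine s (\<lambda>n. g (fst u n)) h
      in (cauchy_prod br gu (fst v), res (cauchy_prod form (formal_deriv s gu) (fst v))))"

definition Gamma_bracket ::
    "(complex \<Rightarrow> 'g::ab_group_add \<Rightarrow> 'g) \<Rightarrow> ('g \<Rightarrow> 'g \<Rightarrow> 'g) \<Rightarrow> ('g \<Rightarrow> 'g \<Rightarrow> complex)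
       \<Rightarrow> ('g \<Rightarrow> 'g) set \<Rightarrow> (('g \<Rightarrow> 'g) \<Rightarrow> complex poly) \<Rightarrow> 'g ginf \<Rightarrow> 'g ginf \<Rightarrow> 'g ginf" where
  "Gamma_bracket s br form \<Gamma> \<Psi> u v =
     (let summand = (\<lambda>g. Gamma_summand s br form g
                           (\<Psi> (m_inv (sub_group (aut_group s br form) \<Gamma>) g)) u v)
      in \<Sum>g | g \<in> \<Gamma> \<and> summand g \<noteq> 0. summand g)"

definition Gamma_ideal ::
    "(complex \<Rightarrow> 'g::ab_group_add \<Rightarrow> 'g) \<Rightarrow> ('g \<Rightarrow> 'g) set \<Rightarrow> (('g \<Rightarrow> 'g) \<Rightarrow> complex poly)
       \<Rightarrow> 'g ginf set" where
  "Gamma_ideal s \<Gamma> \<Psi> =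
     Modules.module.span (ginf_scale s)
       {(tens s (g a) p - tens s a (subst_affine (*) p (\<Psi> g)), 0) | g a p.
          g \<in> \<Gamma> \<and> p \<in> laurent_inf}"

definition ginf_Gamma ::
    "(complex \<Rightarrow> 'g::ab_group_add \<Rightarrow> 'g) \<Rightarrow> ('g \<Rightarrow> 'g \<Rightarrow> 'g) \<Rightarrow> ('g \<Rightarrow> 'g \<Rightarrow> complex)
       \<Rightarrow> ('g \<Rightarrow> 'g) set \<Rightarrow> (('g \<Rightarrow> 'g) \<Rightarrow> complex poly) \<Rightarrow> (complex, 'g ginf set) module" where
  "ginf_Gamma s br form \<Gamma> \<Psi> =
     quotient_algebra (ginf_scale s) (Gamma_bracket s br form \<Gamma> \<Psi>)
       (ginf_carrier s) (Gamma_ideal s \<Gamma> \<Psi>)"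

definition ginf_proj ::
    "(complex \<Rightarrow> 'g::ab_group_add \<Rightarrow> 'g) \<Rightarrow> ('g \<Rightarrow> 'g) set \<Rightarrow> (('g \<Rightarrow> 'g) \<Rightarrow> complex poly)
       \<Rightarrow> 'g ginf \<Rightarrow> 'g ginf set" where
  "ginf_proj s \<Gamma> \<Psi> = coset_of (Gamma_ideal s \<Gamma> \<Psi>)"

definition tpow :: "int \<Rightarrow> int \<Rightarrow> complex" where
  "tpow n = (\<lambda>m. if m = n then 1 else 0)"

definition lie_module ::
    "(complex, 'l) module \<Rightarrow> (complex \<Rightarrow> 'w::ab_group_add \<Rightarrow> 'w) \<Rightarrow> ('l \<Rightarrow> 'w \<Rightarrow> 'w) \<Rightarrow> bool" where
  "lie_module L sW \<rho> \<longleftrightarrow>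
     vector_space sW \<and>
     (\<forall>x\<in>carrier L. Vector_Spaces.linear sW sW (\<rho> x)) \<and>
     (\<forall>x\<in>carrier L. \<forall>y\<in>carrier L. \<forall>w. \<rho> (x \<oplus>\<^bsub>L\<^esub> y) w = \<rho> x w + \<rho> y w) \<and>
     (\<forall>c. \<forall>x\<in>carrier L. \<forall>w. \<rho> (c \<odot>\<^bsub>L\<^esub> x) w = sW c (\<rho> x w)) \<and>
     (\<forall>x\<in>carrier L. \<forall>y\<in>carrier L. \<forall>w.
        \<rho> (x \<otimes>\<^bsub>L\<^esub> y) w = \<rho> x (\<rho> y w) - \<rho> y (\<rho> x w))"


section \<open>Vertex algebras and vertex \<open>\<Gamma>\<close>-algebras\<close>

definition linear_on ::
    "(complex, 'v) module \<Rightarrow> (complex, 'u) module \<Rightarrow> ('v \<Rightarrow> 'u) \<Rightarrow> bool" where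
  "linear_on V U f \<longleftrightarrow>
     f \<in> carrier V \<rightarrow> carrier U \<and>
     (\<forall>x\<in>carrier V. \<forall>y\<in>carrier V. f (x \<oplus>\<^bsub>V\<^esub> y) = f x \<oplus>\<^bsub>U\<^esub> f y) \<and>
     (\<forall>c. \<forall>x\<in>carrier V. f (c \<odot>\<^bsub>V\<^esub> x) = c \<odot>\<^bsub>U\<^esub> f x)"

text \<open>\<open>Y u n v\<close> stands for \<open>u\<^sub>n v\<close>. The last axiom is the Jacobi identity, written in components
  (Borcherds identity); by truncation the sums have finite support.\<close>

locale vertex_algebra =
  fixes V :: "(complex, 'v) module" (structure)
    and Y :: "'v \<Rightarrow> int \<Rightarrow> 'v \<Rightarrow> 'v"
    and vac :: 'v
  assumes vector_space: "Module.module CC V"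
    and linear_right: "\<And>u n. u \<in> carrier V \<Longrightarrow> linear_on V V (Y u n)"
    and linear_left: "\<And>v n. v \<in> carrier V \<Longrightarrow> linear_on V V (\<lambda>u. Y u n v)"
    and truncation:
      "\<And>u v. u \<in> carrier V \<Longrightarrow> v \<in> carrier V \<Longrightarrow> \<exists>N. \<forall>n>N. Y u n v = \<zero>"
    and vacuum_closed: "vac \<in> carrier V"
    and vacuum: "\<And>n v. v \<in> carrier V \<Longrightarrow> Y vac n v = (if n = - 1 then v else \<zero>)"
    and creation: "\<And>v. v \<in> carrier V \<Longrightarrow> Y v (- 1) vac = v"
      "\<And>v n. v \<in> carrier V \<Longrightarrow> n \<ge> 0 \<Longrightarrow> Y v n vac = \<zero>"
    and jacobi:
      "\<And>u v w l m n. u \<in> carrier V \<Longrightarrow> v \<in> carrier V \<Longrightarrow> w \<in> carrier V \<Longrightarrow>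
        (let lhs = (\<lambda>i::nat. (of_int m gchoose i) \<odot> Y (Y u (l + int i) v) (m + n - int i) w);
             rhs1 = (\<lambda>i::nat. ((- 1) ^ i * (of_int l gchoose i)) \<odot>
                                Y u (l + m - int i) (Y v (n + int i) w));
             rhs2 = (\<lambda>i::nat. (- ((- 1) powi l) * (- 1) ^ i * (of_int l gchoose i)) \<odot>
                                Y v (l + n - int i) (Y u (m + int i) w))
         in finsum V lhs {i. lhs i \<noteq> \<zero>} =
            finsum V rhs1 {i. rhs1 i \<noteq> \<zero>} \<oplus> finsum V rhs2 {i. rhs2 i \<noteq> \<zero>})"

definition vertex_automorphism ::
    "(complex, 'v) module \<Rightarrow> ('v \<Rightarrow> int \<Rightarrow> 'v \<Rightarrow> 'v) \<Rightarrow> 'v \<Rightarrow> ('v \<Rightarrow> 'v) \<Rightarrow> bool" where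
  "vertex_automorphism V Y vac f \<longleftrightarrow>
     linear_on V V f \<and> bij_betw f (carrier V) (carrier V) \<and> f vac = vac \<and>
     (\<forall>u\<in>carrier V. \<forall>v\<in>carrier V. \<forall>n. f (Y u n v) = Y (f u) n (f v))"

locale vertex_Gamma_algebra = vertex_algebra V Y vac + \<Gamma>?: group \<Gamma>
  for V :: "(complex, 'v) module" and Y vac and \<Gamma> :: "'i monoid" +
  fixes L :: "'i \<Rightarrow> 'v \<Rightarrow> 'v"
    and \<phi> :: "'i \<Rightarrow> complex"
  assumes L_linear: "\<And>g. g \<in> carrier \<Gamma> \<Longrightarrow> linear_on V V (L g)"
    and L_bij: "\<And>g. g \<in> carrier \<Gamma> \<Longrightarrow> bij_betw (L g) (carrier V) (carrier V)"
    and L_mult: "\<And>g h v. g \<in> carrier \<Gamma> \<Longrightarrow> h \<in> carrier \<Gamma> \<Longrightarrow> v \<in> carrier V \<Longrightarrow>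
                   L (g \<otimes>\<^bsub>\<Gamma>\<^esub> h) v = L g (L h v)"
    and \<phi>_nonzero: "\<And>g. g \<in> carrier \<Gamma> \<Longrightarrow> \<phi> g \<noteq> 0"
    and \<phi>_mult: "\<And>g h. g \<in> carrier \<Gamma> \<Longrightarrow> h \<in> carrier \<Gamma> \<Longrightarrow> \<phi> (g \<otimes>\<^bsub>\<Gamma>\<^esub> h) = \<phi> g * \<phi> h"
    and L_vacuum: "\<And>g. g \<in> carrier \<Gamma> \<Longrightarrow> L g vac = vac"
    and L_Y: "\<And>g u v n. g \<in> carrier \<Gamma> \<Longrightarrow> u \<in> carrier V \<Longrightarrow> v \<in> carrier V \<Longrightarrow>
                L g (Y u n v) = (\<phi> g powi (- n - 1)) \<odot>\<^bsub>V\<^esub> Y (L g u) n (L g v)"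


section \<open>Quasi modules at infinity\<close>

text \<open>A field \<open>a(x) = \<Sum>n. a\<^sub>n x^(-n-1)\<close> is represented by \<open>n \<mapsto> a\<^sub>n\<close>, whereas series with
  coefficients in \<open>W\<close> are indexed by the exponents of the variables. The conversion is:\<close>

definition apply_field :: "(int \<Rightarrow> 'w \<Rightarrow> 'w) \<Rightarrow> 'w \<Rightarrow> int \<Rightarrow> 'w" where
  "apply_field a w k = a (- k - 1) w"

definition Eo ::
    "(complex \<Rightarrow> 'w::ab_group_add \<Rightarrow> 'w) \<Rightarrow> (int \<Rightarrow> 'w \<Rightarrow> 'w) set" where
  "Eo s = {a. (\<forall>n. Vector_Spaces.linear s s (a n)) \<and> (\<forall>w. apply_field a w \<in> laurent_inf)}"

definition field_subst ::
    "(complex \<Rightarrow> 'w::ab_group_add \<Rightarrow> 'w) \<Rightarrow> (int \<Rightarrow> 'w \<Rightarrow> 'w) \<Rightarrow> complex poly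
       \<Rightarrow> int \<Rightarrow> 'w \<Rightarrow> 'w" where
  "field_subst s a h n w = subst_affine s (apply_field a w) h (- n - 1)"

text \<open>
  A polynomial \<open>p(x\<^sub>1, x\<^sub>2)\<close> is a polynomial in \<open>x\<^sub>1\<close> with coefficients in \<open>\<complex>[x\<^sub>2]\<close>, and
  \<open>F m n\<close> is the coefficient of \<open>x\<^sub>1^m x\<^sub>2^n\<close> of a series \<open>F(x\<^sub>1, x\<^sub>2)\<close>.
\<close>

definition bipoly_mult ::
    "(complex \<Rightarrow> 'w \<Rightarrow> 'w) \<Rightarrow> complex poly poly \<Rightarrow> (int \<Rightarrow> int \<Rightarrow> 'w)
       \<Rightarrow> int \<Rightarrow> int \<Rightarrow> 'w::comm_monoid_add" where
  "bipoly_mult s p F m n =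
     (\<Sum>i\<le>degree p. \<Sum>j\<le>degree (coeff p i). s (coeff (coeff p i) j) (F (m - int i) (n - int j)))"

definition field_prod ::
    "(int \<Rightarrow> 'w \<Rightarrow> 'w) \<Rightarrow> (int \<Rightarrow> 'w \<Rightarrow> 'w) \<Rightarrow> 'w \<Rightarrow> int \<Rightarrow> int \<Rightarrow> 'w" where
  "field_prod a b w m n = apply_field a (apply_field b w n) m"

text \<open>\<open>W((x\<^sub>1^-1, x\<^sub>2^-1))\<close>\<close>

definition laurent_inf2 :: "(int \<Rightarrow> int \<Rightarrow> 'w::zero) set" where
  "laurent_inf2 = {F. \<exists>N. \<forall>m n. m > N \<or> n > N \<longrightarrow> F m n = 0}"

text \<open>The coefficient of \<open>x\<^sub>0^i x\<^sub>2^k\<close> in \<open>F(x\<^sub>1, x\<^sub>2)\<close> at \<open>x\<^sub>1 = x\<^sub>2 + x\<^sub>0\<close>, where \<open>(x\<^sub>2 + x\<^sub>0)^m\<close> is expanded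
  in nonnegative powers of \<open>x\<^sub>0\<close>; the sum is finite for \<open>F\<close> in \<^const>\<open>laurent_inf2\<close>.\<close>

definition subst_sum ::
    "(complex \<Rightarrow> 'w \<Rightarrow> 'w) \<Rightarrow> (int \<Rightarrow> int \<Rightarrow> 'w) \<Rightarrow> int \<Rightarrow> int \<Rightarrow> 'w::comm_monoid_add" where
  "subst_sum s F i k =
     (if i < 0 then 0
      else \<Sum>m | F m (k + i - m) \<noteq> 0. s (of_int m gchoose nat i) (F m (k + i - m)))"

text \<open>\<open>p(x\<^sub>0 + x\<^sub>2, x\<^sub>2)\<close>, as a polynomial in \<open>x\<^sub>0\<close> with coefficients in \<open>\<complex>[x\<^sub>2]\<close>\<close>

definition bipoly_shift :: "complex poly poly \<Rightarrow> complex poly poly" where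
  "bipoly_shift p = pcompose p [:[:0, 1:], 1:]"

locale quasi_module_at_infinity = vertex_algebra V Y vac
  for V :: "(complex, 'v) module" and Y vac +
  fixes sW :: "complex \<Rightarrow> 'w::ab_group_add \<Rightarrow> 'w"
    and YW :: "'v \<Rightarrow> int \<Rightarrow> 'w \<Rightarrow> 'w"
  assumes W_vector_space: "vector_space sW"
    and YW_Eo: "\<And>v. v \<in> carrier V \<Longrightarrow> YW v \<in> Eo sW"
    and YW_add: "\<And>u v n w. u \<in> carrier V \<Longrightarrow> v \<in> carrier V \<Longrightarrow>
                   YW (u \<oplus>\<^bsub>V\<^esub> v) n w = YW u n w + YW v n w"
    and YW_scale: "\<And>c v n w. v \<in> carrier V \<Longrightarrow> YW (c \<odot>\<^bsub>V\<^esub> v) n w = sW c (YW v n w)"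
    and YW_vacuum: "\<And>n w. YW vac n w = (if n = - 1 then w else 0)"
    and quasi_associativity:
      "\<And>u v. u \<in> carrier V \<Longrightarrow> v \<in> carrier V \<Longrightarrow>
        \<exists>p. p \<noteq> 0 \<and>
          (\<forall>w. let F = bipoly_mult sW p (field_prod (YW u) (YW v) w) in
             F \<in> laurent_inf2 \<and>
             subst_sum sW F =
               bipoly_mult sW (bipoly_shift p) (\<lambda>i. apply_field (YW (Y u (- i - 1) v)) w))"

text \<open>The factor \<open>x\<^sub>1 - h(x\<^sub>2)\<close> is \<open>[:- h, 1:]\<close>.\<close>

definition group_local ::
    "(complex \<Rightarrow> 'w::ab_group_add \<Rightarrow> 'w) \<Rightarrow> complex poly set \<Rightarrow> (int \<Rightarrow> 'w \<Rightarrow> 'w) set \<Rightarrow> bool" where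
  "group_local s H U \<longleftrightarrow>
     (\<forall>a\<in>U. \<forall>b\<in>U. \<exists>hs. set hs \<subseteq> H \<and>
        (\<forall>w m n. bipoly_mult s (prod_list (map (\<lambda>h. [:- h, 1:]) hs))
                   (\<lambda>m n. field_prod a b w m n - field_prod b a w n m) m n = 0))"

locale quasi_module_at_infinity_Gamma =
  vertex_Gamma_algebra V Y vac \<Gamma> L \<phi> + quasi_module_at_infinity V Y vac sW YW
  for V :: "(complex, 'v) module" and Y vac and \<Gamma> :: "'i monoid" and L \<phi>
    and sW :: "complex \<Rightarrow> 'w::ab_group_add \<Rightarrow> 'w" and YW +
  fixes \<Psi> :: "'i \<Rightarrow> complex poly"
  assumes \<Psi>_hom: "\<Psi> \<in> hom \<Gamma> affine_group"
    and \<phi>_eq: "\<And>g. g \<in> carrier \<Gamma> \<Longrightarrow> \<phi> g = lead_coeff (\<Psi> g)"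
    and YW_L: "\<And>g v n w. g \<in> carrier \<Gamma> \<Longrightarrow> v \<in> carrier V \<Longrightarrow>
                 YW (L g v) n w = field_subst sW (YW v) (m_inv affine_group (\<Psi> g)) n w"
    and \<Gamma>_local: "group_local sW (\<Psi> ` carrier \<Gamma>) (YW ` carrier V)"


section \<open>Affine vertex algebras\<close>

text \<open>\<open>\<hh>^ = \<hh> \<otimes> \<complex>[t, t^-1] \<oplus> \<complex>k\<close>; \<open>a \<otimes> t^n\<close> is the finitely supported function
  \<open>Poly_Mapping.single n a\<close>.\<close>

type_synonym 'h affine = "(int \<Rightarrow>\<^sub>0 'h) \<times> complex"

definition aff_el :: "'h::zero \<Rightarrow> int \<Rightarrow> 'h affine" where
  "aff_el a n = (Poly_Mapping.single n a, 0)"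

definition aff_scale :: "(complex \<Rightarrow> 'h::zero \<Rightarrow> 'h) \<Rightarrow> complex \<Rightarrow> 'h affine \<Rightarrow> 'h affine" where
  "aff_scale s c x = (Poly_Mapping.map (s c) (fst x), c * snd x)"

definition aff_bracket ::
    "('h \<Rightarrow> 'h \<Rightarrow> 'h) \<Rightarrow> ('h \<Rightarrow> 'h \<Rightarrow> complex) \<Rightarrow> 'h::ab_group_add affine \<Rightarrow> 'h affine \<Rightarrow> 'h affine" where
  "aff_bracket br form x y =
     ((\<Sum>m\<in>Poly_Mapping.keys (fst x). \<Sum>n\<in>Poly_Mapping.keys (fst y).
         Poly_Mapping.single (m + n)
           (br (Poly_Mapping.lookup (fst x) m) (Poly_Mapping.lookup (fst y) n))),
      (\<Sum>m\<in>Poly_Mapping.keys (fst x). \<Sum>n\<in>Poly_Mapping.keys (fst y).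
         of_int m * (if m + n = 0 then 1 else 0) *
           form (Poly_Mapping.lookup (fst x) m) (Poly_Mapping.lookup (fst y) n)))"

text \<open>The free associative algebra on a set is the monoid algebra of the words over that set.\<close>

instantiation list :: (type) monoid_add
begin

definition zero_list :: "'a list" where "0 = []"

definition plus_list :: "'a list \<Rightarrow> 'a list \<Rightarrow> 'a list" where "xs + ys = xs @ ys"

instance by standard (simp_all add: zero_list_def plus_list_def)

end

type_synonym 'x free_alg = "'x list \<Rightarrow>\<^sub>0 complex"

definition free_gen :: "'x \<Rightarrow> 'x free_alg" where
  "free_gen x = Poly_Mapping.single [x] 1"

definition free_scale :: "complex \<Rightarrow> 'x free_alg \<Rightarrow> 'x free_alg" where
  "free_scale c u = Poly_Mapping.single 0 c * u"

text \<open>\<open>U(\<hh>^)\<close> is the free algebra on \<open>\<hh>^\<close> modulo the two-sided ideal spanned by the following set.\<close>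

definition envelope_relations ::
    "(complex \<Rightarrow> 'h \<Rightarrow> 'h) \<Rightarrow> ('h \<Rightarrow> 'h \<Rightarrow> 'h) \<Rightarrow> ('h \<Rightarrow> 'h \<Rightarrow> complex)
       \<Rightarrow> 'h::ab_group_add affine free_alg set" where
  "envelope_relations s br form =
     {u * (free_gen (x + y) - free_gen x - free_gen y) * v | u v x y. True} \<union>
     {u * (free_gen (aff_scale s c x) - free_scale c (free_gen x)) * v | u v c x. True} \<union>
     {u * (free_gen x * free_gen y - free_gen y * free_gen x
            - free_gen (aff_bracket br form x y)) * v | u v x y. True}"

text \<open>Tensoring with the one-dimensional module over the subalgebra generated by
  \<open>\<hh> \<otimes> \<complex>[t] \<oplus> \<complex>k\<close> adds the balancing relations \<open>u x \<otimes> 1 = u \<otimes> x 1\<close> for \<open>x\<close> in that subspace,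
  with \<open>x 1 = l c\<close> if \<open>c\<close> is the coefficient of \<open>k\<close> in \<open>x\<close>.\<close>

definition induction_relations :: "complex \<Rightarrow> 'h::ab_group_add affine free_alg set" where
  "induction_relations l =
     {u * free_gen x - free_scale (l * snd x) u | u x. \<forall>m<0. Poly_Mapping.lookup (fst x) m = 0}"

definition aff_kernel ::
    "(complex \<Rightarrow> 'h \<Rightarrow> 'h) \<Rightarrow> ('h \<Rightarrow> 'h \<Rightarrow> 'h) \<Rightarrow> ('h \<Rightarrow> 'h \<Rightarrow> complex) \<Rightarrow> complex
       \<Rightarrow> 'h::ab_group_add affine free_alg set" where
  "aff_kernel s br form l =
     Modules.module.span free_scale (envelope_relations s br form \<union> induction_relations l)"

definition aff_space ::
    "(complex \<Rightarrow> 'h \<Rightarrow> 'h) \<Rightarrow> ('h \<Rightarrow> 'h \<Rightarrow> 'h) \<Rightarrow> ('h \<Rightarrow> 'h \<Rightarrow> complex) \<Rightarrow> complex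
       \<Rightarrow> (complex, 'h::ab_group_add affine free_alg set) module" where
  "aff_space s br form l = quotient_space free_scale UNIV (aff_kernel s br form l)"

text \<open>The element \<open>u \<otimes> 1\<close>, for \<open>u\<close> in the free algebra.\<close>

definition aff_vec ::
    "(complex \<Rightarrow> 'h \<Rightarrow> 'h) \<Rightarrow> ('h \<Rightarrow> 'h \<Rightarrow> 'h) \<Rightarrow> ('h \<Rightarrow> 'h \<Rightarrow> complex) \<Rightarrow> complex
       \<Rightarrow> 'h::ab_group_add affine free_alg \<Rightarrow> 'h affine free_alg set" where
  "aff_vec s br form l u = coset_of (aff_kernel s br form l) u"

definition aff_vacuum ::
    "(complex \<Rightarrow> 'h \<Rightarrow> 'h) \<Rightarrow> ('h \<Rightarrow> 'h \<Rightarrow> 'h) \<Rightarrow> ('h \<Rightarrow> 'h \<Rightarrow> complex) \<Rightarrow> complex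
       \<Rightarrow> 'h::ab_group_add affine free_alg set" where
  "aff_vacuum s br form l = aff_vec s br form l 1"

text \<open>The image \<open>(a \<otimes> t^-1) 1\<close> of \<open>a\<close>.\<close>

definition aff_emb ::
    "(complex \<Rightarrow> 'h \<Rightarrow> 'h) \<Rightarrow> ('h \<Rightarrow> 'h \<Rightarrow> 'h) \<Rightarrow> ('h \<Rightarrow> 'h \<Rightarrow> complex) \<Rightarrow> complex
       \<Rightarrow> 'h::ab_group_add \<Rightarrow> 'h affine free_alg set" where
  "aff_emb s br form l a = aff_vec s br form l (free_gen (aff_el a (- 1)))"

text \<open>The homogeneous subspace of degree \<open>n\<close>, spanned by \<open>(a\<^sub>1 \<otimes> t^m\<^sub>1) \<dots> (a\<^sub>k \<otimes> t^m\<^sub>k) 1\<close> with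
  \<open>- m\<^sub>1 - \<dots> - m\<^sub>k = n\<close>.\<close>

definition aff_degree ::
    "(complex \<Rightarrow> 'h \<Rightarrow> 'h) \<Rightarrow> ('h \<Rightarrow> 'h \<Rightarrow> 'h) \<Rightarrow> ('h \<Rightarrow> 'h \<Rightarrow> complex) \<Rightarrow> complex \<Rightarrow> int
       \<Rightarrow> 'h::ab_group_add affine free_alg set set" where
  "aff_degree s br form l n =
     aff_vec s br form l `
       Modules.module.span free_scale
         {prod_list (map (\<lambda>(a, m). free_gen (aff_el a m)) ws) | ws. - sum_list (map snd ws) = n}"

text \<open>\<open>Y\<close> is the vertex algebra structure on the induced module with the given vacuum and
  \<open>Y(a, x) = \<Sum>n. (a \<otimes> t^n) x^(-n-1)\<close>. There is exactly one, since the images of the elements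
  \<open>a\<close> generate the vertex algebra.\<close>

definition affine_vertex_algebra ::
    "(complex \<Rightarrow> 'h \<Rightarrow> 'h) \<Rightarrow> ('h \<Rightarrow> 'h \<Rightarrow> 'h) \<Rightarrow> ('h \<Rightarrow> 'h \<Rightarrow> complex) \<Rightarrow> complex
       \<Rightarrow> ('h::ab_group_add affine free_alg set \<Rightarrow> int \<Rightarrow> 'h affine free_alg set
             \<Rightarrow> 'h affine free_alg set) \<Rightarrow> bool" where
  "affine_vertex_algebra s br form l Y \<longleftrightarrow>
     vertex_algebra (aff_space s br form l) Y (aff_vacuum s br form l) \<and>
     (\<forall>a n u. Y (aff_emb s br form l a) n (aff_vec s br form l u) =
                aff_vec s br form l (free_gen (aff_el a n) * u))"

text \<open>\<open>R g\<close> is the grading-preserving automorphism of the vertex algebra induced by \<open>g\<close>;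
  it is unique because the images of the elements \<open>a\<close> generate.\<close>

definition induced_action ::
    "(complex \<Rightarrow> 'h \<Rightarrow> 'h) \<Rightarrow> ('h \<Rightarrow> 'h \<Rightarrow> 'h) \<Rightarrow> ('h \<Rightarrow> 'h \<Rightarrow> complex) \<Rightarrow> complex
       \<Rightarrow> ('h::ab_group_add affine free_alg set \<Rightarrow> int \<Rightarrow> 'h affine free_alg set
             \<Rightarrow> 'h affine free_alg set)
       \<Rightarrow> ('h \<Rightarrow> 'h) set \<Rightarrow> (('h \<Rightarrow> 'h) \<Rightarrow> 'h affine free_alg set \<Rightarrow> 'h affine free_alg set)
       \<Rightarrow> bool" where
  "induced_action s br form l Y \<Gamma> R \<longleftrightarrow>
     (\<forall>g\<in>\<Gamma>.
        vertex_automorphism (aff_space s br form l) Y (aff_vacuum s br form l) (R g) \<and>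
        (\<forall>n. R g ` aff_degree s br form l n \<subseteq> aff_degree s br form l n) \<and>
        (\<forall>a. R g (aff_emb s br form l a) = aff_emb s br form l (g a)))"

text \<open>\<open>L g = \<phi>(g)^L(0) g\<close>, where \<open>L(0)\<close> acts as \<open>n\<close> on the homogeneous subspace of degree \<open>n\<close>.\<close>

definition twisted_action ::
    "(complex \<Rightarrow> 'h \<Rightarrow> 'h) \<Rightarrow> ('h \<Rightarrow> 'h \<Rightarrow> 'h) \<Rightarrow> ('h \<Rightarrow> 'h \<Rightarrow> complex) \<Rightarrow> complex
       \<Rightarrow> ('h \<Rightarrow> 'h) set \<Rightarrow> (('h \<Rightarrow> 'h) \<Rightarrow> complex)
       \<Rightarrow> (('h \<Rightarrow> 'h) \<Rightarrow> 'h::ab_group_add affine free_alg set \<Rightarrow> 'h affine free_alg set)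
       \<Rightarrow> (('h \<Rightarrow> 'h) \<Rightarrow> 'h affine free_alg set \<Rightarrow> 'h affine free_alg set) \<Rightarrow> bool" where
  "twisted_action s br form l \<Gamma> \<phi> R L \<longleftrightarrow>
     (\<forall>g\<in>\<Gamma>.
        linear_on (aff_space s br form l) (aff_space s br form l) (L g) \<and>
        (\<forall>n. \<forall>v\<in>aff_degree s br form l n.
           L g v = (\<phi> g powi n) \<odot>\<^bsub>aff_space s br form l\<^esub> R g v))"


section \<open>The brackets on pure tensors\<close>

lemma linear_props:
  assumes "Vector_Spaces.linear s t f"
  shows "f (s c x) = t c (f x)" "f 0 = 0" "f (x + y) = f x + f y"
proof -
  interpret Vector_Spaces.linear s t f by fact
  show "f (s c x) = t c (f x)" "f 0 = 0" "f (x + y) = f x + f y"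
    by (simp_all add: scale zero add)
qed

lemma bilinear_map_props:
  assumes "bilinear_map s t b"
  shows "b (s c x) y = t c (b x y)" "b x (s c y) = t c (b x y)" "b 0 y = 0" "b x 0 = 0"
  using assms linear_props[of s t "b x"] linear_props[of s t "\<lambda>x. b x y"]
  unfolding bilinear_map_def by blast+

lemma aff_bracket_el:
  assumes "bilinear_map s s br" and "bilinear_map s (*) form"
  shows "aff_bracket br form (aff_el a m) (aff_el b n) =
           (Poly_Mapping.single (m + n) (br a b), if m + n = 0 then of_int m * form a b else 0)"
  using bilinear_map_props[OF assms(1)] bilinear_map_props[OF assms(2)]
  by (cases "a = 0"; cases "b = 0") (auto simp: aff_bracket_def aff_el_def)

lemma cauchy_prod_tens:
  assumes "vector_space s" and "vector_space t" and "bilinear_map s t b"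
  shows "cauchy_prod b (tens s x p) (tens s y q) k = t (cauchy_prod (*) p q k) (b x y)"
proof -
  interpret s: vector_space s by fact
  interpret t: vector_space t by fact
  note b = bilinear_map_props[OF assms(3)]
  show ?thesis
  proof (cases "x = 0 \<or> y = 0")
    case True
    then show ?thesis by (auto simp: cauchy_prod_def tens_def b)
  next
    case False
    then show ?thesis
      by (simp add: cauchy_prod_def tens_def b t.scale_sum_left mult.commute)
  qed
qed

lemma subst_affine_tens:
  assumes "vector_space s" and "Vector_Spaces.linear s s g"
  shows "subst_affine s (\<lambda>n. g (tens s a p n)) h = tens s (g a) (subst_affine (*) p h)"
proof -
  interpret s: vector_space s by fact
  show ?thesis
    by (cases "g a = 0")
      (auto simp: subst_affine_def tens_def fun_eq_iff s.scale_sum_left linear_props[OF assms(2)])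
qed

text \<open>The next lemma is the defining formula of \<open>[\<cdot>, \<cdot>]\<^sub>\<Gamma>\<close>; the definition above extends it
  bilinearly to the whole of \<^const>\<open>ginf_carrier\<close>.\<close>

lemma Gamma_bracket_tens:
  fixes s :: "complex \<Rightarrow> 'g::ab_group_add \<Rightarrow> 'g"
  assumes s: "vector_space s" and br: "bilinear_map s s br" and form: "bilinear_map s (*) form"
    and \<Gamma>: "\<Gamma> \<subseteq> carrier (aut_group s br form)"
    and fin: "finite {g \<in> \<Gamma>. \<not> (br (g a) b = 0 \<and> form (g a) b = 0)}"
  shows "Gamma_bracket s br form \<Gamma> \<Psi> (tens s a p, c) (tens s b q, d) =
    (\<Sum>g | g \<in> \<Gamma> \<and> \<not> (br (g a) b = 0 \<and> form (g a) b = 0).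
       let pg = subst_affine (*) p (\<Psi> (m_inv (sub_group (aut_group s br form) \<Gamma>) g))
       in (tens s (br (g a) b) (cauchy_prod (*) pg q),
           res (cauchy_prod (*) (formal_deriv (*) pg) q) * form (g a) b))"
proof -
  interpret s: vector_space s by fact
  have c: "vector_space ((*) :: complex \<Rightarrow> complex \<Rightarrow> complex)"
    by unfold_locales (simp_all add: algebra_simps)
  have summand: "Gamma_summand s br form g h (tens s a p, c) (tens s b q, d) =
      (tens s (br (g a) b) (cauchy_prod (*) (subst_affine (*) p h) q),
       res (cauchy_prod (*) (formal_deriv (*) (subst_affine (*) p h)) q) * form (g a) b)"
    if "g \<in> \<Gamma>" for g h
  proof -
    have g: "Vector_Spaces.linear s s g"
      using that \<Gamma> by (auto simp: aut_group_def)
    have deriv: "formal_deriv s (tens s (g a) f) = tens s (g a) (formal_deriv (*) f)" for f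
      by (simp add: formal_deriv_def tens_def fun_eq_iff)
    have prod: "cauchy_prod br (tens s (g a) f) (tens s b q) =
        tens s (br (g a) b) (cauchy_prod (*) f q)" for f
      by (rule ext) (simp add: cauchy_prod_tens[OF s s br], simp add: tens_def)
    show ?thesis
      by (simp add: Gamma_summand_def Let_def subst_affine_tens[OF s g] res_def deriv prod
          cauchy_prod_tens[OF s c form])
  qed
  have vanish: "Gamma_summand s br form g h (tens s a p, c) (tens s b q, d) = 0"
    if "g \<in> \<Gamma>" "br (g a) b = 0" "form (g a) b = 0" for g h
    using that by (simp add: summand) (simp add: tens_def zero_prod_def fun_eq_iff)
  let ?S = "{g. g \<in> \<Gamma> \<and> \<not> (br (g a) b = 0 \<and> form (g a) b = 0)}"
  let ?h = "\<lambda>g. \<Psi> (m_inv (sub_group (aut_group s br form) \<Gamma>) g)"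
  let ?f = "\<lambda>g. Gamma_summand s br form g (?h g) (tens s a p, c) (tens s b q, d)"
  have "Gamma_bracket s br form \<Gamma> \<Psi> (tens s a p, c) (tens s b q, d) =
      (\<Sum>g | g \<in> \<Gamma> \<and> ?f g \<noteq> 0. ?f g)"
    by (simp only: Gamma_bracket_def Let_def)
  also have "\<dots> = sum ?f ?S"
    by (rule sum.mono_neutral_left[OF fin]) (use vanish in blast)+
  finally show ?thesis
    by (simp add: summand Let_def cong: sum.cong_simp)
qed

end

theory Submission
  imports Defs
begin

text \<open>
  The element \<open>a \<otimes> p\<close> has to act on \<open>W\<close> as the residue of \<open>p(x) Y\<^sub>W(a,x)\<close>, and \<open>k\<close> as \<open>l\<close>. The relation
  \<open>Y\<^sub>W(L(g)v, x) = Y\<^sub>W(v, \<Psi>(g)\<^sup>-\<^sup>1(x))\<close> with \<open>L(g) a = \<phi>(g) ga\<close> becomes, by a change of variables in the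
  residue, the statement that \<open>ga \<otimes> p - a \<otimes> p(g(t))\<close> acts as zero. What has to be shown is that brackets act as
  commutators, that is,
  \<open>[Y\<^sub>W(a,x\<^sub>1), Y\<^sub>W(b,x\<^sub>2)] = \<Sum>g. Y\<^sub>W([ga,b], x\<^sub>2) x\<^sub>1\<^sup>-\<^sup>1 \<delta>(h\<^sub>g(x\<^sub>2) / x\<^sub>1) + l \<langle>ga,b\<rangle> d/dx\<^sub>2 x\<^sub>1\<^sup>-\<^sup>1 \<delta>(h\<^sub>g(x\<^sub>2) / x\<^sub>1)\<close>
  with \<open>h\<^sub>g = \<Psi>(g\<^sup>-\<^sup>1)\<close>.

  Near the diagonal \<open>x\<^sub>1 = x\<^sub>2\<close> this is a computation with residues. By locality the two products of the
  fields become equal after multiplication by a polynomial, so they are the two expansions of one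
  rational expression. After multiplication by a suitable \<open>T(x\<^sub>1,x\<^sub>2)\<close> with \<open>T(x\<^sub>2,x\<^sub>2) \<noteq> 0\<close> only a power of
  \<open>x\<^sub>1 - x\<^sub>2\<close> is left in the denominator, the residue of the difference of the two expansions is a
  Taylor coefficient on the diagonal, and quasi associativity expresses it by the products \<open>u\<^sub>i v\<close> of the
  vertex algebra (\<open>residue_difference\<close>, \<open>commutator_near_diagonal\<close>). For generators only \<open>u\<^sub>0 v\<close>
  and \<open>u\<^sub>1 v\<close> are nonzero; as \<open>\<gg>\<close> is replaced by its opposite and \<open>l\<close> by \<open>- l\<close>, the signs agree with those
  of the bracket. Near \<open>x\<^sub>1 = h\<^sub>g(x\<^sub>2)\<close> the covariance of the fields reduces the question to the diagonal, with
  \<open>ga\<close> in place of \<open>a\<close> (\<open>\<Lambda>_near_pole\<close>).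

  It remains to combine the local information. Let \<open>\<delta>(f)\<close> be the residue in \<open>x\<^sub>1\<close> of \<open>f(x\<^sub>1,x\<^sub>2)\<close> times the
  difference of the two sides of the formula, for polynomials \<open>f\<close>. The \<open>Q\<close> with \<open>\<delta>(Q f) = 0\<close> for all
  \<open>f\<close> form an ideal. It contains a product of linear factors \<open>x\<^sub>1 - h(x\<^sub>2)\<close> with \<open>h \<in> \<Psi>(\<Gamma>)\<close>, and for each of these
  factors also an element that does not vanish at \<open>x\<^sub>1 = h(x\<^sub>2)\<close>; here it is needed that \<open>\<Psi>\<close> is one-to-one,
  so that different \<open>g\<close> contribute at different places. Because series in
  \<open>W((x\<^sub>2\<^sup>-\<^sup>1))\<close> have no torsion over \<open>\<complex>[x\<^sub>2]\<close>, the factors can be removed one at a time, and \<open>\<delta> = 0\<close>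
  (\<open>functional_zero_by_peeling\<close>, \<open>nonnegative_commutator\<close>). This settles the nonnegative modes of \<open>a\<close>. The
  polynomial identity satisfied by both sides is a recurrence that carries the equality over to the
  negative modes (\<open>commutator_rows\<close>). Summation against the coefficients of \<open>p\<close> and \<open>q\<close>
  gives the action of the bracket (\<open>action_bracket_tens\<close>).
\<close>

section \<open>Polynomials acting on formal series\<close>

text \<open>
  Multiplying a series by a polynomial in \<open>x\<^sub>2\<close>, and multiplying it by a polynomial in \<open>x\<^sub>1\<close> whose
  coefficients are polynomials in \<open>x\<^sub>2\<close>, are two instances of evaluating a polynomial at a linear
  operator \<open>D\<close>, a shift of exponents in both cases. The rules of calculation are therefore derived
  once, for any operator that commutes with the scalars.
\<close>

definition eval_op :: "('r::zero \<Rightarrow> 'm \<Rightarrow> 'm::comm_monoid_add) \<Rightarrow> ('m \<Rightarrow> 'm) \<Rightarrow> 'r poly \<Rightarrow> 'm \<Rightarrow> 'm" where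
  "eval_op act D p u = (\<Sum>i\<le>degree p. act (coeff p i) ((D ^^ i) u))"

locale commuting_operator = Modules.module act
  for act :: "'r::comm_ring_1 \<Rightarrow> 'm::ab_group_add \<Rightarrow> 'm" +
  fixes D :: "'m \<Rightarrow> 'm"
  assumes D_add: "D (u + v) = D u + D v"
    and D_act: "D (act c u) = act c (D u)"
begin

abbreviation ev :: "'r poly \<Rightarrow> 'm \<Rightarrow> 'm" where "ev \<equiv> eval_op act D"

lemma D_zero [simp]: "D 0 = 0"
  using D_add[of 0 0] by simp

lemma D_sum: "D (sum f A) = (\<Sum>i\<in>A. D (f i))"
proof -
  show ?thesis by (induction A rule: infinite_finite_induct) (auto simp: D_add)
qed

lemma eval_0 [simp]: "ev 0 u = 0"
  by (simp add: eval_op_def)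

lemma eval_pCons: "ev (pCons c p) u = act c u + D (ev p u)"
proof (cases "p = 0")
  case True
  show ?thesis using True by (simp add: eval_op_def)
next
  case False
  then show ?thesis
    by (simp add: eval_op_def sum.atMost_Suc_shift D_sum D_act del: sum.atMost_Suc)
qed

lemma eval_add_left: "ev (p + q) u = ev p u + ev q u"
  by (induction p q rule: poly_induct2) (simp_all add: eval_pCons D_add scale_left_distrib)

lemma eval_add_right: "ev p (u + v) = ev p u + ev p v"
  by (induction p) (simp_all add: eval_pCons D_add scale_right_distrib)

lemma eval_smult: "ev (smult c p) u = act c (ev p u)"
  by (induction p) (simp_all add: eval_pCons D_act scale_right_distrib)

lemma eval_mult: "ev (p * q) u = ev p (ev q u)"
  by (induction p) (simp_all add: eval_pCons eval_smult eval_add_left mult_pCons_left D_add)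

lemma eval_const: "ev [:c:] u = act c u"
  by (simp add: eval_pCons)

lemma eval_1: "ev 1 u = u"
  by (simp add: eval_const one_pCons)

lemma module_eval: "Modules.module ev"
  by unfold_locales (simp_all add: eval_add_left eval_add_right eval_mult eval_1)

lemma eval_linear_factor: "ev [:- c, 1:] u = D u - act c u"
  by (simp add: eval_pCons)

lemma eval_power_var: "ev ([:0, 1:] ^ k) u = (D ^^ k) u"
  by (induction k) (simp_all add: eval_1 eval_mult eval_pCons)

lemma eval_closed:
  assumes "u \<in> S" "0 \<in> S" "\<And>u v. u \<in> S \<Longrightarrow> v \<in> S \<Longrightarrow> u + v \<in> S"
    and "\<And>c u. u \<in> S \<Longrightarrow> act c u \<in> S" "\<And>u. u \<in> S \<Longrightarrow> D u \<in> S"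
  shows "ev p u \<in> S"
  using assms by (induction p) (auto simp: eval_pCons)

end

text \<open>
  The subset \<open>S\<close> is essential for the intended \<open>Z\<close>: the substitution \<open>x\<^sub>1 = x\<^sub>2 + x\<^sub>0\<close> makes sense and is
  linear only on \<^const>\<open>laurent_inf2\<close>.
\<close>

lemma eval_op_intertwine:
  assumes "commuting_operator act D" and "commuting_operator act' D'"
    and S: "u \<in> S" "0 \<in> S" "\<And>u v. u \<in> S \<Longrightarrow> v \<in> S \<Longrightarrow> u + v \<in> S"
    "\<And>c u. u \<in> S \<Longrightarrow> act c u \<in> S" "\<And>u. u \<in> S \<Longrightarrow> D u \<in> S"
    and Z: "\<And>u v. u \<in> S \<Longrightarrow> v \<in> S \<Longrightarrow> Z (u + v) = Z u + Z v"
    "\<And>c u. u \<in> S \<Longrightarrow> Z (act c u) = act' c (Z u)" "\<And>u. u \<in> S \<Longrightarrow> Z (D u) = D' (Z u)"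
  shows "Z (eval_op act D p u) = eval_op act' D' p (Z u)"
proof -
  interpret a: commuting_operator act D by fact
  interpret b: commuting_operator act' D' by fact
  show ?thesis
  proof (induction p)
    case 0
    then show ?case using Z(1)[OF S(2,2)] by simp
  next
    case (pCons c p)
    have "a.ev p u \<in> S" by (rule a.eval_closed[OF S])
    then show ?case using pCons S Z by (simp add: a.eval_pCons b.eval_pCons)
  qed
qed

lemma (in commuting_operator) commuting_operator_eval:
  "commuting_operator act (\<lambda>u. ev p u)"
proof
  fix c u v
  show "ev p (u + v) = ev p u + ev p v" by (rule eval_add_right)
  show "ev p (act c u) = act c (ev p u)"
    by (metis eval_const eval_mult mult.commute)
qed

text \<open>
  Substituting into a polynomial amounts to changing the operator at which it is evaluated. This
  is how \<open>p(x\<^sub>0 + x\<^sub>2, x\<^sub>2)\<close> acts on series in \<open>x\<^sub>0\<close> and \<open>x\<^sub>2\<close>.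
\<close>

lemma (in commuting_operator) eval_pcompose:
  "ev (pcompose p q) u = eval_op act (\<lambda>u. ev q u) p u"
proof -
  interpret q: commuting_operator act "\<lambda>u. ev q u" by (rule commuting_operator_eval)
  show ?thesis
    by (induction p) (simp_all add: pcompose_pCons eval_add_left eval_mult eval_const q.eval_pCons)
qed

abbreviation (input) pointwise :: "('r \<Rightarrow> 'm \<Rightarrow> 'm) \<Rightarrow> 'r \<Rightarrow> ('i \<Rightarrow> 'm) \<Rightarrow> 'i \<Rightarrow> 'm" where
  "pointwise act \<equiv> (\<lambda>c f n. act c (f n))"

lemma module_pointwise:
  assumes "Modules.module act"
  shows "Modules.module (pointwise act)"
proof -
  interpret Modules.module act by fact
  show ?thesis
    by unfold_locales (auto simp: fun_eq_iff scale_right_distrib scale_left_distrib)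
qed

abbreviation (input) shift :: "(int \<Rightarrow> 'w) \<Rightarrow> int \<Rightarrow> 'w" where
  "shift u \<equiv> (\<lambda>n. u (n - 1))"

definition poly_act ::
    "(complex \<Rightarrow> 'w \<Rightarrow> 'w) \<Rightarrow> complex poly \<Rightarrow> (int \<Rightarrow> 'w::comm_monoid_add) \<Rightarrow> int \<Rightarrow> 'w" where
  "poly_act s = eval_op (pointwise s) shift"

text \<open>
  Series in one variable are acted on by polynomials in \<open>x\<^sub>2\<close> (\<open>u1\<close>), series in two variables by
  polynomials in \<open>x\<^sub>2\<close> (\<open>u2\<close>) and then by polynomials in \<open>x\<^sub>1\<close> with coefficients in \<open>\<complex>[x\<^sub>2]\<close> (\<open>u\<close>).
\<close>

locale complex_space = vector_space sW for sW :: "complex \<Rightarrow> 'w::ab_group_add \<Rightarrow> 'w"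
begin

lemma module_sW: "Modules.module sW" by unfold_locales

abbreviation pact :: "complex poly \<Rightarrow> (int \<Rightarrow> 'w) \<Rightarrow> int \<Rightarrow> 'w" where
  "pact \<equiv> poly_act sW"

definition pact2 :: "complex poly \<Rightarrow> (int \<Rightarrow> int \<Rightarrow> 'w) \<Rightarrow> int \<Rightarrow> int \<Rightarrow> 'w" where
  "pact2 = eval_op (pointwise (pointwise sW)) (\<lambda>F m. shift (F m))"

sublocale u1: commuting_operator "pointwise sW :: complex \<Rightarrow> (int \<Rightarrow> 'w) \<Rightarrow> int \<Rightarrow> 'w" shift
  rewrites "eval_op (pointwise sW) shift \<equiv> pact"
proof -
  show "commuting_operator (pointwise sW :: complex \<Rightarrow> (int \<Rightarrow> 'w) \<Rightarrow> int \<Rightarrow> 'w) shift"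
    by (intro commuting_operator.intro module_pointwise module_sW commuting_operator_axioms.intro)
      (simp_all add: fun_eq_iff)
qed (simp add: poly_act_def)

sublocale u2: commuting_operator "pointwise (pointwise sW) :: complex \<Rightarrow> (int \<Rightarrow> int \<Rightarrow> 'w) \<Rightarrow> int \<Rightarrow> int \<Rightarrow> 'w"
    "\<lambda>F m. shift (F m)"
  rewrites "eval_op (pointwise (pointwise sW)) (\<lambda>F m. shift (F m)) \<equiv> pact2"
proof -
  show "commuting_operator (pointwise (pointwise sW) :: complex \<Rightarrow> (int \<Rightarrow> int \<Rightarrow> 'w) \<Rightarrow> int \<Rightarrow> int \<Rightarrow> 'w)
    (\<lambda>F m. shift (F m))"
    by (intro commuting_operator.intro module_pointwise module_sW commuting_operator_axioms.intro)
      (simp_all add: fun_eq_iff)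
qed (simp add: pact2_def)

lemma funpow_shift2: "((\<lambda>F m. shift (F m)) ^^ i) F m n = F m (n - int i)"
  by (induction i arbitrary: n) (simp_all add: algebra_simps)

lemma funpow_shift: "(shift ^^ i) u n = u (n - int i)"
  by (induction i arbitrary: n) (simp_all add: algebra_simps)

lemma sum_fun_apply: "(\<Sum>i\<in>A. f i) x = (\<Sum>i\<in>A. f i x)"
  by (induction A rule: infinite_finite_induct) auto

lemma pact_eq: "pact q u n = (\<Sum>j\<le>degree q. sW (coeff q j) (u (n - int j)))"
  by (simp add: poly_act_def eval_op_def sum_fun_apply funpow_shift)

lemma pact2_eq: "pact2 q F m = pact q (F m)"
  by (rule ext) (simp add: pact_eq pact2_def eval_op_def sum_fun_apply funpow_shift2)

abbreviation bmult where "bmult \<equiv> bipoly_mult sW"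

text \<open>
  This presents \<^const>\<open>bipoly_mult\<close> as the evaluation of a polynomial over \<open>\<complex>[x\<^sub>2]\<close> at the shift in
  \<open>x\<^sub>1\<close>, so that it is an action of the ring \<open>\<complex>[x\<^sub>2][x\<^sub>1]\<close>.
\<close>

lemma bmult_eq_eval: "bmult = eval_op pact2 shift"
proof (intro ext)
  fix p F m n
  show "bmult p F m n = eval_op pact2 shift p F m n"
    by (simp add: eval_op_def sum_fun_apply bipoly_mult_def pact2_eq pact_eq)
      (simp only: funpow_shift)
qed

sublocale u: commuting_operator pact2 "shift :: (int \<Rightarrow> int \<Rightarrow> 'w) \<Rightarrow> _"
  rewrites "eval_op pact2 shift \<equiv> bmult"
proof -
  show "commuting_operator pact2 (shift :: (int \<Rightarrow> int \<Rightarrow> 'w) \<Rightarrow> _)"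
    by (intro commuting_operator.intro u2.module_eval commuting_operator_axioms.intro)
      (simp_all add: fun_eq_iff pact2_eq)
qed (simp add: bmult_eq_eval)

lemma bmult_row: "bmult p F m = (\<Sum>i\<le>degree p. pact (coeff p i) (F (m - int i)))"
  by (rule ext) (simp add: bipoly_mult_def pact_eq sum_fun_apply)

lemma bmult_closed:
  assumes "F \<in> S" "0 \<in> S" "\<And>F G. F \<in> S \<Longrightarrow> G \<in> S \<Longrightarrow> F + G \<in> S"
    and "\<And>c F. F \<in> S \<Longrightarrow> pointwise (pointwise sW) c F \<in> S"
    and "\<And>F. F \<in> S \<Longrightarrow> shift F \<in> S" "\<And>F. F \<in> S \<Longrightarrow> (\<lambda>m. shift (F m)) \<in> S"
  shows "bmult p F \<in> S"
proof (rule u.eval_closed)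
  show "pact2 q G \<in> S" if "G \<in> S" for q G
    by (rule u2.eval_closed) (use assms that in auto)
qed (use assms in auto)

lemma pact_laurent_inf: "u \<in> laurent_inf \<Longrightarrow> pact q u \<in> laurent_inf"
proof (rule u1.eval_closed)
  fix u v :: "int \<Rightarrow> 'w"
  assume "u \<in> laurent_inf" "v \<in> laurent_inf"
  then obtain N M where "\<forall>n>N. u n = 0" "\<forall>n>M. v n = 0" by (auto simp: laurent_inf_def)
  then show "u + v \<in> laurent_inf" by (auto simp: laurent_inf_def intro!: exI[of _ "max N M"])
next
  fix u :: "int \<Rightarrow> 'w"
  assume "u \<in> laurent_inf"
  then obtain N where "\<forall>n>N. u n = 0" by (auto simp: laurent_inf_def)
  then show "shift u \<in> laurent_inf" by (auto simp: laurent_inf_def intro!: exI[of _ "N + 1"])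
qed (auto simp: laurent_inf_def)

text \<open>
  The highest coefficient of \<open>q u\<close> is the product of the highest coefficients of \<open>q\<close> and of \<open>u\<close>. This is
  what allows nonzero polynomials in \<open>x\<^sub>2\<close> to be cancelled later on.
\<close>

lemma pact_torsion_free:
  assumes "pact q u = 0" "q \<noteq> 0" "u \<in> laurent_inf"
  shows "u = 0"
proof (rule ccontr)
  assume "u \<noteq> 0"
  then obtain n0 where n0: "u n0 \<noteq> 0" by (auto simp: fun_eq_iff)
  obtain N where N: "\<forall>n>N. u n = 0" using assms by (auto simp: laurent_inf_def)
  define n where "n = Max {n \<in> {n0..N}. u n \<noteq> 0}"
  have "n0 \<le> N" using n0 N by force
  have fin: "finite {n \<in> {n0..N}. u n \<noteq> 0}" by (rule finite_subset[of _ "{n0..N}"]) auto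
  then have "n \<in> {n \<in> {n0..N}. u n \<noteq> 0}" unfolding n_def using n0 \<open>n0 \<le> N\<close> by (intro Max_in fin) auto
  moreover have top: "u m = 0" if "m > n" for m
  proof (rule ccontr)
    assume "u m \<noteq> 0"
    moreover have "m \<ge> n0" using that \<open>n \<in> _\<close> by auto
    moreover have "m \<le> N" using N \<open>u m \<noteq> 0\<close> by force
    ultimately have "m \<le> n" unfolding n_def by (intro Max_ge fin) auto
    then show False using that by simp
  qed
  ultimately have un: "u n \<noteq> 0" by simp
  have "0 = pact q u (n + int (degree q))" using assms by simp
  also have "\<dots> = (\<Sum>j\<in>{degree q}. sW (coeff q j) (u (n + int (degree q) - int j)))"
    unfolding pact_eq by (rule sum.mono_neutral_right) (auto simp: top)
  also have "\<dots> = sW (lead_coeff q) (u n)" by simp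
  finally show False using un assms by simp
qed

end

section \<open>The two expansions of a quotient by a power of \<open>x\<^sub>1 - x\<^sub>2\<close>\<close>

context complex_space
begin

lemma gchoose_Pascal:
  fixes x :: complex
  shows "(x gchoose Suc k) = ((x - 1) gchoose k) + ((x - 1) gchoose Suc k)"
  using gbinomial_Suc_Suc[of "x - 1" k] by simp

lemma bmult_diag: "bmult [:- [:0, 1:], 1:] F m n = F (m - 1) n - F m (n - 1)"
  unfolding u.eval_linear_factor by (simp add: pact2_eq u1.eval_pCons)

text \<open>
  Division by a power of \<open>x\<^sub>1 - x\<^sub>2\<close> is unique among the series with \<open>x\<^sub>2\<close>-exponents bounded above: the
  coefficients are computed downwards in \<open>n\<close> along the lines \<open>m + n = const\<close>, one factor at a time,
  and Pascal's rule puts the binomial coefficients together. Any \<open>M\<close> with \<open>n + M > N\<close> serves as the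
  length of the sum, because from there on the coefficients of \<open>G\<close> vanish.
\<close>

lemma expansion_bounded_right:
  assumes "\<forall>m. \<forall>n>N. G m n = 0" and "n + int M > N"
    and "bmult ([:- [:0, 1:], 1:] ^ Suc k) G = H"
  shows "G m n =
    - (\<Sum>i<M. sW ((- 1 - of_nat i) gchoose k) (H (m - int i) (n + 1 + int k + int i)))"
  using assms
proof (induction k arbitrary: G N m n M)
  case 0
  have H: "H m n = G (m - 1) n - G m (n - 1)" for m n
    unfolding 0(3)[symmetric] by (simp only: power_Suc0_right bmult_diag)
  show ?case
    using 0(2)
  proof (induction M arbitrary: m n)
    case 0
    then show ?case using \<open>\<forall>m. \<forall>n>N. G m n = 0\<close> by simp
  next
    case (Suc M)
    have "G m n = G (m - 1) (n + 1) - H m (n + 1)" by (simp add: H)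
    also have "G (m - 1) (n + 1) = - (\<Sum>i<M. H (m - int (Suc i)) (n + 1 + int (Suc i)))"
      using Suc by (simp add: algebra_simps)
    finally have G: "G m n = - (\<Sum>i<M. H (m - int (Suc i)) (n + 1 + int (Suc i))) - H m (n + 1)" .
    show ?case
      unfolding G by (simp add: sum.lessThan_Suc_shift algebra_simps del: sum.lessThan_Suc)
  qed
next
  case (Suc k)
  define G1 where "G1 = bmult [:- [:0, 1:], 1:] G"
  have G1: "G1 m n = G (m - 1) n - G m (n - 1)" for m n
    unfolding G1_def by (rule bmult_diag)
  have b1: "\<forall>m. \<forall>n>N + 1. G1 m n = 0"
    using Suc.prems(1) by (simp add: G1)
  have H1: "bmult ([:- [:0, 1:], 1:] ^ Suc k) G1 = H"
    unfolding G1_def Suc.prems(3)[symmetric] by (simp only: power_Suc2 u.eval_mult)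
  note IH = Suc.IH[OF b1 _ H1]
  show ?case
    using Suc.prems(2)
  proof (induction M arbitrary: m n)
    case 0
    then show ?case using Suc.prems(1) by simp
  next
    case (Suc M)
    let ?b = "\<lambda>k i. (- 1 - complex_of_nat i) gchoose k"
    let ?h = "\<lambda>i. H (m - int i) (n + 2 + int k + int i)"
    have "G m n = G (m - 1) (n + 1) - G1 m (n + 1)" by (simp add: G1)
    also have "G1 m (n + 1) = - (\<Sum>i<Suc M. sW (?b k i) (?h i))"
      using Suc.prems by (subst IH[where M = "Suc M"]) (simp_all add: algebra_simps)
    also have "\<dots> = - sW (?b k 0) (?h 0) - (\<Sum>i<M. sW (?b k (Suc i)) (?h (Suc i)))"
      by (simp add: sum.lessThan_Suc_shift del: sum.lessThan_Suc)
    also have "G (m - 1) (n + 1) = - (\<Sum>i<M. sW (?b (Suc k) i) (?h (Suc i)))"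
      using Suc by (simp add: algebra_simps)
    also have "- (\<Sum>i<M. sW (?b (Suc k) i) (?h (Suc i))) -
        (- sW (?b k 0) (?h 0) - (\<Sum>i<M. sW (?b k (Suc i)) (?h (Suc i)))) =
        sW (?b k 0) (?h 0) - (\<Sum>i<M. sW (?b (Suc k) i - ?b k (Suc i)) (?h (Suc i)))"
      by (simp add: scale_left_diff_distrib sum_subtractf)
    also have "(\<lambda>i. ?b (Suc k) i - ?b k (Suc i)) = (\<lambda>i. ?b (Suc k) (Suc i))"
      using gchoose_Pascal[of "- 1 - of_nat i" k for i] by (auto simp: fun_eq_iff algebra_simps)
    also have "?b k 0 = - ?b (Suc k) 0"
      using gchoose_Pascal[of 0 k] by (simp add: eq_neg_iff_add_eq_0)
    finally show ?case
      by (simp add: sum.lessThan_Suc_shift scale_minus_left algebra_simps del: sum.lessThan_Suc)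
  qed
qed

text \<open>
  The analogue for series with \<open>x\<^sub>1\<close>-exponents bounded above. Each of the first \<open>k\<close> factors raises that
  bound by one, which is why the sum may have to be longer by \<open>k\<close> here.
\<close>

lemma expansion_bounded_left:
  assumes "\<forall>m>N. \<forall>n. G m n = 0" and "m + int M > N + int k"
    and "bmult ([:- [:0, 1:], 1:] ^ Suc k) G = H"
  shows "G m n = (\<Sum>i<M. sW (of_nat i gchoose k) (H (m + 1 + int i) (n + int k - int i)))"
  using assms
proof (induction k arbitrary: G N m n M)
  case 0
  have H: "H m n = G (m - 1) n - G m (n - 1)" for m n
    unfolding 0(3)[symmetric] by (simp only: power_Suc0_right bmult_diag)
  show ?case
    using 0(2)
  proof (induction M arbitrary: m n)
    case 0
    then show ?case using \<open>\<forall>m>N. \<forall>n. G m n = 0\<close> by simp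
  next
    case (Suc M)
    have "G m n = G (m + 1) (n - 1) + H (m + 1) n" by (simp add: H)
    then show ?case
      using Suc by (simp add: sum.lessThan_Suc_shift algebra_simps del: sum.lessThan_Suc)
  qed
next
  case (Suc k)
  define G1 where "G1 = bmult [:- [:0, 1:], 1:] G"
  have G1: "G1 m n = G (m - 1) n - G m (n - 1)" for m n
    unfolding G1_def by (rule bmult_diag)
  have b1: "\<forall>m>N + 1. \<forall>n. G1 m n = 0"
    using Suc.prems(1) by (simp add: G1)
  have H1: "bmult ([:- [:0, 1:], 1:] ^ Suc k) G1 = H"
    unfolding G1_def Suc.prems(3)[symmetric] by (simp only: power_Suc2 u.eval_mult)
  note IH = Suc.IH[OF b1 _ H1]
  show ?case
    using Suc.prems(2)
  proof (induction M arbitrary: m n)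
    case 0
    then show ?case using Suc.prems(1) by simp
  next
    case (Suc M)
    let ?b = "\<lambda>k i. complex_of_nat i gchoose k"
    let ?h = "\<lambda>i. H (m + 1 + int i) (n + 1 + int k - int i)"
    have "G m n = G (m + 1) (n - 1) + G1 (m + 1) n" by (simp add: G1)
    also have "G1 (m + 1) n = (\<Sum>i<M. sW (?b k i) (?h (Suc i)))"
      using Suc.prems by (subst IH[where M = M]) (simp_all add: algebra_simps)
    also have "G (m + 1) (n - 1) = (\<Sum>i<M. sW (?b (Suc k) i) (?h (Suc i)))"
      using Suc by (simp add: algebra_simps)
    also have "\<dots> + (\<Sum>i<M. sW (?b k i) (?h (Suc i))) =
        (\<Sum>i<M. sW (?b k i + ?b (Suc k) i) (?h (Suc i)))"
      by (simp add: scale_left_distrib sum.distrib add.commute)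
    also have "(\<lambda>i. ?b k i + ?b (Suc k) i) = (\<lambda>i. ?b (Suc k) (Suc i))"
      using gchoose_Pascal[of "1 + of_nat i" k for i] by (auto simp: fun_eq_iff algebra_simps)
    finally show ?case
      by (simp add: sum.lessThan_Suc_shift algebra_simps del: sum.lessThan_Suc)
  qed
qed


lemma subst_sum_box:
  assumes "\<forall>m n. m > N \<or> n > N \<longrightarrow> F m n = 0" and "N \<le> M"
  shows "subst_sum sW F i k =
    (if i < 0 then 0
     else \<Sum>m\<in>{k + i - M..M}. sW (of_int m gchoose nat i) (F m (k + i - m)))"
proof -
  have "(\<Sum>m | F m (k + i - m) \<noteq> 0. sW (of_int m gchoose nat i) (F m (k + i - m))) =
      (\<Sum>m\<in>{k + i - M..M}. sW (of_int m gchoose nat i) (F m (k + i - m)))"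
  proof (rule sum.mono_neutral_left)
    have "k + i - M \<le> m \<and> m \<le> M" if "F m (k + i - m) \<noteq> 0" for m
    proof -
      have "\<not> (m > N \<or> k + i - m > N)" using assms that by blast
      then show ?thesis using \<open>N \<le> M\<close> by linarith
    qed
    then show "{m. F m (k + i - m) \<noteq> 0} \<subseteq> {k + i - M..M}" by auto
  qed auto
  then show ?thesis by (simp add: subst_sum_def)
qed

lemma laurent_inf2D:
  assumes "F \<in> laurent_inf2" "G \<in> laurent_inf2"
  obtains N where "\<forall>m n. m > N \<or> n > N \<longrightarrow> F m n = 0" "\<forall>m n. m > N \<or> n > N \<longrightarrow> G m n = 0"
proof -
  obtain N M where N: "\<forall>m n. m > N \<or> n > N \<longrightarrow> F m n = 0" and M: "\<forall>m n. m > M \<or> n > M \<longrightarrow> G m n = 0"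
    using assms by (auto simp: laurent_inf2_def)
  show ?thesis
    by (rule that[of "max N M"]) (use N M in auto)
qed

lemma laurent_inf2_closed:
  shows "(0 :: int \<Rightarrow> int \<Rightarrow> 'w) \<in> laurent_inf2"
    and "F \<in> laurent_inf2 \<Longrightarrow> G \<in> laurent_inf2 \<Longrightarrow> F + G \<in> laurent_inf2"
    and "F \<in> laurent_inf2 \<Longrightarrow> pointwise (pointwise sW) c F \<in> laurent_inf2"
    and "F \<in> laurent_inf2 \<Longrightarrow> shift F \<in> laurent_inf2"
    and "F \<in> laurent_inf2 \<Longrightarrow> (\<lambda>m. shift (F m)) \<in> laurent_inf2"
proof -
  show "(0 :: int \<Rightarrow> int \<Rightarrow> 'w) \<in> laurent_inf2" by (auto simp: laurent_inf2_def)
  show "F \<in> laurent_inf2 \<Longrightarrow> G \<in> laurent_inf2 \<Longrightarrow> F + G \<in> laurent_inf2"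
  proof -
    assume "F \<in> laurent_inf2" "G \<in> laurent_inf2"
    then obtain N where "\<forall>m n. m > N \<or> n > N \<longrightarrow> F m n = 0" "\<forall>m n. m > N \<or> n > N \<longrightarrow> G m n = 0"
      using laurent_inf2D by blast
    then show ?thesis by (auto simp: laurent_inf2_def intro!: exI[of _ N])
  qed
  assume "F \<in> laurent_inf2"
  then obtain N where N: "\<forall>m n. m > N \<or> n > N \<longrightarrow> F m n = 0" by (auto simp: laurent_inf2_def)
  then show "pointwise (pointwise sW) c F \<in> laurent_inf2"
    by (auto simp: laurent_inf2_def)
  show "shift F \<in> laurent_inf2" "(\<lambda>m. shift (F m)) \<in> laurent_inf2"
    using N by (auto simp: laurent_inf2_def intro!: exI[of _ "N + 1"])
qed

lemma bmult_laurent_inf2: "F \<in> laurent_inf2 \<Longrightarrow> bmult p F \<in> laurent_inf2"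
  by (rule bmult_closed) (simp_all add: laurent_inf2_closed)

text \<open>
  Multiplication by \<open>x\<^sub>1\<close> becomes multiplication by \<open>x\<^sub>0 + x\<^sub>2\<close>; in coefficients this is Pascal's rule for
  \<open>(x\<^sub>2 + x\<^sub>0)^m\<close>.
\<close>

lemma subst_sum_shift1:
  assumes "F \<in> laurent_inf2"
  shows "subst_sum sW (shift F) = bmult [:[:0, 1:], 1:] (subst_sum sW F)"
proof (intro ext)
  fix i k
  obtain N where N: "\<forall>m n. m > N \<or> n > N \<longrightarrow> F m n = 0"
    using assms by (auto simp: laurent_inf2_def)
  have N1: "\<forall>m n. m > N + 1 \<or> n > N + 1 \<longrightarrow> shift F m n = 0" using N by simp
  show "subst_sum sW (shift F) i k = bmult [:[:0, 1:], 1:] (subst_sum sW F) i k"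
  proof (cases "i < 0")
    case True
    then show ?thesis by (simp add: subst_sum_def u.eval_pCons pact2_eq u1.eval_pCons)
  next
    case False
    have "subst_sum sW (shift F) i k =
        (\<Sum>m\<in>{k + i - (N + 1)..N + 1}. sW (of_int m gchoose nat i) (F (m - 1) (k + i - m)))"
      using subst_sum_box[OF N1, of "N + 1" i k] False by simp
    also have "\<dots> = (\<Sum>m\<in>{k + i - 1 - (N + 1)..N}.
        sW (of_int (m + 1) gchoose nat i) (F m (k + i - 1 - m)))"
      by (rule sum.reindex_bij_witness[of _ "\<lambda>m. m + 1" "\<lambda>m. m - 1"]) (auto simp: algebra_simps)
    also have "\<dots> = (\<Sum>m\<in>{k + i - 1 - (N + 1)..N + 1}.
        sW (of_int (m + 1) gchoose nat i) (F m (k + i - 1 - m)))"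
      by (rule sum.mono_neutral_left) (use N in auto)
    also have "\<dots> = subst_sum sW F i (k - 1) + subst_sum sW F (i - 1) k"
    proof (cases "i = 0")
      case True
      then show ?thesis
        using subst_sum_box[OF N, of "N + 1" i "k - 1"]
        by (simp add: subst_sum_def[of _ _ "-1"])
    next
      case i: False
      then obtain j where j: "nat i = Suc j" "nat (i - 1) = j"
        using False by (metis nat_diff_distrib' Suc_pred' zero_less_nat_eq diff_Suc_1 nat_1 One_nat_def linorder_neqE_linordered_idom zero_le_one linorder_not_less)
      have P: "(of_int (m + 1) :: complex) gchoose Suc j = (of_int m gchoose j) + (of_int m gchoose Suc j)" for m
        using gchoose_Pascal[of "of_int (m + 1)" j] by simp
      show ?thesis
        using subst_sum_box[OF N, of "N + 1" i "k - 1"] subst_sum_box[OF N, of "N + 1" "i - 1" k] False i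
        unfolding j P
        by (simp add: j scale_left_distrib sum.distrib algebra_simps)
    qed
    finally show ?thesis by (simp add: u.eval_pCons pact2_eq u1.eval_pCons)
  qed
qed

lemma subst_sum_bmult:
  assumes F: "F \<in> laurent_inf2"
  shows "subst_sum sW (bmult p F) = bmult (bipoly_shift p) (subst_sum sW F)"
proof -
  have add: "subst_sum sW (F + G) = subst_sum sW F + subst_sum sW G"
    if "F \<in> laurent_inf2" "G \<in> laurent_inf2" for F G
  proof -
    obtain N where N: "\<forall>m n. m > N \<or> n > N \<longrightarrow> F m n = 0" "\<forall>m n. m > N \<or> n > N \<longrightarrow> G m n = 0"
      using laurent_inf2D[OF \<open>F \<in> laurent_inf2\<close> \<open>G \<in> laurent_inf2\<close>] by blast
    then have "\<forall>m n. m > N \<or> n > N \<longrightarrow> (F + G) m n = 0" by simp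
    then show ?thesis
      by (intro ext, subst subst_sum_box[where F = "F + G", OF _ order_refl], assumption)
        (simp add: subst_sum_box[OF N(1) order_refl] subst_sum_box[OF N(2) order_refl]
          scale_right_distrib sum.distrib)
  qed
  have sc: "subst_sum sW (pointwise (pointwise sW) c F) = pointwise (pointwise sW) c (subst_sum sW F)"
    if "F \<in> laurent_inf2" for F c
  proof -
    obtain N where N: "\<forall>m n. m > N \<or> n > N \<longrightarrow> F m n = 0"
      using \<open>F \<in> laurent_inf2\<close> by (auto simp: laurent_inf2_def)
    then have "\<forall>m n. m > N \<or> n > N \<longrightarrow> pointwise (pointwise sW) c F m n = 0" by simp
    from subst_sum_box[OF this order_refl] subst_sum_box[OF N(1) order_refl]
    show ?thesis by (auto simp: fun_eq_iff scale_sum_right mult.commute)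
  qed
  have sh: "subst_sum sW (\<lambda>m. shift (F m)) = (\<lambda>i. shift (subst_sum sW F i))" for F
    by (auto simp: fun_eq_iff subst_sum_def algebra_simps)
  \<comment> \<open>first polynomials in \<open>x\<^sub>2\<close>, then polynomials in \<open>x\<^sub>1\<close> over them\<close>
  have act: "subst_sum sW (pact2 q F) = pact2 q (subst_sum sW F)" if "F \<in> laurent_inf2" for q F
    unfolding pact2_def
  proof (rule eval_op_intertwine[where S = laurent_inf2])
    show "subst_sum sW (F + G) = subst_sum sW F + subst_sum sW G"
      if "F \<in> laurent_inf2" "G \<in> laurent_inf2" for F G
      using that by (rule add)
  qed (use that in \<open>simp_all add: laurent_inf2_closed sc sh u2.commuting_operator_axioms\<close>)
  have act_closed: "pact2 q G \<in> laurent_inf2" if "G \<in> laurent_inf2" for q G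
    by (rule u2.eval_closed) (simp_all add: laurent_inf2_closed that)
  have "subst_sum sW (eval_op pact2 shift p F) =
      eval_op pact2 (bmult [:[:0, 1:], 1:]) p (subst_sum sW F)"
  proof (rule eval_op_intertwine[where S = laurent_inf2])
    show "subst_sum sW (F + G) = subst_sum sW F + subst_sum sW G"
      if "F \<in> laurent_inf2" "G \<in> laurent_inf2" for F G
      using that by (rule add)
    show "commuting_operator pact2 (bmult [:[:0, 1:], 1:])"
      by (rule u.commuting_operator_eval)
    show "commuting_operator pact2 (shift :: (int \<Rightarrow> int \<Rightarrow> 'w) \<Rightarrow> _)"
      by (rule u.commuting_operator_axioms)
  qed (simp_all add: F laurent_inf2_closed act act_closed subst_sum_shift1)
  then show ?thesis
    by (simp only: bipoly_shift_def u.eval_pcompose bmult_eq_eval[symmetric])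
qed

text \<open>
  A formal residue theorem. The coefficient of \<open>x\<^sub>1^-1\<close> in the first expansion of \<open>H / (x\<^sub>1 - x\<^sub>2)^(k+1)\<close>
  is minus a sum over the negative exponents \<open>m\<close> of \<open>x\<^sub>1\<close> in \<open>H\<close>, and in the second expansion it is
  the same sum over the nonnegative exponents. Their difference is minus the sum over all \<open>m\<close>, which
  is the coefficient of \<open>x\<^sub>0^k\<close> in \<open>H(x\<^sub>2 + x\<^sub>0, x\<^sub>2)\<close>.
\<close>

lemma residue_difference:
  assumes G: "\<forall>m. \<forall>n>N. G m n = 0" and G': "\<forall>m>N. \<forall>n. G' m n = 0"
    and H: "bmult ([:- [:0, 1:], 1:] ^ Suc k) G = H" "bmult ([:- [:0, 1:], 1:] ^ Suc k) G' = H"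
    and HL: "H \<in> laurent_inf2"
  shows "G (- 1) n - G' (- 1) n = - subst_sum sW H (int k) n"
proof -
  obtain M where M: "\<forall>m n. m > M \<or> n > M \<longrightarrow> H m n = 0"
    using HL by (auto simp: laurent_inf2_def)
  \<comment> \<open>long enough for both expansions and for the range of the sum over the antidiagonal\<close>
  define L where "L = nat (\<bar>N\<bar> + \<bar>M\<bar> + \<bar>n\<bar> + int k + 2)"
  have "G (- 1) n = - (\<Sum>i<L. sW ((- 1 - of_nat i) gchoose k) (H (- 1 - int i) (n + 1 + int k + int i)))"
    by (rule expansion_bounded_right[OF G _ H(1)]) (simp add: L_def)
  also have "(\<Sum>i<L. sW ((- 1 - of_nat i) gchoose k) (H (- 1 - int i) (n + 1 + int k + int i))) =
      (\<Sum>m\<in>{- int L..<0}. sW (of_int m gchoose k) (H m (n + int k - m)))"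
    by (rule sum.reindex_bij_witness[of _ "\<lambda>m. nat (- 1 - m)" "\<lambda>i. - 1 - int i"])
      (auto simp: algebra_simps)
  finally have 1: "G (- 1) n = - (\<Sum>m\<in>{- int L..<0}. sW (of_int m gchoose k) (H m (n + int k - m)))" .
  have "G' (- 1) n = (\<Sum>i<L. sW (of_nat i gchoose k) (H (- 1 + 1 + int i) (n + int k - int i)))"
    by (rule expansion_bounded_left[OF G' _ H(2)]) (simp add: L_def)
  also have "\<dots> = (\<Sum>m\<in>{0..<int L}. sW (of_int m gchoose k) (H m (n + int k - m)))"
    by (rule sum.reindex_bij_witness[of _ nat int]) (auto simp: algebra_simps)
  finally have 2: "G' (- 1) n = (\<Sum>m\<in>{0..<int L}. sW (of_int m gchoose k) (H m (n + int k - m)))" .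
  have "subst_sum sW H (int k) n = (\<Sum>m\<in>{n + int k - M..M}. sW (of_int m gchoose k) (H m (n + int k - m)))"
    using subst_sum_box[OF M order_refl] by simp
  also have "\<dots> = (\<Sum>m\<in>{- int L..<int L}. sW (of_int m gchoose k) (H m (n + int k - m)))"
  proof (rule sum.mono_neutral_left)
    show "{n + int k - M..M} \<subseteq> {- int L..<int L}" by (auto simp: L_def)
  qed (use M in auto)
  also have "{- int L..<int L} = {- int L..<0} \<union> {0..<int L}" by auto
  finally show ?thesis using 1 2 by (subst (asm) sum.union_disjoint) auto
qed

end

section \<open>The commutator of two fields near the diagonal\<close>

definition field_comm :: "(int \<Rightarrow> 'w \<Rightarrow> 'w) \<Rightarrow> (int \<Rightarrow> 'w \<Rightarrow> 'w) \<Rightarrow> 'w \<Rightarrow> int \<Rightarrow> int \<Rightarrow> 'w::ab_group_add"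
  where "field_comm a b w = (\<lambda>m n. field_prod a b w m n - field_prod b a w n m)"

lemma (in complex_space) bmult_bounded_right:
  assumes "\<exists>N. \<forall>m. \<forall>n>N. F m n = 0"
  shows "\<exists>N. \<forall>m. \<forall>n>N. bmult p F m n = 0"
proof -
  have "bmult p F \<in> {F. \<exists>N. \<forall>m. \<forall>n>N. F m n = 0}"
  proof (rule bmult_closed)
    fix F G :: "int \<Rightarrow> int \<Rightarrow> 'w"
    assume "F \<in> {F. \<exists>N. \<forall>m. \<forall>n>N. F m n = 0}" "G \<in> {F. \<exists>N. \<forall>m. \<forall>n>N. F m n = 0}"
    then obtain N M where "\<forall>m. \<forall>n>N. F m n = 0" "\<forall>m. \<forall>n>M. G m n = 0" by auto
    then show "F + G \<in> {F. \<exists>N. \<forall>m. \<forall>n>N. F m n = 0}"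
      by (auto intro!: exI[of _ "max N M"])
  next
    fix F :: "int \<Rightarrow> int \<Rightarrow> 'w"
    assume "F \<in> {F. \<exists>N. \<forall>m. \<forall>n>N. F m n = 0}"
    then obtain N where "\<forall>m. \<forall>n>N. F m n = 0" by auto
    then show "(\<lambda>m. shift (F m)) \<in> {F. \<exists>N. \<forall>m. \<forall>n>N. F m n = 0}"
      by (auto intro!: exI[of _ "N + 1"])
  qed (use assms in auto)
  then show ?thesis by simp
qed

lemma (in complex_space) bmult_bounded_left:
  assumes "\<exists>N. \<forall>m>N. \<forall>n. F m n = 0"
  shows "\<exists>N. \<forall>m>N. \<forall>n. bmult p F m n = 0"
proof -
  have "bmult p F \<in> {F. \<exists>N. \<forall>m>N. \<forall>n. F m n = 0}"
  proof (rule bmult_closed)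
    fix F G :: "int \<Rightarrow> int \<Rightarrow> 'w"
    assume "F \<in> {F. \<exists>N. \<forall>m>N. \<forall>n. F m n = 0}" "G \<in> {F. \<exists>N. \<forall>m>N. \<forall>n. F m n = 0}"
    then obtain N M where "\<forall>m>N. \<forall>n. F m n = 0" "\<forall>m>M. \<forall>n. G m n = 0" by auto
    then show "F + G \<in> {F. \<exists>N. \<forall>m>N. \<forall>n. F m n = 0}"
      by (auto intro!: exI[of _ "max N M"])
  next
    fix F :: "int \<Rightarrow> int \<Rightarrow> 'w"
    assume "F \<in> {F. \<exists>N. \<forall>m>N. \<forall>n. F m n = 0}"
    then obtain N where "\<forall>m>N. \<forall>n. F m n = 0" by auto
    then show "shift F \<in> {F. \<exists>N. \<forall>m>N. \<forall>n. F m n = 0}"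
      by (auto intro!: exI[of _ "N + 1"])
  qed (use assms in auto)
  then show ?thesis by simp
qed

lemma (in complex_space) bmult_diff: "bmult p (F - G) = bmult p F - bmult p G"
proof -
  interpret m: Modules.module "bmult" by (rule u.module_eval)
  show ?thesis by (rule m.scale_right_diff_distrib)
qed

text \<open>
  Multiply the polynomial of quasi associativity by the polynomial \<open>P\<close> of locality and by one more
  factor \<open>x\<^sub>1 - x\<^sub>2\<close>, and write the result as \<open>(x\<^sub>1 - x\<^sub>2)^(k+1) T\<close> with \<open>T(x\<^sub>2, x\<^sub>2) \<noteq> 0\<close>. Locality says that
  \<open>T f Y(u,x\<^sub>1) Y(v,x\<^sub>2) w\<close> and \<open>T f Y(v,x\<^sub>2) Y(u,x\<^sub>1) w\<close> have the same product with \<open>(x\<^sub>1 - x\<^sub>2)^(k+1)\<close>,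
  so that they are the two expansions of one quotient. The residue of their difference is given by
  the previous section, and quasi associativity evaluates it: the factor \<open>(x\<^sub>1 - x\<^sub>2)^(k+1)\<close> turns
  into \<open>x\<^sub>0^(k+1)\<close> and leaves minus the residue in \<open>x\<^sub>0\<close> of \<open>(T f)(x\<^sub>2 + x\<^sub>0, x\<^sub>2) Y(Y(u,x\<^sub>0) v, x\<^sub>2) w\<close>.
\<close>

lemma (in quasi_module_at_infinity) commutator_near_diagonal:
  assumes u: "u \<in> carrier V" and v: "v \<in> carrier V"
    and loc: "P \<noteq> 0" "\<And>w. bipoly_mult sW P (field_comm (YW u) (YW v) w) = 0"
  shows "\<exists>T. poly T [:0, 1:] \<noteq> 0 \<and> (\<forall>w f n.
    bipoly_mult sW (T * f) (field_comm (YW u) (YW v) w) (- 1) n =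
    - (\<Sum>i\<le>degree (bipoly_shift (T * f)).
        poly_act sW (coeff (bipoly_shift (T * f)) i) (apply_field (YW (Y u (int i) v)) w) n))"
proof -
  interpret C: complex_space sW
    unfolding complex_space_def by (rule W_vector_space)
  obtain p where p: "p \<noteq> 0"
    "\<And>w. bipoly_mult sW p (field_prod (YW u) (YW v) w) \<in> laurent_inf2"
    "\<And>w. subst_sum sW (bipoly_mult sW p (field_prod (YW u) (YW v) w)) =
       bipoly_mult sW (bipoly_shift p) (\<lambda>i. apply_field (YW (Y u (- i - 1) v)) w)"
    using quasi_associativity[OF u v] unfolding Let_def by blast
  define x where "x = [:0, 1 :: complex:]"
  \<comment> \<open>the extra factor makes the exponent of \<open>x\<^sub>1 - x\<^sub>2\<close> in \<open>Q\<close> positive\<close>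
  define Q where "Q = p * (P * [:- x, 1:])"
  have "[:- x, 1:] \<noteq> 0" by simp
  then have "Q \<noteq> 0" using p(1) loc(1) unfolding Q_def mult_eq_0_iff by blast
  obtain T where T: "Q = [:- x, 1:] ^ order x Q * T" "\<not> [:- x, 1:] dvd T"
    using order_decomp[OF \<open>Q \<noteq> 0\<close>] by blast
  have "poly Q x = 0" by (simp add: Q_def)
  then have "order x Q \<noteq> 0" using \<open>Q \<noteq> 0\<close> by (simp add: order_root)
  then obtain k where k: "order x Q = Suc k" using not0_implies_Suc by blast
  have "poly T x \<noteq> 0" using T(2) by (simp add: poly_eq_0_iff_dvd)
  moreover have "bipoly_mult sW (T * f) (field_comm (YW u) (YW v) w) (- 1) n =
    - (\<Sum>i\<le>degree (bipoly_shift (T * f)).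
        poly_act sW (coeff (bipoly_shift (T * f)) i) (apply_field (YW (Y u (int i) v)) w) n)" for w f n
  proof -
    define U where "U = field_prod (YW u) (YW v) w"
    define U' where "U' = (\<lambda>m n. field_prod (YW v) (YW u) w n m)"
    define Z where "Z = (\<lambda>i. apply_field (YW (Y u (- i - 1) v)) w)"
    have comm: "field_comm (YW u) (YW v) w = U - U'"
      by (simp add: field_comm_def U_def U'_def fun_eq_iff)
    have zero: "YW u n 0 = 0" "YW v n 0 = 0" for n
      using YW_Eo[OF u] YW_Eo[OF v] linear_props(2)[of sW sW] unfolding Eo_def by blast+
    obtain K where K: "\<forall>n>K. apply_field (YW v) w n = 0"
      using YW_Eo[OF v] unfolding Eo_def laurent_inf_def by blast
    then have "\<forall>m. \<forall>n>K. U m n = 0"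
      by (simp add: U_def field_prod_def apply_field_def zero)
    then obtain N where N: "\<forall>m. \<forall>n>N. bipoly_mult sW (T * f) U m n = 0"
      using C.bmult_bounded_right by blast
    obtain K' where K': "\<forall>n>K'. apply_field (YW u) w n = 0"
      using YW_Eo[OF u] unfolding Eo_def laurent_inf_def by blast
    then have "\<forall>m>K'. \<forall>n. U' m n = 0"
      by (simp add: U'_def field_prod_def apply_field_def zero)
    then obtain N' where N': "\<forall>m>N'. \<forall>n. bipoly_mult sW (T * f) U' m n = 0"
      using C.bmult_bounded_left by blast
    define H where "H = bipoly_mult sW (Q * f) U"
    have Qf: "Q * f = ([:- x, 1:] ^ Suc k) * (T * f)"
      by (subst T(1)) (simp add: k mult.assoc)
    have "bipoly_mult sW (Q * f) (U - U') = 0"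
    proof -
      have "Q * f = (p * [:- x, 1:] * f) * P" by (simp only: Q_def mult_ac)
      then have "bipoly_mult sW (Q * f) (U - U') =
          bipoly_mult sW (p * [:- x, 1:] * f) (bipoly_mult sW P (U - U'))"
        by (simp only: C.u.eval_mult)
      also have "bipoly_mult sW P (U - U') = 0"
        using loc(2)[of w] by (simp only: comm)
      also have "bipoly_mult sW (p * [:- x, 1:] * f) 0 = 0"
        using C.bmult_diff[of "p * [:- x, 1:] * f" 0 0] by (simp only: diff_self)
      finally show ?thesis .
    qed
    then have H': "bipoly_mult sW (Q * f) U' = H"
      by (simp add: H_def C.bmult_diff)
    have "Q * f = (P * [:- x, 1:] * f) * p" by (simp only: Q_def mult_ac)
    then have H2: "H = bipoly_mult sW (P * [:- x, 1:] * f) (bipoly_mult sW p U)"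
      unfolding H_def by (simp only: C.u.eval_mult)
    have HL: "H \<in> laurent_inf2"
      unfolding H2 using p(2) by (simp only: U_def C.bmult_laurent_inf2)
    have shift_mult: "bipoly_shift (a * b) = bipoly_shift a * bipoly_shift b" for a b
      by (simp add: bipoly_shift_def pcompose_mult)
    have "subst_sum sW H = bipoly_mult sW (bipoly_shift (P * [:- x, 1:] * f)) (bipoly_mult sW (bipoly_shift p) Z)"
      unfolding H2 by (subst C.subst_sum_bmult) (simp_all add: U_def p Z_def)
    also have "\<dots> = bipoly_mult sW (bipoly_shift (Q * f)) Z"
      by (simp only: C.u.eval_mult[symmetric] shift_mult[symmetric]) (simp only: Q_def mult_ac)
    also have "bipoly_shift (Q * f) = [:0, 1:] ^ Suc k * bipoly_shift (T * f)"
    proof -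
      have "bipoly_shift (r ^ j) = bipoly_shift r ^ j" for r j
        by (induction j) (simp_all add: shift_mult, simp add: bipoly_shift_def one_pCons)
      moreover have "bipoly_shift [:- x, 1:] = [:0, 1:]"
        by (simp add: bipoly_shift_def x_def pcompose_pCons)
      ultimately show ?thesis unfolding Qf by (simp only: shift_mult)
    qed
    finally have "subst_sum sW H = bipoly_mult sW ([:0, 1:] ^ Suc k * bipoly_shift (T * f)) Z" .
    moreover have "bipoly_mult sW ([:0, 1:] ^ Suc k * bipoly_shift (T * f)) Z (int k) n =
        bipoly_mult sW (bipoly_shift (T * f)) Z (- 1) n"
    proof -
      have "(shift ^^ j) F m = F (m - int j)" for j and F :: "int \<Rightarrow> int \<Rightarrow> 'w" and m
        by (induction j arbitrary: m) (simp_all add: algebra_simps)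
      from this[of "Suc k"] show ?thesis
        unfolding C.u.eval_mult C.u.eval_power_var by (simp del: funpow.simps)
    qed
    ultimately have SH: "subst_sum sW H (int k) n = bipoly_mult sW (bipoly_shift (T * f)) Z (- 1) n"
      by metis
    define M where "M = max N N'"
    have "bipoly_mult sW (T * f) U (- 1) n - bipoly_mult sW (T * f) U' (- 1) n = - subst_sum sW H (int k) n"
    proof (rule C.residue_difference[OF _ _ _ _ HL])
      show "\<forall>m. \<forall>n>M. bipoly_mult sW (T * f) U m n = 0" using N by (simp add: M_def)
      show "\<forall>m>M. \<forall>n. bipoly_mult sW (T * f) U' m n = 0" using N' by (simp add: M_def)
      show "bipoly_mult sW ([:- [:0, 1:], 1:] ^ Suc k) (bipoly_mult sW (T * f) U) = H"
        unfolding x_def[symmetric] C.u.eval_mult[symmetric] Qf[symmetric] H_def ..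
      show "bipoly_mult sW ([:- [:0, 1:], 1:] ^ Suc k) (bipoly_mult sW (T * f) U') = H"
        unfolding x_def[symmetric] C.u.eval_mult[symmetric] Qf[symmetric] H' ..
    qed
    also have "subst_sum sW H (int k) n = (\<Sum>i\<le>degree (bipoly_shift (T * f)).
        poly_act sW (coeff (bipoly_shift (T * f)) i) (apply_field (YW (Y u (int i) v)) w) n)"
      unfolding SH C.bmult_row C.sum_fun_apply by (simp add: Z_def)
    finally show ?thesis by (simp add: comm C.bmult_diff)
  qed
  ultimately show ?thesis unfolding x_def by blast
qed

section \<open>Products of generators of the affine vertex algebra\<close>

context complex_space
begin

lemma coset_of_eq_iff:
  assumes "subspace N"
  shows "coset_of N a = coset_of N b \<longleftrightarrow> a - b \<in> N"
proof
  assume "coset_of N a = coset_of N b"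
  moreover have "a \<in> coset_of N a"
    using subspace_0[OF assms] by (auto simp: coset_of_def image_iff intro!: bexI[of _ 0])
  ultimately show "a - b \<in> N" by (auto simp: coset_of_def)
next
  have sub: "coset_of N a \<subseteq> coset_of N b" if "a - b \<in> N" for a b
  proof
    fix x assume "x \<in> coset_of N a"
    then obtain n where n: "n \<in> N" "x = a + n" by (auto simp: coset_of_def)
    then have "x = b + ((a - b) + n)" by simp
    then show "x \<in> coset_of N b"
      using subspace_add[OF assms that n(1)] unfolding coset_of_def by (rule image_eqI)
  qed
  assume ab: "a - b \<in> N"
  then have "b - a \<in> N" using subspace_neg[OF assms ab] by simp
  with ab show "coset_of N a = coset_of N b" using sub by blast
qed

lemma coset_of_self: "subspace N \<Longrightarrow> a \<in> coset_of N a"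
  using subspace_0 by (auto simp: coset_of_def image_iff intro!: bexI[of _ 0])

lemma quotient_space_add:
  assumes "subspace N"
  shows "coset_of N a \<oplus>\<^bsub>quotient_space sW S N\<^esub> coset_of N b = coset_of N (a + b)"
proof -
  have "{x + y |x y. x \<in> coset_of N a \<and> y \<in> coset_of N b} = coset_of N (a + b)"
  proof (intro equalityI subsetI)
    fix z assume "z \<in> {x + y |x y. x \<in> coset_of N a \<and> y \<in> coset_of N b}"
    then obtain n m where "n \<in> N" "m \<in> N" "z = (a + n) + (b + m)" by (auto simp: coset_of_def)
    then show "z \<in> coset_of N (a + b)"
      using subspace_add[OF assms] by (auto simp: coset_of_def image_iff intro!: bexI[of _ "n + m"])
  next
    fix z assume "z \<in> coset_of N (a + b)"
    then obtain n where "n \<in> N" "z = (a + n) + b" by (auto simp: coset_of_def add_ac)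
    then show "z \<in> {x + y |x y. x \<in> coset_of N a \<and> y \<in> coset_of N b}"
      using coset_of_self[OF assms, of b] by (auto simp: coset_of_def)
  qed
  then show ?thesis by (simp add: quotient_space_def)
qed

lemma quotient_space_smult:
  assumes "subspace N"
  shows "c \<odot>\<^bsub>quotient_space sW S N\<^esub> coset_of N a = coset_of N (sW c a)"
proof -
  have "{sW c x + n |x n. x \<in> coset_of N a \<and> n \<in> N} = coset_of N (sW c a)"
  proof (intro equalityI subsetI)
    fix z assume "z \<in> {sW c x + n |x n. x \<in> coset_of N a \<and> n \<in> N}"
    then obtain n m where "n \<in> N" "m \<in> N" "z = sW c (a + n) + m" by (auto simp: coset_of_def)
    then show "z \<in> coset_of N (sW c a)"
      using subspace_add[OF assms] subspace_scale[OF assms]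
      by (auto simp: coset_of_def image_iff scale_right_distrib add.assoc intro!: bexI[of _ "sW c n + m"])
  next
    fix z assume "z \<in> coset_of N (sW c a)"
    then show "z \<in> {sW c x + n |x n. x \<in> coset_of N a \<and> n \<in> N}"
      using coset_of_self[OF assms, of a] by (auto simp: coset_of_def)
  qed
  then show ?thesis by (simp add: quotient_space_def)
qed

end

lemma vector_space_free_scale: "vector_space (free_scale :: complex \<Rightarrow> 'x free_alg \<Rightarrow> 'x free_alg)"
proof
  fix c d :: complex and u v :: "'x free_alg"
  show "free_scale c (u + v) = free_scale c u + free_scale c v"
    by (simp add: free_scale_def distrib_left)
  show "free_scale (c + d) u = free_scale c u + free_scale d u"
    by (simp add: free_scale_def single_add distrib_right)
  show "free_scale c (free_scale d u) = free_scale (c * d) u"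
    by (simp add: free_scale_def mult_single flip: mult.assoc)
  show "free_scale 1 u = u"
    by (simp add: free_scale_def)
qed

locale affine_space_data =
  fixes s :: "complex \<Rightarrow> 'h::ab_group_add \<Rightarrow> 'h" and br form and k :: complex
  assumes br: "bilinear_map s s br" and form: "bilinear_map s (*) form"
begin

sublocale fa: complex_space "free_scale :: complex \<Rightarrow> 'h affine free_alg \<Rightarrow> 'h affine free_alg"
  unfolding complex_space_def by (rule vector_space_free_scale)

abbreviation "N \<equiv> aff_kernel s br form k"
abbreviation "V \<equiv> aff_space s br form k"
abbreviation "vec \<equiv> aff_vec s br form k"
abbreviation "emb \<equiv> aff_emb s br form k"
abbreviation "vacuum \<equiv> aff_vacuum s br form k"

lemma subspace_N: "fa.subspace N"
  unfolding aff_kernel_def by (rule fa.subspace_span)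

lemma vec_eq: "vec u = vec v \<longleftrightarrow> u - v \<in> N"
  unfolding aff_vec_def by (rule fa.coset_of_eq_iff[OF subspace_N])

lemma vec_closed: "vec u \<in> carrier V"
  by (simp add: aff_vec_def aff_space_def quotient_space_def)

lemma vec_add: "vec u \<oplus>\<^bsub>V\<^esub> vec v = vec (u + v)"
  unfolding aff_vec_def aff_space_def by (rule fa.quotient_space_add[OF subspace_N])

lemma vec_smult: "c \<odot>\<^bsub>V\<^esub> vec u = vec (free_scale c u)"
  unfolding aff_vec_def aff_space_def by (rule fa.quotient_space_smult[OF subspace_N])

lemma relation_add: "free_gen (x + y) - (free_gen x + free_gen y) \<in> N"
proof -
  have "1 * (free_gen (x + y) - free_gen x - free_gen y) * 1 \<in> envelope_relations s br form"
    unfolding envelope_relations_def by blast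
  then show ?thesis unfolding aff_kernel_def by (intro fa.span_base) (simp add: diff_diff_eq)
qed

lemma relation_scale: "free_gen (aff_scale s c x) - free_scale c (free_gen x) \<in> N"
proof -
  have "1 * (free_gen (aff_scale s c x) - free_scale c (free_gen x)) * 1 \<in> envelope_relations s br form"
    unfolding envelope_relations_def by blast
  then show ?thesis unfolding aff_kernel_def by (intro fa.span_base) simp
qed

lemma relation_bracket:
  "free_gen x * free_gen y - free_gen y * free_gen x - free_gen (aff_bracket br form x y) \<in> N"
proof -
  have "1 * (free_gen x * free_gen y - free_gen y * free_gen x
      - free_gen (aff_bracket br form x y)) * 1 \<in> envelope_relations s br form"
    unfolding envelope_relations_def by blast
  then show ?thesis unfolding aff_kernel_def by (intro fa.span_base) simp
qed

lemma relation_induction: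
  "\<forall>m<0. Poly_Mapping.lookup (fst x) m = 0 \<Longrightarrow> u * free_gen x - free_scale (k * snd x) u \<in> N"
  unfolding aff_kernel_def induction_relations_def by (intro fa.span_base UnI2) blast

lemma emb_add: "emb (a + b) = emb a \<oplus>\<^bsub>V\<^esub> emb b"
proof -
  have "aff_el (a + b) (- 1) = aff_el a (- 1) + aff_el b (- 1)"
    by (simp add: aff_el_def single_add)
  then show ?thesis
    unfolding aff_emb_def vec_add vec_eq using relation_add by metis
qed

lemma emb_scale: "vector_space s \<Longrightarrow> emb (s c a) = c \<odot>\<^bsub>V\<^esub> emb a"
proof -
  assume "vector_space s"
  then interpret s: vector_space s .
  have "aff_el (s c a) (- 1) = aff_scale s c (aff_el a (- 1))"
    by (auto simp: aff_el_def aff_scale_def intro!: poly_mapping_eqI simp: lookup_single Poly_Mapping.map.rep_eq when_def)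
  then show ?thesis
    unfolding aff_emb_def vec_smult vec_eq using relation_scale by metis
qed

lemma emb_closed: "emb a \<in> carrier V"
  unfolding aff_emb_def by (rule vec_closed)

lemma vacuum_eq: "vacuum = vec 1"
  by (simp add: aff_vacuum_def)

text \<open>
  For \<open>n \<ge> 0\<close> move \<open>a \<otimes> t^n\<close> to the right of \<open>b \<otimes> t^-1\<close>. There it annihilates the vacuum, and what remains is
  the commutator, \<open>[a, b] \<otimes> t^(n-1) + n \<delta>\<^sub>n\<^sub>,\<^sub>1 \<langle>a, b\<rangle> k\<close> applied to the vacuum.
\<close>

lemma product_on_generators:
  assumes Y: "affine_vertex_algebra s br form k Y"
  shows "Y (emb a) (int n) (emb b) =
    (if n = 0 then emb (br a b) else if n = 1 then (k * form a b) \<odot>\<^bsub>V\<^esub> vacuum else vec 0)"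
proof -
  let ?x = "aff_el a (int n)" and ?y = "aff_el b (- 1)"
  have Yv: "Y (emb a) (int n) (emb b) = vec (free_gen ?x * free_gen ?y)"
    using Y unfolding affine_vertex_algebra_def aff_emb_def[of _ _ _ _ b] by blast
  define c where "c = aff_bracket br form ?x ?y"
  have c: "c = (Poly_Mapping.single (int n - 1) (br a b), if n = 1 then form a b else 0)"
    unfolding c_def aff_bracket_el[OF br form] by auto
  have "free_gen ?y * free_gen ?x - free_scale (k * snd ?x) (free_gen ?y) \<in> N"
    by (rule relation_induction) (auto simp: aff_el_def lookup_single when_def)
  then have "free_gen ?y * free_gen ?x \<in> N"
    by (simp add: aff_el_def)
  from fa.subspace_add[OF subspace_N relation_bracket[of ?x ?y] this]
  have gen: "free_gen ?x * free_gen ?y - free_gen c \<in> N" by (simp add: c_def)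
  have snd: "free_gen c - free_scale (k * snd c) 1 \<in> N" if "n \<noteq> 0"
    using relation_induction[of c 1] that by (simp add: c lookup_single when_def)
  show ?thesis
  proof (cases "n = 0")
    case True
    then have "free_gen c = free_gen (aff_el (br a b) (- 1))" by (simp add: c aff_el_def)
    with gen True show ?thesis unfolding Yv by (simp add: vec_eq aff_emb_def)
  next
    case False
    have "free_gen ?x * free_gen ?y - free_scale (k * snd c) 1 \<in> N"
      using fa.subspace_add[OF subspace_N gen snd[OF False]] by simp
    then show ?thesis
      using False unfolding Yv vacuum_eq vec_smult by (simp add: vec_eq c split: if_splits)
  qed
qed

lemma emb_degree: "emb a \<in> aff_degree s br form k 1"
proof -
  have "free_gen (aff_el a (- 1)) = prod_list (map (\<lambda>(a, m). free_gen (aff_el a m)) [(a, - 1)])"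
    by simp
  moreover have "- sum_list (map snd [(a, - 1 :: int)]) = 1" by simp
  ultimately show ?thesis
    unfolding aff_degree_def aff_emb_def by (intro imageI fa.span_base) blast
qed

end

section \<open>Powers of affine substitutions\<close>

lemma cauchy_prod_box:
  assumes "\<And>y. b 0 y = 0" "\<And>x. b x 0 = 0"
    and "\<forall>n>N. f n = 0" "\<forall>n>M. f' n = 0"
  shows "cauchy_prod b f f' k = (\<Sum>m\<in>{k - M..N}. b (f m) (f' (k - m)))"
  unfolding cauchy_prod_def
proof (rule sum.mono_neutral_left)
  have "k - M \<le> m \<and> m \<le> N" if "f m \<noteq> 0" "f' (k - m) \<noteq> 0" for m
  proof -
    have "\<not> m > N" "\<not> k - m > M" using that assms by blast+
    then show ?thesis by linarith
  qed
  then show "{m. f m \<noteq> 0 \<and> f' (k - m) \<noteq> 0} \<subseteq> {k - M..N}" by auto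
qed (use assms in auto)

interpretation cc: complex_space "(*)"
  by unfold_locales (simp_all add: algebra_simps)

(* over the complex numbers this rule moves parentheses to the left, against mult.assoc *)
declare cc.scale_scale [simp del]

lemma affine_pow_bounded: "k > n \<Longrightarrow> affine_pow h n k = 0"
  by (simp add: affine_pow_def)

text \<open>
  The coefficients of \<open>h(x)^(m+1) = h(x) h(x)^m\<close>, for exponents \<open>m\<close> of either sign.
\<close>

lemma affine_pow_Pascal:
  assumes "coeff h 1 \<noteq> 0"
  shows "affine_pow h (m + 1) k = coeff h 1 * affine_pow h m (k - 1) + coeff h 0 * affine_pow h m k"
proof (cases "k \<le> m")
  case True
  define i where "i = nat (m - k)"
  have i: "nat (m - k) = i" "nat (m + 1 - k) = Suc i" "nat (m - (k - 1)) = Suc i"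
    using True by (auto simp: i_def)
  have "(of_int (m + 1) gchoose Suc i :: complex) = (of_int m gchoose i) + (of_int m gchoose Suc i)"
    using gbinomial_Suc_Suc[of "of_int m :: complex" i] by (simp add: add.commute)
  moreover have "coeff h 1 powi k = coeff h 1 * coeff h 1 powi (k - 1)"
    using assms by (simp add: power_int_diff)
  moreover have "affine_pow h (m + 1) k =
      (of_int (m + 1) gchoose Suc i) * coeff h 1 powi k * coeff h 0 ^ Suc i"
    using True by (simp only: affine_pow_def i) simp
  moreover have "affine_pow h m (k - 1) =
      (of_int m gchoose Suc i) * coeff h 1 powi (k - 1) * coeff h 0 ^ Suc i"
    using True by (simp only: affine_pow_def i) simp
  moreover have "affine_pow h m k = (of_int m gchoose i) * coeff h 1 powi k * coeff h 0 ^ i"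
    using True by (simp only: affine_pow_def i) simp
  ultimately show ?thesis
    by (simp only: power_Suc ring_distribs mult_ac add_ac)
next
  case False
  then show ?thesis
    using assms by (cases "k = m + 1") (auto simp: affine_pow_def power_int_add)
qed

lemma linear_poly_eq: "degree h = 1 \<Longrightarrow> h = [:coeff h 0, coeff h 1:]"
proof (rule poly_eqI)
  fix n assume "degree h = 1"
  then show "coeff h n = coeff [:coeff h 0, coeff h 1:] n"
    by (cases n) (auto simp: coeff_pCons coeff_eq_0 split: nat.split)
qed

lemma affine_pow_Suc:
  assumes "degree h = 1"
  shows "affine_pow h (m + 1) = poly_act (*) h (affine_pow h m)"
proof -
  have "coeff h 1 \<noteq> 0" using assms by (metis leading_coeff_0_iff degree_0 zero_neq_one)
  then show ?thesis
    using assms by (auto simp: fun_eq_iff affine_pow_Pascal cc.pact_eq)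
qed

lemma affine_pow_0: "affine_pow h 0 k = (if k = 0 then 1 else 0)"
  by (auto simp: affine_pow_def gbinomial_0_left)

lemma affine_pow_nat:
  assumes "degree h = 1"
  shows "affine_pow h (int m) k = (if k < 0 then 0 else coeff (h ^ m) (nat k))"
proof (induction m arbitrary: k)
  case 0
  then show ?case by (auto simp: affine_pow_0)
next
  case (Suc m)
  have "coeff h 1 \<noteq> 0" using assms by (metis leading_coeff_0_iff degree_0 zero_neq_one)
  have "h ^ Suc m = [:coeff h 0, coeff h 1:] * h ^ m"
    by (subst linear_poly_eq[OF assms, symmetric]) simp
  then have "coeff (h ^ Suc m) (nat k) = coeff h 0 * coeff (h ^ m) (nat k) +
      (if k > 0 then coeff h 1 * coeff (h ^ m) (nat (k - 1)) else 0)"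
    by (cases "nat k") (auto simp: nat_diff_distrib)
  moreover have "affine_pow h (int (Suc m)) k =
      coeff h 1 * affine_pow h (int m) (k - 1) + coeff h 0 * affine_pow h (int m) k"
    using affine_pow_Pascal[OF \<open>coeff h 1 \<noteq> 0\<close>, of "int m" k] by (simp add: add.commute)
  ultimately show ?case by (auto simp: Suc.IH)
qed

text \<open>
  With \<open>h(x) = \<alpha> x + \<beta>\<close>, this is the change of variables \<open>x = h(y)\<close> in the residue of
  \<open>x^m h\<^sup>-\<^sup>1(x)^(-n-1)\<close>, written in coefficients.
\<close>

lemma affine_pow_inverse:
  assumes "\<alpha> \<noteq> 0"
  shows "affine_pow [:- \<beta> / \<alpha>, 1 / \<alpha>:] (- n - 1) (- m - 1) = \<alpha> * affine_pow [:\<beta>, \<alpha>:] m n"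
proof (cases "n \<le> m")
  case True
  define i where "i = nat (m - n)"
  have m: "m = n + int i" using True by (simp add: i_def)
  have B: "(of_int (- n - 1) gchoose i :: complex) = (- 1) ^ i * (of_int m gchoose i)"
  proof -
    have "of_int (- n - 1) = - (of_int n + 1 :: complex)" by simp
    then show ?thesis
      using gbinomial_minus[of "of_int n + 1 :: complex" i] by (simp only: m) simp
  qed
  have P: "(1 / \<alpha>) powi (- m - 1) = \<alpha> * \<alpha> powi n * \<alpha> ^ i"
  proof -
    have "- m - 1 = - (n + 1 + int i)" by (simp add: m)
    then have "(1 / \<alpha>) powi (- m - 1) = inverse (inverse \<alpha> powi (n + 1 + int i))"
      by (simp only: power_int_minus inverse_eq_divide[of \<alpha>])
    then have "(1 / \<alpha>) powi (- m - 1) = \<alpha> powi (n + 1 + int i)"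
      by (simp add: power_int_inverse)
    then show ?thesis using assms by (simp add: power_int_add)
  qed
  have C: "(- \<beta> / \<alpha>) ^ i * \<alpha> ^ i = (- 1) ^ i * \<beta> ^ i"
    using assms by (simp add: power_mult_distrib[symmetric])
  have E: "(- 1 :: complex) ^ i * (- 1) ^ i = 1"
    by (simp add: power_mult_distrib[symmetric])
  have eq: "e * b * (\<alpha> * p * a) * c = \<alpha> * (b * p * t)"
    if "e * e = 1" "c * a = e * t" for e b p a c t
  proof -
    have "e * b * (\<alpha> * p * a) * c = e * b * \<alpha> * p * (c * a)" by (simp only: mult_ac)
    also have "\<dots> = (e * e) * (\<alpha> * (b * p * t))" unfolding that(2) by (simp only: mult_ac)
    finally show ?thesis by (simp add: that(1))
  qed
  have "(of_int (- n - 1) gchoose i) * (1 / \<alpha>) powi (- m - 1) * (- \<beta> / \<alpha>) ^ i =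
      \<alpha> * ((of_int m gchoose i) * \<alpha> powi n * \<beta> ^ i)"
    unfolding B P by (rule eq[OF E C])
  moreover have "nat (- n - 1 - (- m - 1)) = i" by (simp add: i_def)
  ultimately show ?thesis
    using True by (simp add: affine_pow_def flip: i_def)
next
  case False
  then show ?thesis by (simp add: affine_pow_def)
qed

section \<open>The residues of the commutator against polynomials\<close>

lemma additive_eq_on_monoms:
  fixes F G :: "'a::comm_ring_1 poly \<Rightarrow> 'm::ab_group_add"
  assumes F: "\<And>p q. F (p + q) = F p + F q" and G: "\<And>p q. G (p + q) = G p + G q"
    and "\<And>c i. F (monom c i) = G (monom c i)"
  shows "F p = G p"
proof -
  have z: "F 0 = 0" "G 0 = 0" using F[of 0 0] G[of 0 0] by simp_all
  have "F (\<Sum>i\<in>A. f i) = (\<Sum>i\<in>A. F (f i))" for f :: "nat \<Rightarrow> _" and A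
    by (induction A rule: infinite_finite_induct) (simp_all add: F z)
  moreover have "G (\<Sum>i\<in>A. f i) = (\<Sum>i\<in>A. G (f i))" for f :: "nat \<Rightarrow> _" and A
    by (induction A rule: infinite_finite_induct) (simp_all add: G z)
  ultimately have "F (\<Sum>i\<le>degree p. monom (coeff p i) i) = G (\<Sum>i\<le>degree p. monom (coeff p i) i)"
    by (simp add: assms(3))
  then show ?thesis by (simp only: poly_as_sum_of_monoms)
qed

text \<open>
  The polynomials \<open>Q\<close> with \<open>\<delta>(Q f) = 0\<close> for all \<open>f\<close> form an ideal. If it contains \<open>(x - h) P\<close> and some \<open>Q\<close>
  with \<open>Q(h) \<noteq> 0\<close>, then it contains \<open>Q(h) P\<close>, since \<open>Q - Q(h)\<close> is divisible by \<open>x - h\<close>, and torsion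
  freeness removes the factor \<open>Q(h)\<close>. In this way the linear factors are stripped off one by one. Over
  the field of fractions this would be the statement that an ideal without a common zero is the unit
  ideal; the present form avoids fractions.
\<close>

lemma functional_zero_by_peeling:
  fixes \<delta> :: "'r::comm_ring_1 poly \<Rightarrow> 'm::ab_group_add" and act :: "'r \<Rightarrow> 'm \<Rightarrow> 'm"
  assumes add: "\<And>f g. \<delta> (f + g) = \<delta> f + \<delta> g"
    and smult: "\<And>q f. \<delta> (smult q f) = act q (\<delta> f)"
    and torsion_free: "\<And>q f. q \<noteq> 0 \<Longrightarrow> act q (\<delta> f) = 0 \<Longrightarrow> \<delta> f = 0"
    and product: "\<And>f. \<delta> (prod_list (map (\<lambda>h. [:- h, 1:]) hs) * f) = 0"
    and nonroot: "\<And>h. h \<in> set hs \<Longrightarrow> \<exists>Q. poly Q h \<noteq> 0 \<and> (\<forall>f. \<delta> (Q * f) = 0)"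
  shows "\<delta> f = 0"
  using product nonroot
proof (induction hs arbitrary: f)
  case Nil
  then show ?case by (simp add: mult_1)
next
  case (Cons h hs)
  let ?P = "prod_list (map (\<lambda>h. [:- h, 1:]) hs)"
  obtain Q where Q: "poly Q h \<noteq> 0" "\<And>f. \<delta> (Q * f) = 0" using Cons.prems(2)[of h] by auto
  have "\<delta> (?P * f) = 0" for f
  proof -
    have "smult (poly Q h) (?P * f) + [:- h, 1:] * ?P * (synthetic_div Q h * f) =
        ([:- h, 1:] * synthetic_div Q h + [:poly Q h:]) * (?P * f)"
      by (simp add: algebra_simps)
    also have "\<dots> = Q * (?P * f)" by (simp only: synthetic_div_correct')
    finally have "\<delta> (smult (poly Q h) (?P * f)) + \<delta> ([:- h, 1:] * ?P * (synthetic_div Q h * f)) = 0"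
      using Q(2) by (simp only: add[symmetric])
    then have "act (poly Q h) (\<delta> (?P * f)) = 0"
      using Cons.prems(1)[of "synthetic_div Q h * f"] by (simp only: smult list.map prod_list.Cons add_0_right)
    then show ?thesis using torsion_free Q(1) by blast
  qed
  then show ?case using Cons.IH Cons.prems(2) by auto
qed

text \<open>
  The polynomial \<open>h(x\<^sub>1)\<close>, as a polynomial in \<open>x\<^sub>1\<close> with constant coefficients in \<open>\<complex>[x\<^sub>2]\<close>. Composition with
  it is the change of variables \<open>x\<^sub>1 \<mapsto> h(x\<^sub>1)\<close>.
\<close>

definition lift :: "complex poly \<Rightarrow> complex poly poly" where
  "lift h = [:[:coeff h 0:], [:coeff h 1:]:]"

lemma poly_lift: "degree h = 1 \<Longrightarrow> poly (lift h) q = pcompose h q"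
  by (subst (3) linear_poly_eq) (simp_all add: lift_def pcompose_pCons)

lemma poly_lift_x: "degree h = 1 \<Longrightarrow> poly (lift h) [:0, 1:] = h"
  by (simp add: poly_lift)

lemma pderiv_lift: "degree h = 1 \<Longrightarrow> poly (pderiv (lift h)) q = pderiv h"
  by (subst (3) linear_poly_eq) (simp_all add: lift_def pderiv_pCons)

lemma lift_inverse:
  assumes "degree h = 1" "degree h' = 1" "pcompose h h' = [:0, 1:]"
  shows "pcompose (lift h) (lift h') = [:0, 1:]"
proof -
  have "pcompose [:coeff h 0, coeff h 1:] [:coeff h' 0, coeff h' 1:] = [:0, 1:]"
    using assms linear_poly_eq by metis
  then have "coeff h 0 + coeff h 1 * coeff h' 0 = 0" "coeff h 1 * coeff h' 1 = 1"
    by (simp_all add: pcompose_pCons)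
  then show ?thesis by (simp add: lift_def pcompose_pCons one_pCons mult.commute)
qed

lemma coeff_lift_power: "coeff (lift h ^ i) k = [:coeff ([:coeff h 0, coeff h 1:] ^ i) k:]"
proof (induction i arbitrary: k)
  case 0
  then show ?case by (cases k) (simp_all add: one_pCons)
next
  case (Suc i)
  have "coeff ([:c, d:] * p) k = c * coeff p k + (if k = 0 then 0 else d * coeff p (k - 1))"
    for c d :: "'a::comm_ring_1" and p and k
    by (cases k) (simp_all add: mult_pCons_left)
  from this[of "[:coeff h 0:]"] this[of "coeff h 0"] show ?case
    by (simp add: lift_def Suc.IH[unfolded lift_def One_nat_def])
qed

lemma degree_lift_power: "degree (lift h ^ i) \<le> i"
proof -
  have "degree (lift h) \<le> 1" by (simp add: lift_def)
  then show ?thesis using degree_power_le[of "lift h" i] by (metis le_trans mult_le_mono1 mult_1)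
qed

context complex_space
begin

lemma bmult_monom: "bmult (monom q i) F m = pact q (F (m - int i))"
proof -
  have "(shift ^^ i) F m = F (m - int i)" for F :: "int \<Rightarrow> int \<Rightarrow> 'w"
    by (induction i arbitrary: m) (simp_all add: algebra_simps)
  then show ?thesis
    by (simp add: monom_altdef u.eval_smult u.eval_power_var pact2_eq)
qed

lemma bmult_row_le:
  assumes "degree p \<le> N"
  shows "bmult p F m = (\<Sum>i\<le>N. pact (coeff p i) (F (m - int i)))"
  unfolding bmult_row
  by (rule sum.mono_neutral_left) (use assms in \<open>auto simp: coeff_eq_0\<close>)

lemma laurent_inf_add: "u \<in> laurent_inf \<Longrightarrow> v \<in> laurent_inf \<Longrightarrow> u + v \<in> laurent_inf"
  for u v :: "int \<Rightarrow> 'w"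
proof -
  assume "u \<in> laurent_inf" "v \<in> laurent_inf"
  then obtain N M where "\<forall>n>N. u n = 0" "\<forall>n>M. v n = 0" unfolding laurent_inf_def by blast
  then show "u + v \<in> laurent_inf" by (auto simp: laurent_inf_def intro!: exI[of _ "max N M"])
qed

lemma laurent_inf_diff: "u \<in> laurent_inf \<Longrightarrow> v \<in> laurent_inf \<Longrightarrow> u - v \<in> laurent_inf"
  for u v :: "int \<Rightarrow> 'w"
proof -
  assume "u \<in> laurent_inf" "v \<in> laurent_inf"
  then obtain N M where "\<forall>n>N. u n = 0" "\<forall>n>M. v n = 0" unfolding laurent_inf_def by blast
  then show "u - v \<in> laurent_inf" by (auto simp: laurent_inf_def intro!: exI[of _ "max N M"])
qed

lemma laurent_inf_sum: "(\<And>i. i \<in> A \<Longrightarrow> f i \<in> laurent_inf) \<Longrightarrow> sum f A \<in> laurent_inf"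
  for f :: "'i \<Rightarrow> int \<Rightarrow> 'w"
proof (induction A rule: infinite_finite_induct)
  case (insert i A)
  then have "f i + sum f A \<in> laurent_inf" by (intro laurent_inf_add) auto
  then show ?case by (simp only: sum.insert[OF insert.hyps])
qed (simp_all add: laurent_inf_def)

lemma bmult_row_laurent_inf:
  assumes "\<And>m. F m \<in> laurent_inf"
  shows "bmult p F m \<in> laurent_inf"
  unfolding bmult_row by (intro laurent_inf_sum pact_laurent_inf assms)

end

text \<open>
  What the proof uses of a quasi module: \<open>A a n\<close> is the mode \<open>a\<^sub>n\<close> on \<open>W\<close> of \<open>a \<in> \<gg>\<close>. Covariance is the
  relation \<open>(ga)(x) \<phi>(g) = a(\<Psi>(g)\<^sup>-\<^sup>1(x))\<close> after the change of variables in the residue, and the last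
  assumption is the commutator near the diagonal for generators, whose only contributions are
  \<open>a\<^sub>0 b\<close> and \<open>a\<^sub>1 b\<close>.
\<close>

locale covariant_fields = complex_space sW
  for sW :: "complex \<Rightarrow> 'w::ab_group_add \<Rightarrow> 'w" +
  fixes s :: "complex \<Rightarrow> 'g::ab_group_add \<Rightarrow> 'g"
    and br :: "'g \<Rightarrow> 'g \<Rightarrow> 'g" and form :: "'g \<Rightarrow> 'g \<Rightarrow> complex"
    and \<Gamma> :: "('g \<Rightarrow> 'g) set" and \<Psi> :: "('g \<Rightarrow> 'g) \<Rightarrow> complex poly"
    and ginv :: "('g \<Rightarrow> 'g) \<Rightarrow> ('g \<Rightarrow> 'g)"
    and l :: complex
    and A :: "'g \<Rightarrow> int \<Rightarrow> 'w \<Rightarrow> 'w"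
  assumes s: "vector_space s" and br: "bilinear_map s s br" and form: "bilinear_map s (*) form"
    and \<Gamma>_linear: "\<And>g. g \<in> \<Gamma> \<Longrightarrow> Vector_Spaces.linear s s g"
    and ginv_closed: "\<And>g. g \<in> \<Gamma> \<Longrightarrow> ginv g \<in> \<Gamma>"
    and ginv_left: "\<And>g a. g \<in> \<Gamma> \<Longrightarrow> ginv g (g a) = a"
    and ginv_ginv: "\<And>g. g \<in> \<Gamma> \<Longrightarrow> ginv (ginv g) = g"
    and finite_support: "\<And>a b. finite {g \<in> \<Gamma>. \<not> (br (g a) b = 0 \<and> form (g a) b = 0)}"
    and \<Psi>_degree: "\<And>g. g \<in> \<Gamma> \<Longrightarrow> degree (\<Psi> g) = 1"
    and \<Psi>_inverse: "\<And>g. g \<in> \<Gamma> \<Longrightarrow> pcompose (\<Psi> g) (\<Psi> (ginv g)) = [:0, 1:]"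
    and \<Psi>_inj: "inj_on \<Psi> \<Gamma>"
    and A_add: "\<And>a b n w. A (a + b) n w = A a n w + A b n w"
    and A_scale: "\<And>c a n w. A (s c a) n w = sW c (A a n w)"
    and A_Eo: "\<And>a. A a \<in> Eo sW"
    and covariance: "\<And>g a n w. g \<in> \<Gamma> \<Longrightarrow>
      A (g a) n w = (\<Sum>k | k \<le> n \<and> A a k w \<noteq> 0. sW (affine_pow (\<Psi> g) n k) (A a k w))"
    and locality: "\<And>a b. \<exists>hs. set hs \<subseteq> \<Psi> ` \<Gamma> \<and>
      (\<forall>w. bipoly_mult sW (prod_list (map (\<lambda>h. [:- h, 1:]) hs)) (field_comm (A a) (A b) w) = 0)"
    and near_diagonal: "\<And>a b. \<exists>T. poly T [:0, 1:] \<noteq> 0 \<and> (\<forall>w f.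
      bipoly_mult sW (T * f) (field_comm (A a) (A b) w) (- 1) =
        poly_act sW (poly (T * f) [:0, 1:]) (apply_field (A (br a b)) w) +
        poly_act sW (poly (pderiv (T * f)) [:0, 1:])
          (\<lambda>n. if n = 0 then sW (l * form a b) w else 0))"
begin

text \<open>
  The commutator \<open>[a(x\<^sub>1), b(x\<^sub>2)]\<close> will turn out to be supported at \<open>x\<^sub>1 = h(x\<^sub>2)\<close>, where \<open>h = \<Psi>(g\<^sup>-\<^sup>1)\<close> and
  \<open>g\<close> runs through the finitely many elements with \<open>[ga, b] \<noteq> 0\<close> or \<open>\<langle>ga, b\<rangle> \<noteq> 0\<close>.
\<close>

abbreviation pole :: "('g \<Rightarrow> 'g) \<Rightarrow> complex poly" where "pole g \<equiv> \<Psi> (ginv g)"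

abbreviation C where "C a b w \<equiv> field_comm (A a) (A b) w"

abbreviation scalar_series :: "complex \<Rightarrow> 'w \<Rightarrow> int \<Rightarrow> 'w" where
  "scalar_series c w \<equiv> (\<lambda>n. if n = 0 then sW c w else 0)"

text \<open>
  The residue in \<open>x\<^sub>1\<close> of \<open>f(x\<^sub>1, x\<^sub>2) [a(x\<^sub>1), b(x\<^sub>2)] w\<close>. For \<open>f = x\<^sub>1^i\<close> it is \<open>[a\<^sub>i, b(x\<^sub>2)] w\<close>, so only the
  nonnegative modes of \<open>a\<close> are seen.
\<close>

definition \<Lambda> :: "'g \<Rightarrow> 'g \<Rightarrow> 'w \<Rightarrow> complex poly poly \<Rightarrow> int \<Rightarrow> 'w" where
  "\<Lambda> a b w f = bmult f (C a b w) (- 1)"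

text \<open>
  The contribution to this residue of a delta function at \<open>x\<^sub>1 = h(x\<^sub>2)\<close>, which evaluates \<open>f\<close> there, and of
  its derivative. The factor \<open>h'\<close> comes from differentiating \<open>f(h(x))\<close>.
\<close>

definition point_term :: "'g \<Rightarrow> 'g \<Rightarrow> 'w \<Rightarrow> ('g \<Rightarrow> 'g) \<Rightarrow> complex poly poly \<Rightarrow> int \<Rightarrow> 'w" where
  "point_term a b w g f =
     pact (poly f (pole g)) (apply_field (A (br (g a) b)) w) +
     pact (poly (pderiv f) (pole g) * pderiv (pole g)) (scalar_series (l * form (g a) b) w)"

definition supp :: "'g \<Rightarrow> 'g \<Rightarrow> ('g \<Rightarrow> 'g) set" where
  "supp a b = {g \<in> \<Gamma>. \<not> (br (g a) b = 0 \<and> form (g a) b = 0)}"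

lemma A_linear: "Vector_Spaces.linear sW sW (A a n)"
  using A_Eo[of a] unfolding Eo_def by blast

lemma A_0: "A 0 n w = 0"
  using A_add[of 0 0 n w] by simp

lemma A_laurent: "apply_field (A a) w \<in> laurent_inf"
  using A_Eo[of a] unfolding Eo_def by blast

lemma A_zero: "A a n 0 = 0"
  by (rule linear_props(2)[OF A_linear])

lemma A_truncated: "\<exists>N. \<forall>n<N. A a n w = 0"
proof -
  obtain K where K: "\<forall>k>K. apply_field (A a) w k = 0"
    using A_laurent[of a w] unfolding laurent_inf_def by blast
  have "A a n w = 0" if "n < - K - 1" for n
    using K[rule_format, of "- n - 1"] that by (simp add: apply_field_def)
  then show ?thesis by blast
qed

lemma pole_degree: "g \<in> \<Gamma> \<Longrightarrow> degree (pole g) = 1"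
  using \<Psi>_degree ginv_closed by blast

lemma pole_inj: "g \<in> \<Gamma> \<Longrightarrow> g' \<in> \<Gamma> \<Longrightarrow> pole g = pole g' \<Longrightarrow> g = g'"
  using \<Psi>_inj ginv_closed ginv_ginv unfolding inj_on_def by metis

lemma pole_image: "\<Psi> ` \<Gamma> = pole ` \<Gamma>"
  using ginv_closed ginv_ginv by (force simp: image_iff)

lemma C_row_laurent: "C a b w m \<in> laurent_inf"
proof -
  have "C a b w m = (\<lambda>n. A a (- m - 1) (apply_field (A b) w n)) - apply_field (A b) (A a (- m - 1) w)"
    by (simp add: fun_eq_iff field_comm_def field_prod_def apply_field_def)
  moreover have "(\<lambda>n. A a (- m - 1) (apply_field (A b) w n)) \<in> laurent_inf"
  proof -
    obtain K where "\<forall>k>K. apply_field (A b) w k = 0"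
      using A_laurent[of b w] unfolding laurent_inf_def by blast
    then show ?thesis by (auto simp: laurent_inf_def A_zero intro!: exI[of _ K])
  qed
  ultimately show ?thesis using A_laurent laurent_inf_diff by metis
qed

lemma \<Lambda>_add: "\<Lambda> a b w (f + g) = \<Lambda> a b w f + \<Lambda> a b w g"
  by (simp add: \<Lambda>_def u.eval_add_left)

lemma \<Lambda>_smult: "\<Lambda> a b w (smult q f) = pact q (\<Lambda> a b w f)"
  by (simp add: \<Lambda>_def u.eval_smult pact2_eq)

lemma \<Lambda>_laurent: "\<Lambda> a b w f \<in> laurent_inf"
  unfolding \<Lambda>_def by (rule bmult_row_laurent_inf) (rule C_row_laurent)

lemma point_term_add: "point_term a b w g (f + f') = point_term a b w g f + point_term a b w g f'"
  by (simp add: point_term_def pderiv_add distrib_right u1.eval_add_left)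

lemma point_term_smult: "point_term a b w g (smult q f) = pact q (point_term a b w g f)"
  by (simp add: point_term_def pderiv_smult mult.assoc u1.eval_mult u1.eval_add_right)

lemma scalar_series_laurent: "scalar_series c w \<in> laurent_inf"
  by (auto simp: laurent_inf_def intro!: exI[of _ 0])

lemma point_term_laurent: "point_term a b w g f \<in> laurent_inf"
  unfolding point_term_def
  by (intro laurent_inf_add pact_laurent_inf A_laurent scalar_series_laurent)

text \<open>
  For nonnegative exponents the expansion of \<open>h(x)^i\<close> is a polynomial, so that the relation between
  the modes of \<open>a\<close> and of \<open>ga\<close> has no infinite tail.
\<close>

lemma covariance_nonneg:
  assumes "g \<in> \<Gamma>"
  shows "A a (int i) w = (\<Sum>k\<le>i. sW (coeff (pole g ^ i) k) (A (g a) (int k) w))"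
proof -
  have d: "degree (pole g) = 1" by (rule pole_degree[OF assms])
  let ?S = "{k. k \<le> int i \<and> A (g a) k w \<noteq> 0}"
  obtain N where N: "\<forall>n<N. A (g a) n w = 0" using A_truncated by blast
  have fin: "finite ?S"
    by (rule finite_subset[of _ "{N..int i}"]) (use N in force)+
  have "A a (int i) w = (\<Sum>k\<in>?S. sW (affine_pow (pole g) (int i) k) (A (g a) k w))"
    using covariance[OF ginv_closed[OF assms], of "g a"] by (simp add: ginv_left[OF assms])
  also have "\<dots> = (\<Sum>k\<in>{0..int i}. sW (affine_pow (pole g) (int i) k) (A (g a) k w))"
    by (rule sum.mono_neutral_cong[OF _ fin]) (auto simp: affine_pow_nat[OF d])
  also have "\<dots> = (\<Sum>k\<le>i. sW (coeff (pole g ^ i) k) (A (g a) (int k) w))"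
    by (rule sum.reindex_bij_witness[of _ int nat]) (auto simp: affine_pow_nat[OF d])
  finally show ?thesis .
qed

text \<open>
  The change of variables \<open>x\<^sub>1 = h(y)\<close> in the residue, where \<open>a(h(y)) h'\<close> is the field of \<open>ga\<close>.
\<close>

lemma \<Lambda>_covariance:
  assumes "g \<in> \<Gamma>"
  shows "\<Lambda> a b w f = \<Lambda> (g a) b w (pcompose f (lift (pole g)))"
proof (rule additive_eq_on_monoms[where p = f])
  show "\<Lambda> a b w (p + q) = \<Lambda> a b w p + \<Lambda> a b w q" for p q by (rule \<Lambda>_add)
  show "\<Lambda> (g a) b w (pcompose (p + q) (lift (pole g))) =
    \<Lambda> (g a) b w (pcompose p (lift (pole g))) + \<Lambda> (g a) b w (pcompose q (lift (pole g)))" for p q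
    by (simp add: pcompose_add \<Lambda>_add)
  fix q i
  let ?h = "pole g"
  have h: "[:coeff ?h 0, coeff ?h 1:] = ?h" using linear_poly_eq[OF pole_degree[OF assms]] by simp
  have const: "pact [:c:] u n = sW c (u n)" for c u n by (simp add: u1.eval_const)
  have row: "C a b w (- 1 - int i) n =
      (\<Sum>k\<le>i. sW (coeff (?h ^ i) k) (C (g a) b w (- 1 - int k) n))" for n
  proof -
    have lin: "A b m (\<Sum>k\<in>K. sW (c k) (u k)) = (\<Sum>k\<in>K. sW (c k) (A b m (u k)))" for m K c and u :: "nat \<Rightarrow> 'w"
      by (induction K rule: infinite_finite_induct) (simp_all add: A_zero linear_props[OF A_linear])
    show ?thesis
      by (simp add: field_comm_def field_prod_def apply_field_def covariance_nonneg[OF assms, of a i]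
          lin scale_right_diff_distrib sum_subtractf)
  qed
  have "\<Lambda> (g a) b w (lift ?h ^ i) = C a b w (- 1 - int i)"
    unfolding \<Lambda>_def
    by (rule ext)
      (simp add: bmult_row_le[OF degree_lift_power] coeff_lift_power h[unfolded One_nat_def] row const sum_fun_apply)
  moreover have "pcompose (monom q i) (lift ?h) = smult q (lift ?h ^ i)"
  proof -
    have "pcompose (r ^ j) k = pcompose r k ^ j" for r k :: "complex poly poly" and j
      by (induction j) (simp_all add: pcompose_mult, simp add: one_pCons)
    then show ?thesis by (simp add: monom_altdef pcompose_smult pcompose_pCons)
  qed
  ultimately show "\<Lambda> a b w (monom q i) = \<Lambda> (g a) b w (pcompose (monom q i) (lift ?h))"
    by (simp add: \<Lambda>_smult) (simp add: \<Lambda>_def bmult_monom)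
qed

text \<open>
  After the change of variables the point \<open>x\<^sub>1 = h(x\<^sub>2)\<close> becomes the diagonal, where the commutator of \<open>ga\<close>
  and \<open>b\<close> is known. The multiplier \<open>T\<close> found there is transported back with the inverse \<open>\<Psi>(g)\<close> of \<open>h\<close>.
\<close>

lemma \<Lambda>_near_pole:
  assumes "g \<in> \<Gamma>"
  shows "\<exists>Q. poly Q (pole g) \<noteq> 0 \<and> (\<forall>w f. \<Lambda> a b w (Q * f) = point_term a b w g (Q * f))"
proof -
  let ?h = "pole g" and ?k = "\<Psi> g"
  note d = pole_degree[OF assms] \<Psi>_degree[OF assms]
  obtain T where T: "poly T [:0, 1:] \<noteq> 0"
    "\<And>w f. bipoly_mult sW (T * f) (C (g a) b w) (- 1) =
        poly_act sW (poly (T * f) [:0, 1:]) (apply_field (A (br (g a) b)) w) +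
        poly_act sW (poly (pderiv (T * f)) [:0, 1:]) (scalar_series (l * form (g a) b) w)"
    using near_diagonal by blast
  \<comment> \<open>so that \<open>Q\<close> becomes \<open>T\<close> under \<open>x\<^sub>1 \<mapsto> h(x\<^sub>1)\<close>\<close>
  define Q where "Q = pcompose T (lift ?k)"
  have QT: "pcompose Q (lift ?h) = T"
    unfolding Q_def
    by (simp add: pcompose_assoc[symmetric] lift_inverse[OF d(2,1) \<Psi>_inverse[OF assms]])
  have "poly Q ?h = poly T [:0, 1:]"
    by (simp add: Q_def poly_pcompose poly_lift[OF d(2)] \<Psi>_inverse[OF assms])
  moreover have "\<Lambda> a b w (Q * f) = point_term a b w g (Q * f)" for w f
  proof -
    have "\<Lambda> a b w (Q * f) = \<Lambda> (g a) b w (pcompose (Q * f) (lift ?h))"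
      by (rule \<Lambda>_covariance[OF assms])
    also have "pcompose (Q * f) (lift ?h) = T * pcompose f (lift ?h)"
      by (simp add: pcompose_mult QT)
    finally have "\<Lambda> a b w (Q * f) =
        pact (poly (T * pcompose f (lift ?h)) [:0, 1:]) (apply_field (A (br (g a) b)) w) +
        pact (poly (pderiv (T * pcompose f (lift ?h))) [:0, 1:]) (scalar_series (l * form (g a) b) w)"
      unfolding \<Lambda>_def T(2) .
    also have "T * pcompose f (lift ?h) = pcompose (Q * f) (lift ?h)"
      by (simp add: pcompose_mult QT)
    finally show ?thesis
      unfolding point_term_def pderiv_pcompose
      by (simp only: poly_pcompose poly_mult poly_lift_x[OF d(1)] pderiv_lift[OF d(1)])
  qed
  ultimately show ?thesis using T(1) by metis
qed

text \<open>
  A delta function and its derivative at \<open>h\<close> are killed by a polynomial with a double zero at \<open>h\<close>.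
\<close>

lemma point_term_square:
  "point_term a b w g ([:- pole g, 1:] ^ 2 * f) = 0"
proof -
  have "poly (q ^ 2 * f) r = 0" "poly (pderiv (q ^ 2 * f)) r = 0" if "poly q r = 0"
    for q f :: "complex poly poly" and r
    using that by (simp_all add: power2_eq_square pderiv_mult)
  from this[of "[:- pole g, 1:]" "pole g"] show ?thesis
    by (simp add: point_term_def)
qed

lemma point_term_outside: "g \<in> \<Gamma> \<Longrightarrow> g \<notin> supp a b \<Longrightarrow> point_term a b w g f = 0"
proof -
  assume "g \<in> \<Gamma>" "g \<notin> supp a b"
  then have z: "br (g a) b = 0" "form (g a) b = 0" by (auto simp: supp_def)
  moreover have "apply_field (A 0) w = 0" by (simp add: fun_eq_iff apply_field_def A_0)
  moreover have "scalar_series (l * form (g a) b) w = 0" using z by (auto simp: fun_eq_iff)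
  ultimately show ?thesis
    unfolding point_term_def by (simp only: Modules.module.scale_zero_right[OF u1.module_eval] add_0)
qed

text \<open>
  The difference \<open>\<delta>\<close> of the two sides is killed by a product of factors \<open>x\<^sub>1 - h\<close> with \<open>h \<in> \<Psi>(\<Gamma>)\<close>: those from
  locality together with the squares for the contributing points. For each such \<open>h\<close>, belonging to \<open>g\<close>,
  it is also killed by \<open>Q R\<close> with \<open>Q\<close> as in the previous lemma and \<open>R\<close> the product of the squares for
  the other contributing points. The injectivity of \<open>\<Psi>\<close> enters here: distinct \<open>g\<close> have distinct \<open>h\<close>, so
  \<open>R(h) \<noteq> 0\<close> and the linear factors can be peeled off.
\<close>

theorem nonnegative_commutator: "\<Lambda> a b w f = (\<Sum>g\<in>supp a b. point_term a b w g f)"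
proof -
  define \<delta> where "\<delta> f = \<Lambda> a b w f - (\<Sum>g\<in>supp a b. point_term a b w g f)" for f
  have fin: "finite (supp a b)" unfolding supp_def by (rule finite_support)
  obtain hs where hs: "set hs \<subseteq> \<Psi> ` \<Gamma>"
    "\<And>w. bmult (prod_list (map (\<lambda>h. [:- h, 1:]) hs)) (C a b w) = 0"
    using locality by blast
  obtain gs where gs: "set gs = supp a b" using finite_list[OF fin] by blast
  let ?P = "\<lambda>hs. prod_list (map (\<lambda>h. [:- h, 1:]) hs) :: complex poly poly"
  define ks where "ks = hs @ map pole gs @ map pole gs"
  have dvd: "[:- pole g, 1:] ^ 2 dvd ?P ks" if "g \<in> supp a b" for g
  proof -
    have "[:- pole g, 1:] dvd ?P (map pole gs)"
      using that gs by (intro prod_list_dvd) auto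
    then have "[:- pole g, 1:] * [:- pole g, 1:] dvd ?P (map pole gs) * ?P (map pole gs)"
      by (intro mult_dvd_mono)
    then show ?thesis
      unfolding ks_def power2_eq_square by (simp only: map_append prod_list.append dvd_mult)
  qed
  have "\<delta> f = 0"
  proof (rule functional_zero_by_peeling[where act = pact and hs = ks])
    show "\<delta> (f + g) = \<delta> f + \<delta> g" for f g
      by (simp add: \<delta>_def \<Lambda>_add point_term_add sum.distrib)
    have pact_sum: "pact q (sum u K) = (\<Sum>i\<in>K. pact q (u i))" for q K and u :: "('g \<Rightarrow> 'g) \<Rightarrow> int \<Rightarrow> 'w"
      by (rule Modules.module.scale_sum_right[OF u1.module_eval])
    show "\<delta> (smult q f) = pact q (\<delta> f)" for q f
      by (simp add: \<delta>_def \<Lambda>_smult point_term_smult pact_sum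
          Modules.module.scale_right_diff_distrib[OF u1.module_eval])
    show "\<delta> f = 0" if "q \<noteq> 0" "pact q (\<delta> f) = 0" for q f
    proof (rule pact_torsion_free[OF that(2,1)])
      show "\<delta> f \<in> laurent_inf"
        unfolding \<delta>_def by (intro laurent_inf_diff \<Lambda>_laurent laurent_inf_sum point_term_laurent)
    qed
    show "\<delta> (?P ks * f) = 0" for f
    proof -
      have "?P ks * f = (?P (map pole gs @ map pole gs) * f) * ?P hs"
        unfolding ks_def by (simp only: map_append prod_list.append mult_ac)
      then have "\<Lambda> a b w (?P ks * f) = 0"
        unfolding \<Lambda>_def
        by (simp only: u.eval_mult hs(2)
            Modules.module.scale_zero_right[OF u.module_eval] zero_fun_apply)
      moreover have "point_term a b w g (?P ks * f) = 0" if "g \<in> supp a b" for g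
      proof -
        obtain c where "?P ks = [:- pole g, 1:] ^ 2 * c" using dvd[OF \<open>g \<in> supp a b\<close>] unfolding dvd_def by blast
        then show ?thesis by (simp only: mult.assoc point_term_square)
      qed
      ultimately show ?thesis by (simp add: \<delta>_def)
    qed
    fix h assume "h \<in> set ks"
    then have "h \<in> pole ` \<Gamma>"
      using hs(1) gs pole_image by (auto simp: ks_def supp_def)
    then obtain g where g: "g \<in> \<Gamma>" "h = pole g" by blast
    obtain Q where Q: "poly Q (pole g) \<noteq> 0" "\<And>w f. \<Lambda> a b w (Q * f) = point_term a b w g (Q * f)"
      using \<Lambda>_near_pole[OF g(1)] by blast
    let ?R = "\<Prod>g'\<in>supp a b - {g}. [:- pole g', 1:] ^ 2"
    have "poly ?R (pole g) \<noteq> 0"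
      using fin g(1) pole_inj by (auto simp: poly_prod poly_power supp_def)
    then have "poly (Q * ?R) h \<noteq> 0" using Q(1) g(2) by simp
    moreover have "\<delta> (Q * ?R * f) = 0" for f
    proof -
      have "point_term a b w g' (Q * ?R * f) = 0" if "g' \<in> supp a b - {g}" for g'
      proof -
        have "?R = [:- pole g', 1:] ^ 2 * (\<Prod>g'\<in>supp a b - {g} - {g'}. [:- pole g', 1:] ^ 2)"
          using that fin by (intro prod.remove) auto
        then have "Q * ?R * f = [:- pole g', 1:] ^ 2 *
            (Q * (\<Prod>g'\<in>supp a b - {g} - {g'}. [:- pole g', 1:] ^ 2) * f)"
          by (simp only: mult_ac)
        then show ?thesis by (simp only: point_term_square)
      qed
      then have "(\<Sum>g\<in>supp a b. point_term a b w g (Q * ?R * f)) = point_term a b w g (Q * ?R * f)"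
        using fin point_term_outside[OF g(1), of a b w]
        by (cases "g \<in> supp a b") (simp_all add: sum.remove[of _ g])
      then show ?thesis using Q(2)[of w "?R * f"] by (simp add: \<delta>_def mult.assoc)
    qed
    ultimately show "\<exists>Q. poly Q h \<noteq> 0 \<and> (\<forall>f. \<delta> (Q * f) = 0)" by blast
  qed
  then show ?thesis by (simp add: \<delta>_def)
qed

end

section \<open>The commutator of arbitrary modes\<close>

lemma affine_pow_laurent: "affine_pow h m \<in> laurent_inf"
  by (auto simp: laurent_inf_def affine_pow_def intro!: exI[of _ m])

text \<open>
  The product rule for \<open>h p\<close>, where \<open>h' = coeff h 1\<close>.
\<close>

lemma formal_deriv_pact:
  fixes p :: "int \<Rightarrow> complex"
  assumes "degree h = 1"
  shows "formal_deriv (*) (poly_act (*) h p) n = poly_act (*) h (formal_deriv (*) p) n + coeff h 1 * p n"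
  using assms by (simp add: formal_deriv_def cc.pact_eq) (simp add: ring_distribs)

context complex_space
begin

lemma conv_box:
  assumes "\<forall>n>N. p n = 0" "\<forall>n>M. u n = 0"
  shows "cauchy_prod sW p u k = (\<Sum>m\<in>{k - M..N}. sW (p m) (u (k - m)))"
  by (rule cauchy_prod_box) (use assms in auto)

lemma conv_laurent:
  assumes "p \<in> laurent_inf" "u \<in> laurent_inf"
  shows "cauchy_prod sW p u \<in> laurent_inf"
proof -
  obtain N M where N: "\<forall>n>N. p n = 0" and M: "\<forall>n>M. u n = 0"
    using assms unfolding laurent_inf_def by blast
  have "cauchy_prod sW p u k = 0" if "k > N + M" for k
    using conv_box[OF N M, of k] that by simp
  then show ?thesis unfolding laurent_inf_def by blast
qed

lemma conv_pact:
  assumes "p \<in> laurent_inf" "u \<in> laurent_inf" "degree h = 1"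
  shows "cauchy_prod sW (poly_act (*) h p) u = pact h (cauchy_prod sW p u)"
proof
  fix k
  obtain N M where N: "\<forall>n>N. p n = 0" and M: "\<forall>n>M. u n = 0"
    using assms unfolding laurent_inf_def by blast
  have N': "\<forall>n>N + 1. p n = 0" and M': "\<forall>n>M + 1. u n = 0" using N M by auto
  have hp: "poly_act (*) h p n = coeff h 0 * p n + coeff h 1 * p (n - 1)" for n
    using assms by (simp add: cc.pact_eq)
  then have hN: "\<forall>n>N + 1. poly_act (*) h p n = 0" using N by simp
  have "cauchy_prod sW (poly_act (*) h p) u k =
      (\<Sum>m\<in>{k - (M + 1)..N + 1}. sW (coeff h 0 * p m) (u (k - m))) +
      (\<Sum>m\<in>{k - (M + 1)..N + 1}. sW (coeff h 1 * p (m - 1)) (u (k - m)))"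
    unfolding conv_box[OF hN M'] by (simp add: hp scale_left_distrib sum.distrib)
  also have "(\<Sum>m\<in>{k - (M + 1)..N + 1}. sW (coeff h 0 * p m) (u (k - m))) =
      sW (coeff h 0) (cauchy_prod sW p u k)"
    unfolding conv_box[OF N' M'] by (simp add: scale_sum_right)
  also have "(\<Sum>m\<in>{k - (M + 1)..N + 1}. sW (coeff h 1 * p (m - 1)) (u (k - m))) =
      (\<Sum>m\<in>{k - 1 - (M + 1)..N}. sW (coeff h 1 * p m) (u (k - 1 - m)))"
    by (rule sum.reindex_bij_witness[of _ "\<lambda>m. m + 1" "\<lambda>m. m - 1"]) (auto simp: algebra_simps)
  also have "\<dots> = sW (coeff h 1) (cauchy_prod sW p u (k - 1))"
    unfolding conv_box[OF N M'] by (simp add: scale_sum_right)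
  finally show "cauchy_prod sW (poly_act (*) h p) u k = pact h (cauchy_prod sW p u) k"
    using assms by (simp add: pact_eq)
qed

lemma coeff_pact: "pact h (\<lambda>n. sW (p n) w) = (\<lambda>n. sW (poly_act (*) h p n) w)"
  by (simp add: fun_eq_iff pact_eq cc.pact_eq scale_sum_left)

text \<open>
  The equation \<open>P D = 0\<close> is a linear recurrence for the coefficients of the powers of \<open>x\<^sub>1\<close>. Its coefficient
  \<open>P(0, x\<^sub>2) \<noteq> 0\<close> allows each of them to be computed from those with smaller exponent.
\<close>

lemma zero_from_negative_rows:
  assumes P: "bmult P D = 0" "coeff P 0 \<noteq> 0"
    and neg: "\<And>m. m < 0 \<Longrightarrow> D m = 0" and row: "\<And>m. D m \<in> laurent_inf"
  shows "D m = 0"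
proof (cases "m < 0")
  case True
  then show ?thesis by (rule neg)
next
  case False
  have "D (int j) = 0" for j
  proof (induction j rule: less_induct)
    case (less j)
    have D: "D m = 0" if "m < int j" for m
      using less.IH[of "nat m"] neg[of m] that by (cases "m < 0") auto
    have "0 = bmult P D (int j)" by (simp add: P(1))
    also have "\<dots> = (\<Sum>i\<in>{0}. pact (coeff P i) (D (int j - int i)))"
      unfolding bmult_row
      by (rule sum.mono_neutral_right)
        (auto simp: D Modules.module.scale_zero_right[OF u1.module_eval])
    finally have "pact (coeff P 0) (D (int j)) = 0" by simp
    then show ?case using pact_torsion_free P(2) row by blast
  qed
  from this[of "nat m"] show ?thesis using False by simp
qed

end

context covariant_fields
begin

text \<open>
  The coefficient of \<open>x\<^sub>1^m\<close> in the sum of the delta function and its derivative at \<open>x\<^sub>1 = h(x\<^sub>2)\<close>. It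
  contains \<open>h(x\<^sub>2)^(-m-1)\<close> and its derivative, and these make sense for all \<open>m\<close> when expanded in
  negative powers of \<open>x\<^sub>2\<close>.
\<close>

definition point_row :: "'g \<Rightarrow> 'g \<Rightarrow> 'w \<Rightarrow> ('g \<Rightarrow> 'g) \<Rightarrow> int \<Rightarrow> int \<Rightarrow> 'w" where
  "point_row a b w g m =
     cauchy_prod sW (affine_pow (pole g) (- m - 1)) (apply_field (A (br (g a) b)) w) +
     (\<lambda>n. sW (formal_deriv (*) (affine_pow (pole g) (- m - 1)) n) (sW (l * form (g a) b) w))"

lemma point_row_laurent: "point_row a b w g m \<in> laurent_inf"
proof -
  obtain N where "\<forall>n>N. affine_pow (pole g) (- m - 1) n = 0"
    using affine_pow_laurent unfolding laurent_inf_def by blast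
  then have "(\<lambda>n. sW (formal_deriv (*) (affine_pow (pole g) (- m - 1)) n) (sW (l * form (g a) b) w)) \<in> laurent_inf"
    by (auto simp: laurent_inf_def formal_deriv_def intro!: exI[of _ N])
  then show ?thesis
    unfolding point_row_def by (intro laurent_inf_add conv_laurent affine_pow_laurent A_laurent)
qed

text \<open>
  Multiplication by \<open>x\<^sub>1 - h(x\<^sub>2)\<close> kills the delta function and turns its derivative into a delta function.
\<close>

lemma point_row_step:
  assumes "g \<in> \<Gamma>"
  shows "point_row a b w g (m - 1) = pact (pole g) (point_row a b w g m) +
    (\<lambda>n. sW (affine_pow (pole g) (- m - 1) n) (sW (coeff (pole g) 1 * (l * form (g a) b)) w))"
proof -
  note d = pole_degree[OF assms]
  have S: "affine_pow (pole g) (- (m - 1) - 1) = poly_act (*) (pole g) (affine_pow (pole g) (- m - 1))"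
    using affine_pow_Suc[OF d, of "- m - 1"] by simp
  have D: "(\<lambda>n. sW (formal_deriv (*) (poly_act (*) (pole g) p) n) v) =
      pact (pole g) (\<lambda>n. sW (formal_deriv (*) p n) v) + (\<lambda>n. sW (p n) (sW (coeff (pole g) 1) v))" for p v
    by (simp add: formal_deriv_pact[OF d] coeff_pact fun_eq_iff scale_left_distrib mult.commute)
  show ?thesis
    unfolding point_row_def S D
    by (simp only: conv_pact[OF affine_pow_laurent A_laurent d] u1.eval_add_right add.assoc scale_scale)
qed

lemma point_row_square:
  assumes "g \<in> \<Gamma>"
  shows "bmult ([:- pole g, 1:] ^ 2) (point_row a b w g) = 0"
proof -
  note d = pole_degree[OF assms]
  define v where "v = sW (coeff (pole g) 1 * (l * form (g a) b)) w"
  have lin: "bmult [:- pole g, 1:] F m = F (m - 1) - pact (pole g) (F m)" for F m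
    unfolding u.eval_linear_factor by (simp add: fun_eq_iff pact2_eq)
  have "bmult [:- pole g, 1:] (point_row a b w g) = (\<lambda>m n. sW (affine_pow (pole g) (- m - 1) n) v)"
    by (rule ext) (simp add: lin point_row_step[OF assms] v_def)
  moreover have "bmult [:- pole g, 1:] (\<lambda>m n. sW (affine_pow (pole g) (- m - 1) n) v) = 0"
  proof
    fix m
    have "affine_pow (pole g) (- (m - 1) - 1) = poly_act (*) (pole g) (affine_pow (pole g) (- m - 1))"
      using affine_pow_Suc[OF d, of "- m - 1"] by simp
    then show "bmult [:- pole g, 1:] (\<lambda>m n. sW (affine_pow (pole g) (- m - 1) n) v) m = 0 m"
      unfolding lin coeff_pact by simp
  qed
  ultimately show ?thesis by (simp only: power2_eq_square u.eval_mult)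
qed

text \<open>
  Both sides satisfy the same recurrence in \<open>i\<close>, which comes from \<open>h^(i+1) = h h^i\<close> and the product rule,
  and they agree at \<open>i = 0\<close>.
\<close>

lemma point_row_nonneg:
  assumes "g \<in> \<Gamma>"
  shows "point_row a b w g (- 1 - int i) = point_term a b w g (monom 1 i)"
proof (induction i)
  case 0
  obtain M where M: "\<forall>n>M. apply_field (A (br (g a) b)) w n = 0"
    using A_laurent unfolding laurent_inf_def by blast
  have conv_1: "cauchy_prod sW (affine_pow (pole g) 0) u = u" if "\<forall>n>M. u n = 0" for u M
  proof
    fix k
    have "\<forall>n>max 0 (k - M). affine_pow (pole g) 0 n = 0" by (simp add: affine_pow_0)
    then have "cauchy_prod sW (affine_pow (pole g) 0) u k =
        (\<Sum>m\<in>{k - M..max 0 (k - M)}. sW (affine_pow (pole g) 0 m) (u (k - m)))"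
      by (rule conv_box[OF _ that])
    also have "\<dots> = (\<Sum>m\<in>{k - M..max 0 (k - M)}. if m = 0 then u k else 0)"
      by (rule sum.cong) (auto simp: affine_pow_0)
    also have "\<dots> = (if k - M \<le> 0 then u k else 0)" by (simp add: sum.delta)
    finally have eq: "cauchy_prod sW (affine_pow (pole g) 0) u k = (if k - M \<le> 0 then u k else 0)" .
    show "cauchy_prod sW (affine_pow (pole g) 0) u k = u k" unfolding eq using that by auto
  qed
  have "formal_deriv (*) (affine_pow (pole g) 0) n = 0" for n
    by (cases "n = - 1") (simp_all add: formal_deriv_def affine_pow_0)
  then have "point_row a b w g (- 1) = apply_field (A (br (g a) b)) w"
    using conv_1[OF M] by (simp add: point_row_def fun_eq_iff)
  then show ?case
    by (simp add: point_term_def pderiv_monom u1.eval_1 monom_0 pderiv_pCons)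
next
  case (Suc i)
  note d = pole_degree[OF assms]
  let ?e = "scalar_series (l * form (g a) b) w"
  have m: "monom 1 (Suc i) = [:0, 1:] * (monom 1 i :: complex poly poly)" by (simp add: monom_Suc)
  have pm: "poly (monom 1 i) (pole g) = pole g ^ i" by (simp add: poly_monom)
  have pd: "pderiv (pole g) = [:coeff (pole g) 1:]"
    by (subst linear_poly_eq[OF d]) (simp add: pderiv_pCons)
  have "point_term a b w g (monom 1 (Suc i)) =
      pact (pole g) (point_term a b w g (monom 1 i)) + pact (pole g ^ i) (pact [:coeff (pole g) 1:] ?e)"
    by (simp add: point_term_def m pderiv_mult pderiv_pCons pd u1.eval_add_right u1.eval_add_left
        distrib_right distrib_left flip: u1.eval_mult) (simp add: algebra_simps pm smult_add_right u1.eval_add_left)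
  moreover have "(\<lambda>n. sW (affine_pow (pole g) (int i) n) (sW (coeff (pole g) 1 * (l * form (g a) b)) w)) =
      pact (pole g ^ i) (pact [:coeff (pole g) 1:] ?e)"
  proof (induction i)
    case 0
    show ?case by (auto simp: fun_eq_iff u1.eval_1 u1.eval_const affine_pow_0)
  next
    case (Suc i)
    have "(\<lambda>n. sW (affine_pow (pole g) (int (Suc i)) n) v) =
        pact (pole g) (\<lambda>n. sW (affine_pow (pole g) (int i) n) v)" for v
      using affine_pow_Suc[OF d, of "int i"] by (simp add: coeff_pact add.commute)
    then show ?case by (simp only: Suc.IH power_Suc u1.eval_mult)
  qed
  moreover have "point_row a b w g (- 1 - int (Suc i)) = pact (pole g) (point_row a b w g (- 1 - int i)) +
      (\<lambda>n. sW (affine_pow (pole g) (int i) n) (sW (coeff (pole g) 1 * (l * form (g a) b)) w))"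
  proof -
    have "- 1 - int (Suc i) = - 1 - int i - 1" "int i = - (- 1 - int i) - 1" by simp_all
    then show ?thesis using point_row_step[OF assms, of a b w "- 1 - int i"] by metis
  qed
  ultimately show ?case by (simp only: Suc.IH)
qed

text \<open>
  The coefficients of negative powers \<open>x\<^sub>1^(-1-i)\<close> are the residues against \<open>x\<^sub>1^i\<close> and hence known. The
  difference of the two sides is annihilated by the polynomial of locality times the squares of the
  contributing factors, and its constant coefficient in \<open>x\<^sub>1\<close> is nonzero because no \<open>h \<in> \<Psi>(\<Gamma>)\<close> is zero. So
  the remaining coefficients agree as well.
\<close>

theorem commutator_rows: "C a b w m = (\<Sum>g\<in>supp a b. point_row a b w g m)"
proof -
  define D where "D = (\<lambda>m. C a b w m - (\<Sum>g\<in>supp a b. point_row a b w g m))"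
  have fin: "finite (supp a b)" unfolding supp_def by (rule finite_support)
  have sub: "g \<in> \<Gamma>" if "g \<in> supp a b" for g using that by (simp add: supp_def)
  obtain hs where hs: "set hs \<subseteq> \<Psi> ` \<Gamma>"
    "\<And>w. bmult (prod_list (map (\<lambda>h. [:- h, 1:]) hs)) (C a b w) = 0"
    using locality by blast
  let ?P = "prod_list (map (\<lambda>h. [:- h, 1:]) hs) :: complex poly poly"
  let ?R = "\<Prod>g\<in>supp a b. [:- pole g, 1:] ^ 2"
  have zero: "bmult q 0 = 0" for q
    by (rule Modules.module.scale_zero_right[OF u.module_eval])
  have bs: "bmult q (sum F K) = (\<Sum>i\<in>K. bmult q (F i))" for q K and F :: "('g \<Rightarrow> 'g) \<Rightarrow> _"
    by (rule Modules.module.scale_sum_right[OF u.module_eval])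
  have D: "D = C a b w - (\<Sum>g\<in>supp a b. point_row a b w g)"
    by (simp add: D_def fun_eq_iff sum_fun_apply)
  have "bmult (?P * ?R) (C a b w) = 0"
    using hs(2)[of w] zero by (simp only: mult.commute[of ?P] u.eval_mult)
  moreover have "bmult (?P * ?R) (point_row a b w g) = 0" if "g \<in> supp a b" for g
  proof -
    have "?P * ?R = ?P * (\<Prod>g\<in>supp a b - {g}. [:- pole g, 1:] ^ 2) * [:- pole g, 1:] ^ 2"
      using that fin by (simp only: prod.remove[of "supp a b" g] mult_ac)
    then show ?thesis
      by (simp only: u.eval_mult[of _ "[:- pole g, 1:] ^ 2"] point_row_square[OF sub[OF that]] zero)
  qed
  ultimately have kill: "bmult (?P * ?R) D = 0"
    unfolding D by (simp only: bmult_diff bs) simp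
  have "D m = 0"
  proof (rule zero_from_negative_rows[OF kill])
    have nz: "h \<noteq> 0" if "h \<in> \<Psi> ` \<Gamma>" for h using \<Psi>_degree that by force
    have "poly ?P 0 \<noteq> 0"
      using hs(1) by (induction hs) (use nz in auto)
    moreover have "poly ?R 0 \<noteq> 0"
      using nz fin sub pole_image by (auto simp: poly_prod poly_power)
    ultimately show "coeff (?P * ?R) 0 \<noteq> 0"
      by (simp add: poly_0_coeff_0[symmetric])
    show "D m = 0" if "m < 0" for m
    proof -
      obtain i where i: "m = - 1 - int i"
        by (rule that[of "nat (- 1 - m)"]) (use \<open>m < 0\<close> in simp)
      have "C a b w m = \<Lambda> a b w (monom 1 i)"
        by (simp add: \<Lambda>_def bmult_monom i u1.eval_1)
      then show ?thesis
        using nonnegative_commutator[of a b w "monom 1 i"] point_row_nonneg[OF sub]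
        by (simp add: D_def i)
    qed
    show "D m \<in> laurent_inf" for m
      unfolding D_def by (intro laurent_inf_diff C_row_laurent laurent_inf_sum point_row_laurent)
  qed
  then show ?thesis by (simp add: D_def)
qed

end

section \<open>The action on \<open>W\<close> of the algebra before passing to the quotient\<close>

lemma vector_space_ginf_scale:
  assumes "vector_space s"
  shows "vector_space (ginf_scale s)"
proof -
  interpret vector_space s by fact
  show ?thesis
    by unfold_locales
      (simp_all add: ginf_scale_def prod_eq_iff fun_eq_iff scale_right_distrib scale_left_distrib
        distrib_left distrib_right)
qed

lemma subst_affine_box:
  assumes "vector_space s" and "\<forall>n>N. f n = 0" and "L \<le> k"
  shows "subst_affine s f h k = (\<Sum>m\<in>{L..N}. s (affine_pow h m k) (f m))"
proof -
  interpret vector_space s by fact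
  show ?thesis
    unfolding subst_affine_def
  proof (rule sum.mono_neutral_left)
    show "{m. k \<le> m \<and> f m \<noteq> 0} \<subseteq> {L..N}"
    proof
      fix m assume "m \<in> {m. k \<le> m \<and> f m \<noteq> 0}"
      then show "m \<in> {L..N}" using assms(2)[rule_format, of m] assms(3) by (cases "m > N") auto
    qed
    show "\<forall>i\<in>{L..N} - {m. k \<le> m \<and> f m \<noteq> 0}. s (affine_pow h i k) (f i) = 0"
    proof
      fix i assume "i \<in> {L..N} - {m. k \<le> m \<and> f m \<noteq> 0}"
      then show "s (affine_pow h i k) (f i) = 0" by (cases "k \<le> i") (auto simp: affine_pow_bounded)
    qed
  qed simp
qed

lemma subst_affine_bounded:
  assumes "\<forall>n>N. f n = 0"
  shows "k > N \<Longrightarrow> subst_affine s f h k = 0"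
proof -
  assume "k > N"
  then have "{m. k \<le> m \<and> f m \<noteq> 0} = {}" using assms by force
  then show ?thesis by (simp only: subst_affine_def sum.empty)
qed

text \<open>
  This identifies \<open>ginv\<close> with the inverse in the group \<open>\<Gamma>\<close> of automorphisms, to which the bracket refers.
\<close>

locale covariant_Gamma_fields = covariant_fields +
  assumes \<Gamma>_aut: "\<Gamma> \<subseteq> carrier (aut_group s br form)"
    and ginv_eq: "\<And>g. g \<in> \<Gamma> \<Longrightarrow> m_inv (sub_group (aut_group s br form) \<Gamma>) g = ginv g"
begin

abbreviation "G_series \<equiv> Modules.module.span (pointwise s) {tens s a p | a p. p \<in> laurent_inf}"

lemma module_pointwise_s: "Modules.module (pointwise s :: complex \<Rightarrow> (int \<Rightarrow> 'b) \<Rightarrow> int \<Rightarrow> 'b)"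
proof -
  interpret s: vector_space s by (rule s)
  show ?thesis by (rule module_pointwise) unfold_locales
qed

interpretation gs: Modules.module "pointwise s :: complex \<Rightarrow> (int \<Rightarrow> 'b) \<Rightarrow> int \<Rightarrow> 'b"
  by (rule module_pointwise_s)

interpretation s: vector_space s by (rule s)

interpretation gi: complex_space "ginf_scale s"
  unfolding complex_space_def by (rule vector_space_ginf_scale[OF s])

lemma G_series_induct [consumes 1, case_names zero add]:
  assumes "f \<in> G_series" and "Q 0"
    and "\<And>a p f. p \<in> laurent_inf \<Longrightarrow> f \<in> G_series \<Longrightarrow> Q f \<Longrightarrow> Q (tens s a p + f)"
  shows "Q f"
proof -
  have "f \<in> G_series \<and> Q f"
    using assms(1)
  proof (induction rule: gs.span_induct_alt)
    case base
    show ?case using gs.span_zero assms(2) by blast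
  next
    case (step c x y)
    then obtain a p where x: "x = tens s a p" "p \<in> laurent_inf" by auto
    have "pointwise s c x = tens s (s c a) p"
      by (simp add: x tens_def fun_eq_iff mult.commute)
    moreover have "tens s (s c a) p \<in> G_series" using x by (intro gs.span_base) auto
    ultimately have c: "pointwise s c x + y = tens s (s c a) p + y" "tens s (s c a) p + y \<in> G_series"
      using gs.span_add[of "tens s (s c a) p" _ y] step by simp_all
    show ?case unfolding c(1) using c(2) assms(3)[OF x(2)] step by blast
  qed
  then show ?thesis by simp
qed

text \<open>
  The condition under which \<open>\<Sum>n. (f n)\<^sub>n w\<close> is a finite sum. A series in \<open>\<gg>((t\<^sup>-\<^sup>1))\<close>
  need not satisfy it, but a series whose coefficients span a finite-dimensional subspace does.
\<close>

definition tame :: "(int \<Rightarrow> 'b) \<Rightarrow> bool" where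
  "tame f \<longleftrightarrow> (\<exists>N. \<forall>n>N. f n = 0) \<and> (\<forall>w. \<exists>L. \<forall>n<L. A (f n) n w = 0)"

lemma tame_add: "tame f \<Longrightarrow> tame f' \<Longrightarrow> tame (f + f')"
proof -
  assume f: "tame f" and f': "tame f'"
  obtain N N' where N: "\<forall>n>N. f n = 0" "\<forall>n>N'. f' n = 0"
    using f f' unfolding tame_def by blast
  have 1: "\<forall>n>max N N'. (f + f') n = 0" using N by simp
  have 2: "\<exists>L. \<forall>n<L. A ((f + f') n) n w = 0" for w
  proof -
    obtain L L' where "\<forall>n<L. A (f n) n w = 0" "\<forall>n<L'. A (f' n) n w = 0"
      using f f' unfolding tame_def by blast
    then show ?thesis by (intro exI[of _ "min L L'"]) (simp add: A_add)
  qed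
  show ?thesis unfolding tame_def using 1 2 by blast
qed

lemma tame_tens:
  assumes "p \<in> laurent_inf"
  shows "tame (tens s a p)"
proof -
  obtain N where "\<forall>n>N. p n = 0" using assms unfolding laurent_inf_def by blast
  then have "\<forall>n>N. tens s a p n = 0" by (simp add: tens_def)
  moreover have "\<exists>L. \<forall>n<L. A (tens s a p n) n w = 0" for w
    using A_truncated[of a w] by (auto simp: tens_def A_scale)
  ultimately show ?thesis unfolding tame_def by blast
qed

lemma tame_G_series: "f \<in> G_series \<Longrightarrow> tame f"
proof (induction rule: G_series_induct)
  case zero
  show ?case by (simp add: tame_def A_0)
next
  case (add a p f)
  then show ?case by (intro tame_add tame_tens)
qed

text \<open>
  So \<open>a \<otimes> p\<close> acts as the residue of \<open>p(x) a(x)\<close>, and \<open>k\<close> as the scalar \<open>l\<close>.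
\<close>

definition action :: "'b ginf \<Rightarrow> 'a \<Rightarrow> 'a" where
  "action u w = (\<Sum>n | A (fst u n) n w \<noteq> 0. A (fst u n) n w) + sW (snd u * l) w"

lemma action_box:
  assumes "\<forall>n>N. f n = 0" and "\<forall>n<L. A (f n) n w = 0"
  shows "action (f, c) w = (\<Sum>n\<in>{L..N}. A (f n) n w) + sW (c * l) w"
proof -
  have "(\<Sum>n | A (f n) n w \<noteq> 0. A (f n) n w) = (\<Sum>n\<in>{L..N}. A (f n) n w)"
  proof (rule sum.mono_neutral_left)
    show "{n. A (f n) n w \<noteq> 0} \<subseteq> {L..N}"
    proof
      fix n assume "n \<in> {n. A (f n) n w \<noteq> 0}"
      then have "\<not> n > N" "\<not> n < L" using assms A_0 by force+
      then show "n \<in> {L..N}" by simp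
    qed
  qed auto
  then show ?thesis by (simp add: action_def)
qed

lemma action_add:
  assumes "tame (fst u)" "tame (fst v)"
  shows "action (u + v) w = action u w + action v w"
proof -
  obtain N N' where N: "\<forall>n>N. fst u n = 0" "\<forall>n>N'. fst v n = 0"
    using assms unfolding tame_def by blast
  obtain L L' where L: "\<forall>n<L. A (fst u n) n w = 0" "\<forall>n<L'. A (fst v n) n w = 0"
    using assms unfolding tame_def by blast
  let ?N = "max N N'" and ?L = "min L L'"
  have u: "action (fst u, snd u) w = (\<Sum>n\<in>{?L..?N}. A (fst u n) n w) + sW (snd u * l) w"
    by (rule action_box) (use N L in auto)
  have v: "action (fst v, snd v) w = (\<Sum>n\<in>{?L..?N}. A (fst v n) n w) + sW (snd v * l) w"
    by (rule action_box) (use N L in auto)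
  have "action (fst u + fst v, snd u + snd v) w =
      (\<Sum>n\<in>{?L..?N}. A ((fst u + fst v) n) n w) + sW ((snd u + snd v) * l) w"
    by (rule action_box) (use N L in \<open>auto simp: A_add\<close>)
  then have "action (u + v) w = (\<Sum>n\<in>{?L..?N}. A (fst u n) n w + A (fst v n) n w) + sW ((snd u + snd v) * l) w"
    by (simp add: plus_prod_def A_add)
  then show ?thesis
    using u v by (simp add: sum.distrib distrib_right scale_left_distrib)
qed

lemma action_scale: "action (ginf_scale s c u) w = sW c (action u w)"
proof (cases "c = 0")
  case True
  then have "A (s c (fst u n)) n w = 0" for n by (simp only: A_scale) simp
  then show ?thesis using True by (simp add: action_def ginf_scale_def)
next
  case False
  then have "{n. A (s c (fst u n)) n w \<noteq> 0} = {n. A (fst u n) n w \<noteq> 0}"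
    by (simp add: A_scale)
  then show ?thesis
    by (simp only: action_def ginf_scale_def fst_conv snd_conv A_scale scale_right_distrib
        scale_sum_right scale_scale mult.assoc)
qed

lemma action_linear:
  assumes "tame (fst u)"
  shows "Vector_Spaces.linear sW sW (action u)"
proof -
  obtain N where N: "\<forall>n>N. fst u n = 0" using assms unfolding tame_def by blast
  note lin = linear_props[OF A_linear]
  have "action u (v + w) = action u v + action u w" for v w
  proof -
    obtain L L' where L: "\<forall>n<L. A (fst u n) n v = 0" "\<forall>n<L'. A (fst u n) n w = 0"
      using assms unfolding tame_def by blast
    let ?L = "min L L'"
    have "action (fst u, snd u) x = (\<Sum>n\<in>{?L..N}. A (fst u n) n x) + sW (snd u * l) x"
      if "x \<in> {v, w, v + w}" for x
      by (rule action_box) (use N L that in \<open>auto simp: lin\<close>)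
    then show ?thesis by (simp add: lin sum.distrib scale_right_distrib)
  qed
  moreover have "action u (sW c w) = sW c (action u w)" for c w
  proof -
    obtain L where L: "\<forall>n<L. A (fst u n) n w = 0"
      using assms unfolding tame_def by blast
    have "action (fst u, snd u) x = (\<Sum>n\<in>{L..N}. A (fst u n) n x) + sW (snd u * l) x"
      if "x \<in> {w, sW c w}" for x
      by (rule action_box) (use N L that in \<open>auto simp: lin\<close>)
    from this[of w] this[of "sW c w"] show ?thesis
      by (simp only: prod.collapse insert_iff simp_thms lin scale_sum_right scale_right_distrib scale_scale mult_ac)
  qed
  ultimately show ?thesis
    by unfold_locales
qed

lemma action_tens:
  assumes "\<forall>n>N. p n = 0" and "\<forall>n<L. A a n w = 0"
  shows "action (tens s a p, c) w = (\<Sum>n\<in>{L..N}. sW (p n) (A a n w)) + sW (c * l) w"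
  using action_box[of N "tens s a p" L w c] assms by (simp add: tens_def A_scale)

text \<open>
  The covariance of the fields, summed against the coefficients of \<open>p\<close>. All sums are restricted to
  a common finite interval, outside of which every term vanishes on \<open>w\<close>, and then interchanged.
\<close>

lemma action_covariance:
  assumes "g \<in> \<Gamma>" "p \<in> laurent_inf"
  shows "action (tens s (g a) p, 0) w = action (tens s a (subst_affine (*) p (\<Psi> g)), 0) w"
proof -
  obtain N where N: "\<forall>n>N. p n = 0" using assms unfolding laurent_inf_def by blast
  obtain L L' where L0: "\<forall>n<L. A a n w = 0" "\<forall>n<L'. A (g a) n w = 0"
    using A_truncated by metis
  define M where "M = min L L'"
  have L: "\<forall>n<M. A a n w = 0" "\<forall>n<M. A (g a) n w = 0" using L0 by (simp_all add: M_def)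
  have cov: "A (g a) n w = (\<Sum>k\<in>{M..N}. sW (affine_pow (\<Psi> g) n k) (A a k w))" if "n \<le> N" for n
    unfolding covariance[OF assms(1)]
  proof (rule sum.mono_neutral_left)
    show "{k. k \<le> n \<and> A a k w \<noteq> 0} \<subseteq> {M..N}"
      using L(1) that by (auto simp: not_less[symmetric])
    show "\<forall>k\<in>{M..N} - {k. k \<le> n \<and> A a k w \<noteq> 0}. sW (affine_pow (\<Psi> g) n k) (A a k w) = 0"
    proof
      fix k assume "k \<in> {M..N} - {k. k \<le> n \<and> A a k w \<noteq> 0}"
      then show "sW (affine_pow (\<Psi> g) n k) (A a k w) = 0"
        by (cases "k \<le> n") (auto simp: affine_pow_bounded)
    qed
  qed simp
  have N': "\<forall>n>N. subst_affine (*) p (\<Psi> g) n = 0"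
    using subst_affine_bounded[OF N] by blast
  have sub: "subst_affine (*) p (\<Psi> g) k = (\<Sum>n\<in>{M..N}. affine_pow (\<Psi> g) n k * p n)" if "k \<ge> M" for k
    using subst_affine_box[OF cc.vector_space_axioms N that] by simp
  have "action (tens s (g a) p, 0) w = (\<Sum>n\<in>{M..N}. sW (p n) (A (g a) n w))"
    using action_tens[OF N L(2)] by simp
  also have "\<dots> = (\<Sum>n\<in>{M..N}. \<Sum>k\<in>{M..N}. sW (affine_pow (\<Psi> g) n k * p n) (A a k w))"
    by (simp add: cov scale_sum_right mult.commute)
  also have "\<dots> = (\<Sum>k\<in>{M..N}. \<Sum>n\<in>{M..N}. sW (affine_pow (\<Psi> g) n k * p n) (A a k w))"
    by (rule sum.swap)
  also have "\<dots> = action (tens s a (subst_affine (*) p (\<Psi> g)), 0) w"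
    using action_tens[OF N' L(1)] by (simp add: sub scale_sum_left)
  finally show ?thesis .
qed

abbreviation "carr \<equiv> ginf_carrier s"
abbreviation "\<I> \<equiv> Gamma_ideal s \<Gamma> \<Psi>"

lemma carr_iff: "u \<in> carr \<longleftrightarrow> fst u \<in> G_series"
  by (cases u) (simp add: ginf_carrier_def)

lemma carr_tame: "u \<in> carr \<Longrightarrow> tame (fst u)"
  by (simp add: carr_iff tame_G_series)

lemma tens_carr: "p \<in> laurent_inf \<Longrightarrow> (tens s a p, c) \<in> carr"
  by (auto simp: carr_iff intro!: gs.span_base)

lemma carr_add: "u \<in> carr \<Longrightarrow> v \<in> carr \<Longrightarrow> u + v \<in> carr"
  unfolding carr_iff fst_add by (rule gs.span_add)

lemma carr_scale: "u \<in> carr \<Longrightarrow> ginf_scale s c u \<in> carr"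
  unfolding carr_iff ginf_scale_def fst_conv by (rule gs.span_scale)

lemma carr_zero: "0 \<in> carr"
  unfolding carr_iff fst_zero by (rule gs.span_zero)

lemma action_ideal:
  assumes "u \<in> \<I>"
  shows "u \<in> carr \<and> (\<forall>w. action u w = 0)"
  using assms unfolding Gamma_ideal_def
proof (induction rule: gi.span_induct_alt)
  case base
  show ?case by (simp add: carr_zero) (simp add: action_def A_0)
next
  case (step c x y)
  then obtain g a p where x: "x = (tens s (g a) p - tens s a (subst_affine (*) p (\<Psi> g)), 0)"
    "g \<in> \<Gamma>" "p \<in> laurent_inf" by auto
  let ?q = "subst_affine (*) p (\<Psi> g)"
  have q: "?q \<in> laurent_inf"
    using x(3) subst_affine_bounded[of _ p] unfolding laurent_inf_def by blast
  have x': "x = (tens s (g a) p, 0) + ginf_scale s (- 1) (tens s a ?q, 0)"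
    by (simp add: x(1) ginf_scale_def plus_prod_def fun_eq_iff)
  have xc: "x \<in> carr" unfolding x' by (intro carr_add carr_scale tens_carr x q)
  have "action x w = 0" for w
    unfolding x' action_add[OF carr_tame carr_tame, OF tens_carr[OF x(3)] carr_scale[OF tens_carr[OF q]]]
      action_scale action_covariance[OF x(2,3)] by simp
  then have "action (ginf_scale s c x + y) w = 0" for w
    using action_add[OF carr_tame carr_tame] carr_scale[OF xc] step by (simp add: action_scale)
  then show ?case using carr_add carr_scale xc step by blast
qed

end

section \<open>Compatibility with the bracket and the module structure\<close>

context covariant_Gamma_fields
begin

interpretation s: vector_space s by (rule s)

lemma commutator_modes:
  "A a m (A b n w) - A b n (A a m w) = (\<Sum>g\<in>supp a b. point_row a b w g (- m - 1) (- n - 1))"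
proof -
  have "A a m (A b n w) - A b n (A a m w) = C a b w (- m - 1) (- n - 1)"
    by (simp add: field_comm_def field_prod_def apply_field_def)
  then show ?thesis by (simp add: commutator_rows sum_fun_apply)
qed

text \<open>
  Only finitely many \<open>n \<le> N\<close> have \<open>b\<^sub>n w \<noteq> 0\<close>, and each of them gives a bound for \<open>m\<close>.
\<close>

lemma products_truncated: "\<exists>L. \<forall>m<L. \<forall>n\<le>N. A a m (A b n w) = 0"
proof -
  obtain L1 where L1: "\<forall>n<L1. A b n w = 0" using A_truncated by blast
  have "\<exists>K. \<forall>n. \<forall>m<K n. A a m (A b n w) = 0" by (rule choice) (use A_truncated in blast)
  then obtain K where K: "\<forall>m<K n. A a m (A b n w) = 0" for n by blast
  let ?L = "Min (insert 0 (K ` {L1..N}))"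
  have "A a m (A b n w) = 0" if "m < ?L" "n \<le> N" for m n
  proof (cases "n < L1")
    case True
    then show ?thesis using L1 by (simp add: A_zero)
  next
    case False
    then have "?L \<le> K n" using that(2) by (intro Min_le) auto
    with that(1) have "m < K n" by (rule less_le_trans)
    then show ?thesis using K by blast
  qed
  then show ?thesis by blast
qed

text \<open>
  The contribution of \<open>g\<close> to the commutator of the modes, summed against the coefficients of \<open>p\<close> and
  \<open>q\<close>. The bound \<open>L\<close> is so low that the square \<open>{L..N} \<times> {L..N}\<close> contains all pairs of exponents with a
  nonzero contribution: in the first part the exponent \<open>k\<close> of the mode is at least \<open>L0\<close> and the one from
  \<open>p(h(x))\<close> is at most \<open>N\<close>, and in the second part the exponents of \<open>p(h(x))'\<close> and \<open>q\<close> add up to \<open>- 1\<close>.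
\<close>

lemma summed_point_row:
  assumes pN: "\<forall>n>N. p n = 0" and qN: "\<forall>n>N. q n = 0"
    and xL: "\<forall>k<L0. A (br (g a) b) k w = 0" and L: "L \<le> L0 - N" "L \<le> - 1 - N"
    and pg: "pg = subst_affine (*) p (pole g)"
  shows "(\<Sum>m\<in>{L..N}. \<Sum>n\<in>{L..N}. sW (p m * q n) (point_row a b w g (- m - 1) (- n - 1))) =
    action (tens s (br (g a) b) (cauchy_prod (*) pg q),
         res (cauchy_prod (*) (formal_deriv (*) pg) q) * form (g a) b) w"
proof -
  let ?x = "br (g a) b" and ?h = "pole g"
  have pgN: "\<forall>n>N. pg n = 0" unfolding pg using subst_affine_bounded[OF pN] by blast
  have pg_box: "pg k = (\<Sum>m\<in>{L..N}. affine_pow ?h m k * p m)" if "k \<ge> L" for k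
    unfolding pg using subst_affine_box[OF cc.vector_space_axioms pN that] by simp
  define c where "c m n k = affine_pow ?h m (k - n)" for m n k
  have serM: "\<forall>j>- L0 - 1. apply_field (A ?x) w j = 0"
    using xL by (simp add: apply_field_def)
  have first: "cauchy_prod sW (affine_pow ?h m) (apply_field (A ?x) w) (- n - 1) =
      (\<Sum>k\<in>{L0..2 * N}. sW (c m n k) (A ?x k w))" if "m \<le> N" "n \<le> N" for m n
  proof -
    have "\<forall>j>N. affine_pow ?h m j = 0" using that by (simp add: affine_pow_bounded)
    then have "cauchy_prod sW (affine_pow ?h m) (apply_field (A ?x) w) (- n - 1) =
        (\<Sum>j\<in>{- n - 1 - (- L0 - 1)..N}. sW (affine_pow ?h m j) (apply_field (A ?x) w (- n - 1 - j)))"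
      by (rule conv_box[OF _ serM])
    also have "\<dots> = (\<Sum>j\<in>{L0 - n..N}. sW (affine_pow ?h m j) (A ?x (n + j) w))"
      by (rule sum.cong) (auto simp: apply_field_def add.commute)
    also have "\<dots> = (\<Sum>k\<in>{L0..N + n}. sW (c m n k) (A ?x k w))"
      by (rule sum.reindex_bij_witness[of _ "\<lambda>k. k - n" "\<lambda>j. n + j"]) (auto simp: c_def)
    also have "\<dots> = (\<Sum>k\<in>{L0..2 * N}. sW (c m n k) (A ?x k w))"
      by (rule sum.mono_neutral_left) (use that in \<open>auto simp: c_def affine_pow_bounded\<close>)
    finally show ?thesis .
  qed
  have pq: "cauchy_prod (*) pg q k = (\<Sum>m\<in>{L..N}. \<Sum>n\<in>{L..N}. p m * q n * c m n k)"
    if "k \<ge> L0" for k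
  proof -
    have "cauchy_prod (*) pg q k = (\<Sum>j\<in>{k - N..N}. pg j * q (k - j))"
      by (rule cc.conv_box[OF pgN qN])
    also have "\<dots> = (\<Sum>n\<in>{k - N..N}. pg (k - n) * q n)"
      by (rule sum.reindex_bij_witness[of _ "\<lambda>n. k - n" "\<lambda>n. k - n"]) auto
    also have "\<dots> = (\<Sum>n\<in>{k - N..N}. \<Sum>m\<in>{L..N}. p m * q n * c m n k)"
    proof (rule sum.cong[OF refl])
      fix n assume "n \<in> {k - N..N}"
      then have "k - n \<ge> L" using that L by simp
      then show "pg (k - n) * q n = (\<Sum>m\<in>{L..N}. p m * q n * c m n k)"
        unfolding pg_box[OF \<open>k - n \<ge> L\<close>] c_def sum_distrib_right
        by (intro sum.cong refl) (simp only: mult_ac)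
    qed
    also have "\<dots> = (\<Sum>n\<in>{L..N}. \<Sum>m\<in>{L..N}. p m * q n * c m n k)"
      by (rule sum.mono_neutral_left) (use that L in \<open>auto simp: c_def affine_pow_bounded intro!: sum.neutral\<close>)
    also have "\<dots> = (\<Sum>m\<in>{L..N}. \<Sum>n\<in>{L..N}. p m * q n * c m n k)"
      by (rule sum.swap)
    finally show ?thesis .
  qed
  have dN: "\<forall>n>N. formal_deriv (*) pg n = 0"
    using pgN by (simp add: formal_deriv_def)
  have residue: "res (cauchy_prod (*) (formal_deriv (*) pg) q) =
      (\<Sum>m\<in>{L..N}. \<Sum>n\<in>{L..N}. p m * q n * formal_deriv (*) (affine_pow ?h m) (- n - 1))"
  proof -
    have "res (cauchy_prod (*) (formal_deriv (*) pg) q) =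
        (\<Sum>j\<in>{- 1 - N..N}. formal_deriv (*) pg j * q (- 1 - j))"
      unfolding res_def by (rule cc.conv_box[OF dN qN])
    also have "\<dots> = (\<Sum>n\<in>{- 1 - N..N}. formal_deriv (*) pg (- n - 1) * q n)"
      by (rule sum.reindex_bij_witness[of _ "\<lambda>n. - 1 - n" "\<lambda>n. - 1 - n"]) auto
    also have "\<dots> = (\<Sum>n\<in>{- 1 - N..N}. \<Sum>m\<in>{L..N}. p m * q n * formal_deriv (*) (affine_pow ?h m) (- n - 1))"
    proof (rule sum.cong[OF refl])
      fix n assume "n \<in> {- 1 - N..N}"
      then have "- n \<ge> L" using L by simp
      then have "formal_deriv (*) pg (- n - 1) = (\<Sum>m\<in>{L..N}. formal_deriv (*) (affine_pow ?h m) (- n - 1) * p m)"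
        using pg_box[of "- n"] by (simp add: formal_deriv_def sum_distrib_left mult.assoc)
      then show "formal_deriv (*) pg (- n - 1) * q n =
          (\<Sum>m\<in>{L..N}. p m * q n * formal_deriv (*) (affine_pow ?h m) (- n - 1))"
        unfolding sum_distrib_right by (simp only: mult_ac sum_distrib_right sum_distrib_left)
    qed
    also have "\<dots> = (\<Sum>n\<in>{L..N}. \<Sum>m\<in>{L..N}. p m * q n * formal_deriv (*) (affine_pow ?h m) (- n - 1))"
      by (rule sum.mono_neutral_left)
        (use L in \<open>auto simp: formal_deriv_def affine_pow_bounded intro!: sum.neutral\<close>)
    also have "\<dots> = (\<Sum>m\<in>{L..N}. \<Sum>n\<in>{L..N}. p m * q n * formal_deriv (*) (affine_pow ?h m) (- n - 1))"
      by (rule sum.swap)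
    finally show ?thesis .
  qed
  have prodN: "\<forall>n>2 * N. cauchy_prod (*) pg q n = 0"
    using cc.conv_box[OF pgN qN] by simp
  have "(\<Sum>m\<in>{L..N}. \<Sum>n\<in>{L..N}. sW (p m * q n) (point_row a b w g (- m - 1) (- n - 1))) =
      (\<Sum>m\<in>{L..N}. \<Sum>n\<in>{L..N}. \<Sum>k\<in>{L0..2 * N}. sW (p m * q n * c m n k) (A ?x k w)) +
      (\<Sum>m\<in>{L..N}. \<Sum>n\<in>{L..N}.
        sW (p m * q n * formal_deriv (*) (affine_pow ?h m) (- n - 1)) (sW (l * form (g a) b) w))"
    unfolding sum.distrib[symmetric]
    by (intro sum.cong refl)
      (simp add: point_row_def first scale_right_distrib scale_sum_right mult.assoc)
  also have "(\<Sum>m\<in>{L..N}. \<Sum>n\<in>{L..N}.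
        sW (p m * q n * formal_deriv (*) (affine_pow ?h m) (- n - 1)) (sW (l * form (g a) b) w)) =
      sW (res (cauchy_prod (*) (formal_deriv (*) pg) q)) (sW (l * form (g a) b) w)"
    unfolding residue by (simp only: scale_sum_left)
  also have "(\<Sum>m\<in>{L..N}. \<Sum>n\<in>{L..N}. \<Sum>k\<in>{L0..2 * N}. sW (p m * q n * c m n k) (A ?x k w)) =
      (\<Sum>k\<in>{L0..2 * N}. \<Sum>m\<in>{L..N}. \<Sum>n\<in>{L..N}. sW (p m * q n * c m n k) (A ?x k w))"
    by (simp only: sum.swap[of _ _ "{L0..2 * N}"])
  also have "\<dots> = (\<Sum>k\<in>{L0..2 * N}. sW (cauchy_prod (*) pg q k) (A ?x k w))"
    by (intro sum.cong refl) (simp add: pq scale_sum_left)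
  finally show ?thesis
    unfolding action_tens[OF prodN xL] by (simp add: mult_ac)
qed

lemma subst_laurent: "p \<in> laurent_inf \<Longrightarrow> subst_affine (*) p h \<in> laurent_inf"
  for p :: "int \<Rightarrow> complex"
  using subst_affine_bounded[where f = p and s = "(*)" and h = h] unfolding laurent_inf_def by blast

lemma Gamma_bracket_tens_eq:
  "Gamma_bracket s br form \<Gamma> \<Psi> (tens s a p, c) (tens s b q, d) =
    (\<Sum>g\<in>supp a b. (tens s (br (g a) b) (cauchy_prod (*) (subst_affine (*) p (pole g)) q),
       res (cauchy_prod (*) (formal_deriv (*) (subst_affine (*) p (pole g))) q) * form (g a) b))"
  unfolding Gamma_bracket_tens[OF s br form \<Gamma>_aut finite_support] supp_def
  by (intro sum.cong refl) (simp add: ginv_eq Let_def)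

lemma carr_sum: "(\<And>i. i \<in> K \<Longrightarrow> u i \<in> carr) \<Longrightarrow> sum u K \<in> carr"
  by (induction K rule: infinite_finite_induct) (auto simp: carr_zero carr_add)

lemma action_zero: "action 0 w = 0"
  by (simp add: action_def A_0)

lemma action_sum: "(\<And>i. i \<in> K \<Longrightarrow> u i \<in> carr) \<Longrightarrow> action (sum u K) w = (\<Sum>i\<in>K. action (u i) w)"
proof (induction K rule: infinite_finite_induct)
  case (insert i K)
  then have "action (u i + sum u K) w = action (u i) w + action (sum u K) w"
    by (intro action_add carr_tame carr_sum) auto
  then show ?case using insert by simp
qed (simp_all add: action_zero)

text \<open>
  On \<open>w\<close> everything reduces to finitely many modes of \<open>a\<close> and \<open>b\<close>, whose commutators are known.
\<close>

lemma action_bracket_tens: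
  assumes "p \<in> laurent_inf" "q \<in> laurent_inf"
  shows "Gamma_bracket s br form \<Gamma> \<Psi> (tens s a p, c) (tens s b q, d) \<in> carr \<and>
    action (Gamma_bracket s br form \<Gamma> \<Psi> (tens s a p, c) (tens s b q, d)) w =
      action (tens s a p, c) (action (tens s b q, d) w) - action (tens s b q, d) (action (tens s a p, c) w)"
proof
  let ?pg = "\<lambda>g. subst_affine (*) p (pole g)"
  let ?S = "\<lambda>g. (tens s (br (g a) b) (cauchy_prod (*) (?pg g) q),
       res (cauchy_prod (*) (formal_deriv (*) (?pg g)) q) * form (g a) b)"
  have Sc: "?S g \<in> carr" for g
    by (intro tens_carr cc.conv_laurent subst_laurent assms)
  show "Gamma_bracket s br form \<Gamma> \<Psi> (tens s a p, c) (tens s b q, d) \<in> carr"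
    unfolding Gamma_bracket_tens_eq by (intro carr_sum Sc)
  have fin: "finite (supp a b)" unfolding supp_def by (rule finite_support)
  obtain N1 N2 where N12: "\<forall>n>N1. p n = 0" "\<forall>n>N2. q n = 0"
    using assms unfolding laurent_inf_def by blast
  define N where "N = max N1 N2"
  have N: "\<forall>n>N. p n = 0" "\<forall>n>N. q n = 0" using N12 by (simp_all add: N_def)
  have "\<exists>K. \<forall>g. \<forall>k<K g. A (br (g a) b) k w = 0" by (rule choice) (use A_truncated in blast)
  then obtain K where K: "\<forall>k<K g. A (br (g a) b) k w = 0" for g by blast
  define L0 where "L0 = Min (insert 0 (K ` supp a b))"
  have L0: "\<forall>k<L0. A (br (g a) b) k w = 0" if "g \<in> supp a b" for g
  proof -
    have "L0 \<le> K g" unfolding L0_def using that fin by (intro Min_le) auto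
    then show ?thesis using K by simp
  qed
  obtain L1 L2 where L12: "\<forall>n<L1. A a n w = 0" "\<forall>n<L2. A b n w = 0"
    using A_truncated by blast
  obtain L3 where L3: "\<forall>m<L3. \<forall>n\<le>N. A a m (A b n w) = 0" using products_truncated by blast
  obtain L4 where L4: "\<forall>m<L4. \<forall>n\<le>N. A b m (A a n w) = 0" using products_truncated by blast
  note L' = L12 L3 L4
  define L where "L = Min {L0 - N, - 1 - N, L1, L2, L3, L4}"
  have le: "L \<le> L0 - N" "L \<le> - 1 - N" "L \<le> L1" "L \<le> L2" "L \<le> L3" "L \<le> L4"
    unfolding L_def by (rule Min_le; simp)+
  have L: "L \<le> L0 - N" "L \<le> - 1 - N" "\<forall>n<L. A a n w = 0" "\<forall>n<L. A b n w = 0"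
    "\<forall>m<L. \<forall>n\<le>N. A a m (A b n w) = 0" "\<forall>m<L. \<forall>n\<le>N. A b m (A a n w) = 0"
    using le L' by (blast intro: less_le_trans)+
  have product: "action (tens s a p, c) (action (tens s b q, d) w) =
      (\<Sum>m\<in>{L..N}. \<Sum>n\<in>{L..N}. sW (p m * q n) (A a m (A b n w))) +
      sW (d * l) (\<Sum>m\<in>{L..N}. sW (p m) (A a m w)) +
      sW (c * l) (\<Sum>n\<in>{L..N}. sW (q n) (A b n w)) + sW (c * l) (sW (d * l) w)"
    if pN: "\<forall>n>N. p n = 0" and qN: "\<forall>n>N. q n = 0" and a: "\<forall>n<L. A a n w = 0" and b: "\<forall>n<L. A b n w = 0"
      and ab: "\<forall>m<L. \<forall>n\<le>N. A a m (A b n w) = 0" for a b p q c d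
  proof -
    note lin = linear_props[OF A_linear]
    have ls: "A a m (sum u K) = (\<Sum>i\<in>K. A a m (u i))" for m K and u :: "int \<Rightarrow> 'a"
      by (induction K rule: infinite_finite_induct) (simp_all add: lin)
    let ?v = "action (tens s b q, d) w"
    have v: "?v = (\<Sum>n\<in>{L..N}. sW (q n) (A b n w)) + sW (d * l) w"
      by (rule action_tens[OF qN b])
    have Av: "A a m ?v = (\<Sum>n\<in>{L..N}. sW (q n) (A a m (A b n w))) + sW (d * l) (A a m w)" for m
      by (simp add: v lin ls)
    have "\<forall>m<L. A a m ?v = 0"
      unfolding Av using a ab by simp
    then have "action (tens s a p, c) ?v = (\<Sum>m\<in>{L..N}. sW (p m) (A a m ?v)) + sW (c * l) ?v"
      by (rule action_tens[OF pN])
    also have "(\<Sum>m\<in>{L..N}. sW (p m) (A a m ?v)) =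
        (\<Sum>m\<in>{L..N}. \<Sum>n\<in>{L..N}. sW (p m * q n) (A a m (A b n w))) +
        sW (d * l) (\<Sum>m\<in>{L..N}. sW (p m) (A a m w))"
      by (simp only: Av scale_right_distrib sum.distrib scale_sum_right scale_scale mult_ac)
    also have "sW (c * l) ?v = sW (c * l) (\<Sum>n\<in>{L..N}. sW (q n) (A b n w)) + sW (c * l) (sW (d * l) w)"
      by (simp only: v scale_right_distrib)
    finally show ?thesis by (simp only: add.assoc)
  qed
  have "action (tens s a p, c) (action (tens s b q, d) w) - action (tens s b q, d) (action (tens s a p, c) w) =
      (\<Sum>m\<in>{L..N}. \<Sum>n\<in>{L..N}. sW (p m * q n) (A a m (A b n w))) -
      (\<Sum>n\<in>{L..N}. \<Sum>m\<in>{L..N}. sW (q n * p m) (A b n (A a m w)))"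
  proof -
    have "(x + a + b + e) - (y + b + a + e) = x - y" for x y a b e :: 'a by simp
    moreover have "sW (d * l) (sW (c * l) w) = sW (c * l) (sW (d * l) w)"
      by (rule scale_left_commute)
    ultimately show ?thesis
      unfolding product[OF N L(3,4,5)] product[OF N(2,1) L(4,3,6)] by metis
  qed
  also have "(\<Sum>n\<in>{L..N}. \<Sum>m\<in>{L..N}. sW (q n * p m) (A b n (A a m w))) =
      (\<Sum>m\<in>{L..N}. \<Sum>n\<in>{L..N}. sW (p m * q n) (A b n (A a m w)))"
    by (subst sum.swap) (simp add: mult.commute)
  also have "(\<Sum>m\<in>{L..N}. \<Sum>n\<in>{L..N}. sW (p m * q n) (A a m (A b n w))) - \<dots> =
      (\<Sum>m\<in>{L..N}. \<Sum>n\<in>{L..N}. \<Sum>g\<in>supp a b. sW (p m * q n) (point_row a b w g (- m - 1) (- n - 1)))"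
    by (simp only: sum_subtractf[symmetric] scale_right_diff_distrib[symmetric] commutator_modes scale_sum_right)
  also have "\<dots> = (\<Sum>g\<in>supp a b. \<Sum>m\<in>{L..N}. \<Sum>n\<in>{L..N}. sW (p m * q n) (point_row a b w g (- m - 1) (- n - 1)))"
    by (simp only: sum.swap[of _ _ "supp a b"])
  also have "\<dots> = (\<Sum>g\<in>supp a b. action (?S g) w)"
    by (rule sum.cong[OF refl], rule summed_point_row[OF N]) (use L0 L in auto)
  also have "\<dots> = action (Gamma_bracket s br form \<Gamma> \<Psi> (tens s a p, c) (tens s b q, d)) w"
    unfolding Gamma_bracket_tens_eq by (rule action_sum[OF Sc, symmetric])
  finally show "action (Gamma_bracket s br form \<Gamma> \<Psi> (tens s a p, c) (tens s b q, d)) w =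
      action (tens s a p, c) (action (tens s b q, d) w) - action (tens s b q, d) (action (tens s a p, c) w)" ..
qed

abbreviation "summand g u v \<equiv> Gamma_summand s br form g (pole g) u v"

lemma subst_affine_add:
  assumes "\<forall>n>N. f n = 0" "\<forall>n>N. f' n = 0"
  shows "subst_affine s (f + f') h = subst_affine s f h + subst_affine s f' h"
proof
  fix k
  have "\<forall>n>N. (f + f') n = 0" using assms by simp
  then have "subst_affine s (f + f') h k = (\<Sum>m\<in>{k..N}. s (affine_pow h m k) ((f + f') m))"
    by (rule subst_affine_box[OF s _ order_refl])
  then show "subst_affine s (f + f') h k = (subst_affine s f h + subst_affine s f' h) k"
    unfolding plus_fun_apply subst_affine_box[OF s assms(1) order_refl]
      subst_affine_box[OF s assms(2) order_refl]
    by (simp only: s.scale_right_distrib sum.distrib)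
qed

lemma cauchy_prod_add:
  assumes b: "bilinear_map s t b" and f: "\<forall>n>N. f n = 0" "\<forall>n>N. f' n = 0" and e: "\<forall>n>N. e n = 0" "\<forall>n>N. e' n = 0"
  shows "cauchy_prod b (f + f') e = cauchy_prod b f e + cauchy_prod b f' e"
    and "cauchy_prod b f (e + e') = cauchy_prod b f e + cauchy_prod b f e'"
proof -
  have add: "b (x + x') y = b x y + b x' y" "b x (y + y') = b x y + b x y'" for x x' y y'
    using b linear_props(3)[of s t "b x"] linear_props(3)[of s t "\<lambda>x. b x y"]
    unfolding bilinear_map_def by blast+
  note zero = bilinear_map_props(3,4)[OF b]
  have ff: "\<forall>n>N. (f + f') n = 0" and ee: "\<forall>n>N. (e + e') n = 0" using f e by simp_all
  note box = cauchy_prod_box[of b, OF zero]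
  show "cauchy_prod b (f + f') e = cauchy_prod b f e + cauchy_prod b f' e"
  proof
    fix k
    show "cauchy_prod b (f + f') e k = (cauchy_prod b f e + cauchy_prod b f' e) k"
      unfolding box[OF ff e(1), of k]
      unfolding plus_fun_apply box[OF f(1) e(1)] box[OF f(2) e(1)] add sum.distrib ..
  qed
  show "cauchy_prod b f (e + e') = cauchy_prod b f e + cauchy_prod b f e'"
  proof
    fix k
    show "cauchy_prod b f (e + e') k = (cauchy_prod b f e + cauchy_prod b f e') k"
      unfolding box[OF f(1) ee, of k]
      unfolding plus_fun_apply box[OF f(1) e(1)] box[OF f(1) e(2)] add sum.distrib ..
  qed
qed

lemma summand_add:
  assumes "g \<in> \<Gamma>" "u \<in> carr" "u' \<in> carr" "v \<in> carr" "v' \<in> carr"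
  shows "summand g (u + u') v = summand g u v + summand g u' v"
    and "summand g u (v + v') = summand g u v + summand g u v'"
proof -
  have "\<exists>N. \<forall>n>N. fst x n = 0" if "x \<in> carr" for x
    using carr_tame[OF that] unfolding tame_def by blast
  with assms obtain N1 N2 N3 N4 where N': "\<forall>n>N1. fst u n = 0" "\<forall>n>N2. fst u' n = 0"
    "\<forall>n>N3. fst v n = 0" "\<forall>n>N4. fst v' n = 0" by metis
  define N where "N = Max {N1, N2, N3, N4}"
  have N: "\<forall>n>N. fst u n = 0" "\<forall>n>N. fst u' n = 0" "\<forall>n>N. fst v n = 0" "\<forall>n>N. fst v' n = 0"
    using N' by (simp_all add: N_def)
  note lin = linear_props[OF \<Gamma>_linear[OF assms(1)]]
  define gu where "gu = subst_affine s (\<lambda>n. g (fst u n)) (pole g)"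
  define gu' where "gu' = subst_affine s (\<lambda>n. g (fst u' n)) (pole g)"
  have gN: "\<forall>n>N. g (fst u n) = 0" "\<forall>n>N. g (fst u' n) = 0" using N by (simp_all add: lin)
  have guN: "\<forall>n>N. gu n = 0" "\<forall>n>N. gu' n = 0"
    unfolding gu_def gu'_def using subst_affine_bounded[OF gN(1)] subst_affine_bounded[OF gN(2)] by blast+
  have dN: "\<forall>n>N. formal_deriv s gu n = 0" "\<forall>n>N. formal_deriv s gu' n = 0"
    using guN by (simp_all add: formal_deriv_def)
  have "(\<lambda>n. g (fst (u + u') n)) = (\<lambda>n. g (fst u n)) + (\<lambda>n. g (fst u' n))"
    by (simp add: fun_eq_iff lin)
  then have sub: "subst_affine s (\<lambda>n. g (fst (u + u') n)) (pole g) = gu + gu'"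
    unfolding gu_def gu'_def using subst_affine_add[OF gN] by simp
  have d: "formal_deriv s (gu + gu') = formal_deriv s gu + formal_deriv s gu'"
    by (simp add: fun_eq_iff formal_deriv_def s.scale_right_distrib)
  show "summand g (u + u') v = summand g u v + summand g u' v"
    unfolding Gamma_summand_def Let_def sub gu_def[symmetric] gu'_def[symmetric] d
      cauchy_prod_add(1)[OF br guN N(3,4)] cauchy_prod_add(1)[OF form dN N(3,4)]
    by (simp add: res_def)
  show "summand g u (v + v') = summand g u v + summand g u v'"
    unfolding Gamma_summand_def Let_def gu_def[symmetric] fst_add
      cauchy_prod_add(2)[OF br guN N(3,4)] cauchy_prod_add(2)[OF form dN N(3,4)]
    by (simp add: res_def)
qed

lemma summand_tens_vanish:
  assumes "g \<in> \<Gamma>" "g \<notin> supp a b"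
  shows "summand g (tens s a p, c) (tens s b q, d) = 0"
proof -
  have z: "br (g a) b = 0" "form (g a) b = 0" using assms by (auto simp: supp_def)
  have deriv: "formal_deriv s (tens s (g a) f) = tens s (g a) (formal_deriv (*) f)" for f
    by (simp add: formal_deriv_def tens_def fun_eq_iff)
  show ?thesis
    by (simp add: Gamma_summand_def Let_def subst_affine_tens[OF s \<Gamma>_linear[OF assms(1)]] deriv res_def
        cauchy_prod_tens[OF s s br] cauchy_prod_tens[OF s cc.vector_space_axioms form] z fun_eq_iff zero_prod_def)
qed

text \<open>
  Besides the identity to be proved this records the finiteness of the sum over \<open>\<Gamma>\<close>, without which the
  bracket would not be additive.
\<close>

definition represented :: "'b ginf \<Rightarrow> 'b ginf \<Rightarrow> bool" where
  "represented u v \<longleftrightarrow> finite {g \<in> \<Gamma>. summand g u v \<noteq> 0} \<and>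
     Gamma_bracket s br form \<Gamma> \<Psi> u v \<in> carr \<and>
     (\<forall>w. action (Gamma_bracket s br form \<Gamma> \<Psi> u v) w = action u (action v w) - action v (action u w))"

lemma bracket_over:
  assumes "finite K" "K \<subseteq> \<Gamma>" "{g \<in> \<Gamma>. summand g u v \<noteq> 0} \<subseteq> K"
  shows "Gamma_bracket s br form \<Gamma> \<Psi> u v = (\<Sum>g\<in>K. summand g u v)"
proof -
  have "Gamma_bracket s br form \<Gamma> \<Psi> u v = (\<Sum>g\<in>{g \<in> \<Gamma>. summand g u v \<noteq> 0}. summand g u v)"
    unfolding Gamma_bracket_def Let_def by (rule sum.cong) (auto simp: ginv_eq)
  also have "\<dots> = (\<Sum>g\<in>K. summand g u v)"
    by (rule sum.mono_neutral_left) (use assms in auto)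
  finally show ?thesis .
qed

lemma represented_tens:
  assumes "p \<in> laurent_inf" "q \<in> laurent_inf"
  shows "represented (tens s a p, c) (tens s b q, d)"
proof -
  have "{g \<in> \<Gamma>. summand g (tens s a p, c) (tens s b q, d) \<noteq> 0} \<subseteq> supp a b"
    using summand_tens_vanish by blast
  then have "finite {g \<in> \<Gamma>. summand g (tens s a p, c) (tens s b q, d) \<noteq> 0}"
    by (rule finite_subset) (unfold supp_def, rule finite_support)
  then show ?thesis unfolding represented_def using action_bracket_tens[OF assms] by blast
qed

lemma bracket_add:
  assumes "finite {g \<in> \<Gamma>. summand g u v \<noteq> 0}" "finite {g \<in> \<Gamma>. summand g u' v' \<noteq> 0}"
    and add: "\<And>g. g \<in> \<Gamma> \<Longrightarrow> summand g x y = summand g u v + summand g u' v'"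
  shows "finite {g \<in> \<Gamma>. summand g x y \<noteq> 0} \<and>
    Gamma_bracket s br form \<Gamma> \<Psi> x y = Gamma_bracket s br form \<Gamma> \<Psi> u v + Gamma_bracket s br form \<Gamma> \<Psi> u' v'"
proof -
  let ?K = "{g \<in> \<Gamma>. summand g u v \<noteq> 0} \<union> {g \<in> \<Gamma>. summand g u' v' \<noteq> 0}"
  have fin: "finite ?K" using assms by blast
  have sub: "{g \<in> \<Gamma>. summand g x y \<noteq> 0} \<subseteq> ?K" using add by force
  have K: "?K \<subseteq> \<Gamma>" by blast
  have "Gamma_bracket s br form \<Gamma> \<Psi> x y = (\<Sum>g\<in>?K. summand g u v + summand g u' v')"
    unfolding bracket_over[OF fin K sub] by (rule sum.cong) (use add in auto)
  also have "\<dots> = Gamma_bracket s br form \<Gamma> \<Psi> u v + Gamma_bracket s br form \<Gamma> \<Psi> u' v'"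
    unfolding sum.distrib
    by (subst (1 2) bracket_over[OF fin K]) auto
  finally show ?thesis using finite_subset[OF sub fin] by blast
qed

lemma represented_add_left:
  assumes "represented u v" "represented u' v" "u \<in> carr" "u' \<in> carr" "v \<in> carr"
  shows "represented (u + u') v"
proof -
  have "finite {g \<in> \<Gamma>. summand g (u + u') v \<noteq> 0} \<and> Gamma_bracket s br form \<Gamma> \<Psi> (u + u') v =
      Gamma_bracket s br form \<Gamma> \<Psi> u v + Gamma_bracket s br form \<Gamma> \<Psi> u' v"
    by (rule bracket_add) (use assms represented_def summand_add(1)[OF _ assms(3,4,5,5)] in auto)
  moreover have "action v (x + y) = action v x + action v y" for x y
    by (rule linear_props(3)[OF action_linear[OF carr_tame[OF assms(5)]]])
  ultimately show ?thesis
    using assms unfolding represented_def by (simp add: carr_add action_add carr_tame)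
qed

lemma represented_add_right:
  assumes "represented u v" "represented u v'" "u \<in> carr" "v \<in> carr" "v' \<in> carr"
  shows "represented u (v + v')"
proof -
  have "finite {g \<in> \<Gamma>. summand g u (v + v') \<noteq> 0} \<and> Gamma_bracket s br form \<Gamma> \<Psi> u (v + v') =
      Gamma_bracket s br form \<Gamma> \<Psi> u v + Gamma_bracket s br form \<Gamma> \<Psi> u v'"
    by (rule bracket_add) (use assms represented_def summand_add(2)[OF _ assms(3,3,4,5)] in auto)
  moreover have "action u (x + y) = action u x + action u y" for x y
    by (rule linear_props(3)[OF action_linear[OF carr_tame[OF assms(3)]]])
  ultimately show ?thesis
    using assms unfolding represented_def by (simp add: carr_add action_add carr_tame)
qed

lemma zero_tens: "(0, c) = (tens s 0 0, c)"
  by (simp add: tens_def fun_eq_iff)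

lemma zero_laurent: "(0 :: int \<Rightarrow> complex) \<in> laurent_inf"
  by (simp add: laurent_inf_def)

text \<open>
  Pure tensors generate, and the property is additive in both arguments.
\<close>

lemma represented_carr:
  assumes "u \<in> carr" "v \<in> carr"
  shows "represented u v"
proof -
  have right: "represented (tens s a p, c) (f, d)" if "f \<in> G_series" "p \<in> laurent_inf" for a p c f d
    using that(1)
  proof (induction arbitrary: d rule: G_series_induct)
    case zero
    show ?case unfolding zero_tens by (rule represented_tens[OF that(2) zero_laurent])
  next
    case (add b q f)
    have "(f, d) \<in> carr" using add(2) by (simp add: carr_iff)
    then have "represented (tens s a p, c) ((tens s b q, 0) + (f, d))"
      using add that(2) by (intro represented_add_right represented_tens tens_carr)
    then show ?case by (simp only: add_Pair add_0_left)
  qed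
  have "represented (f, c) v" if "f \<in> G_series" for f c
    using that
  proof (induction arbitrary: c rule: G_series_induct)
    case zero
    show ?case unfolding zero_tens
      using right[OF _ zero_laurent, of "fst v" 0 c "snd v"] assms(2) by (simp add: carr_iff)
  next
    case (add a p f)
    have "(f, c) \<in> carr" using add(2) by (simp add: carr_iff)
    moreover have "represented (tens s a p, 0) v"
      using right[of "fst v" p a 0 "snd v"] add(1) assms(2) by (simp add: carr_iff)
    ultimately have "represented ((tens s a p, 0) + (f, c)) v"
      using add assms(2) by (intro represented_add_left tens_carr)
    then show ?case by (simp only: add_Pair add_0_left)
  qed
  from this[of "fst u" "snd u"] show ?thesis using assms(1) by (simp add: carr_iff)
qed

text \<open>
  Elements of the quotient are cosets; the choice of the representative is immaterial because the
  ideal acts by zero.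
\<close>

definition \<rho> :: "'b ginf set \<Rightarrow> 'a \<Rightarrow> 'a" where
  "\<rho> U = action (SOME u. u \<in> U)"

lemma \<rho>_eq: "x \<in> U \<Longrightarrow> (\<And>u. u \<in> U \<Longrightarrow> action u w = r) \<Longrightarrow> \<rho> U w = r"
  unfolding \<rho>_def by (metis someI)

interpretation gi: complex_space "ginf_scale s"
  unfolding complex_space_def by (rule vector_space_ginf_scale[OF s])

lemma subspace_ideal: "gi.subspace \<I>"
  unfolding Gamma_ideal_def by (rule gi.subspace_span)

lemma action_coset:
  assumes "u \<in> carr" "x \<in> coset_of \<I> u"
  shows "action x w = action u w"
proof -
  obtain n where n: "n \<in> \<I>" "x = u + n" using assms(2) by (auto simp: coset_of_def)
  show ?thesis
    using action_ideal[OF n(1)] action_add[OF carr_tame[OF assms(1)] carr_tame, of n] n by simp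
qed

lemma \<rho>_coset: "u \<in> carr \<Longrightarrow> \<rho> (coset_of \<I> u) w = action u w"
  by (rule \<rho>_eq[OF gi.coset_of_self[OF subspace_ideal] action_coset])

text \<open>
  The product of two cosets is given as a set of representatives, so it suffices that all of these
  act in the same way.
\<close>

theorem ginf_Gamma_module:
  "lie_module (ginf_Gamma s br form \<Gamma> \<Psi>) sW \<rho>"
  "\<rho> (ginf_proj s \<Gamma> \<Psi> (0, 1)) w = sW l w"
  "\<rho> (ginf_proj s \<Gamma> \<Psi> (tens s a (tpow n), 0)) w = A a n w"
proof -
  let ?Q = "ginf_Gamma s br form \<Gamma> \<Psi>"
  have carrier: "carrier ?Q = coset_of \<I> ` carr"
    by (simp add: ginf_Gamma_def quotient_algebra_def quotient_space_def)
  have add: "coset_of \<I> u \<oplus>\<^bsub>?Q\<^esub> coset_of \<I> v = coset_of \<I> (u + v)" for u v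
    using gi.quotient_space_add[OF subspace_ideal, where S = carr]
    by (simp add: ginf_Gamma_def quotient_algebra_def)
  have smult: "c \<odot>\<^bsub>?Q\<^esub> coset_of \<I> u = coset_of \<I> (ginf_scale s c u)" for c u
    using gi.quotient_space_smult[OF subspace_ideal, where S = carr]
    by (simp add: ginf_Gamma_def quotient_algebra_def)
  have mult: "\<rho> (coset_of \<I> u \<otimes>\<^bsub>?Q\<^esub> coset_of \<I> v) w = action u (action v w) - action v (action u w)"
    if uv: "u \<in> carr" "v \<in> carr" for u v w
  proof (rule \<rho>_eq)
    let ?b = "Gamma_bracket s br form \<Gamma> \<Psi>"
    have M: "coset_of \<I> u \<otimes>\<^bsub>?Q\<^esub> coset_of \<I> v =
        {?b x y + n | x y n. x \<in> coset_of \<I> u \<and> y \<in> coset_of \<I> v \<and> n \<in> \<I>}"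
      by (simp add: ginf_Gamma_def quotient_algebra_def)
    show "?b u v + 0 \<in> coset_of \<I> u \<otimes>\<^bsub>?Q\<^esub> coset_of \<I> v"
      unfolding M using gi.coset_of_self[OF subspace_ideal] gi.subspace_0[OF subspace_ideal] by blast
    fix z assume "z \<in> coset_of \<I> u \<otimes>\<^bsub>?Q\<^esub> coset_of \<I> v"
    then obtain x y n where z: "z = ?b x y + n" "x \<in> coset_of \<I> u" "y \<in> coset_of \<I> v" "n \<in> \<I>"
      unfolding M by blast
    have xy: "x \<in> carr" "y \<in> carr"
      using z(2,3) uv action_ideal by (auto simp: coset_of_def intro!: carr_add)
    have g: "?b x y \<in> carr" "\<forall>w. action (?b x y) w = action x (action y w) - action y (action x w)"
      using represented_carr[OF xy] unfolding represented_def by blast+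
    show "action z w = action u (action v w) - action v (action u w)"
      using action_add[OF carr_tame[OF g(1)] carr_tame, of n] action_ideal[OF z(4)] g(2)
        action_coset[OF uv(1) z(2)] action_coset[OF uv(2) z(3)] by (simp add: z(1))
  qed
  show "lie_module ?Q sW \<rho>"
    unfolding lie_module_def carrier
  proof (intro conjI ballI allI)
    show "vector_space sW" by (rule vector_space_axioms)
    fix x assume "x \<in> coset_of \<I> ` carr"
    then obtain u where u: "u \<in> carr" "x = coset_of \<I> u" by blast
    have "\<rho> x = action u" using \<rho>_coset[OF u(1)] u(2) by auto
    then show "Vector_Spaces.linear sW sW (\<rho> x)" using action_linear[OF carr_tame[OF u(1)]] by simp
    show "\<rho> (c \<odot>\<^bsub>?Q\<^esub> x) w = sW c (\<rho> x w)" for c w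
      by (simp add: u smult \<rho>_coset carr_scale action_scale)
    fix y assume "y \<in> coset_of \<I> ` carr"
    then obtain v where v: "v \<in> carr" "y = coset_of \<I> v" by blast
    show "\<rho> (x \<oplus>\<^bsub>?Q\<^esub> y) w = \<rho> x w + \<rho> y w" for w
      by (simp add: u v add \<rho>_coset carr_add action_add carr_tame)
    show "\<rho> (x \<otimes>\<^bsub>?Q\<^esub> y) w = \<rho> x (\<rho> y w) - \<rho> y (\<rho> x w)" for w
      by (simp add: u v mult \<rho>_coset)
  qed
  have "(0, 1) \<in> carr" using carr_zero by (simp add: carr_iff)
  then show "\<rho> (ginf_proj s \<Gamma> \<Psi> (0, 1)) w = sW l w"
    by (simp add: ginf_proj_def \<rho>_coset) (simp add: action_def A_0)
  have t: "tpow n \<in> laurent_inf" by (auto simp: laurent_inf_def tpow_def intro!: exI[of _ n])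
  have "action (tens s a (tpow n), 0) w = (\<Sum>k | A (tens s a (tpow n) k) k w \<noteq> 0. A (tens s a (tpow n) k) k w)"
    by (simp add: action_def)
  also have "\<dots> = (\<Sum>k\<in>{n}. A (tens s a (tpow n) k) k w)"
    by (rule sum.mono_neutral_left) (auto simp: tens_def tpow_def A_scale)
  also have "\<dots> = A a n w" by (simp add: tens_def tpow_def)
  finally show "\<rho> (ginf_proj s \<Gamma> \<Psi> (tens s a (tpow n), 0)) w = A a n w"
    by (simp only: ginf_proj_def \<rho>_coset[OF tens_carr[OF t]])
qed

end

section \<open>The fields of a quasi module at infinity\<close>

lemma affine_group_group: "group affine_group"
proof (rule groupI)
  fix x y z assume x: "x \<in> carrier affine_group" and y: "y \<in> carrier affine_group" and "z \<in> carrier affine_group"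
  show "x \<otimes>\<^bsub>affine_group\<^esub> y \<in> carrier affine_group"
    using x y by (simp add: affine_group_def degree_pcompose)
  show "x \<otimes>\<^bsub>affine_group\<^esub> y \<otimes>\<^bsub>affine_group\<^esub> z = x \<otimes>\<^bsub>affine_group\<^esub> (y \<otimes>\<^bsub>affine_group\<^esub> z)"
    by (simp add: affine_group_def pcompose_assoc)
next
  fix x assume x: "x \<in> carrier affine_group"
  show "\<one>\<^bsub>affine_group\<^esub> \<otimes>\<^bsub>affine_group\<^esub> x = x"
    by (simp add: affine_group_def pcompose_pCons)
  have d: "degree x = 1" using x by (simp add: affine_group_def)
  then have a: "coeff x 1 \<noteq> 0" by (metis leading_coeff_0_iff degree_0 zero_neq_one)
  have "pcompose [:- coeff x 0 / coeff x 1, 1 / coeff x 1:] [:coeff x 0, coeff x 1:] = [:0, 1:]"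
    using a by (simp add: pcompose_pCons)
  then have "pcompose [:- coeff x 0 / coeff x 1, 1 / coeff x 1:] x = [:0, 1:]"
    using linear_poly_eq[OF d] by simp
  then show "\<exists>y\<in>carrier affine_group. y \<otimes>\<^bsub>affine_group\<^esub> x = \<one>\<^bsub>affine_group\<^esub>"
    using a by (intro bexI[of _ "[:- coeff x 0 / coeff x 1, 1 / coeff x 1:]"]) (auto simp: affine_group_def)
qed (simp add: affine_group_def)

lemma affine_group_inv:
  assumes "degree h = 1"
  shows "m_inv affine_group h = [:- coeff h 0 / coeff h 1, 1 / coeff h 1:]"
proof -
  interpret group affine_group by (rule affine_group_group)
  have a: "coeff h 1 \<noteq> 0" using assms by (metis leading_coeff_0_iff degree_0 zero_neq_one)
  have "pcompose [:- coeff h 0 / coeff h 1, 1 / coeff h 1:] [:coeff h 0, coeff h 1:] = [:0, 1:]"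
    using a by (simp add: pcompose_pCons)
  then have "pcompose [:- coeff h 0 / coeff h 1, 1 / coeff h 1:] h = [:0, 1:]"
    using linear_poly_eq[OF assms] by simp
  then show ?thesis
    using a assms by (intro inv_equality) (auto simp: affine_group_def)
qed

text \<open>
  Reindexing by \<open>m = - k - 1\<close> and applying the change of variables in the residue.
\<close>

lemma field_subst_inverse:
  assumes "degree h = 1" and "vector_space s"
  shows "field_subst s a (m_inv affine_group h) n w =
    s (coeff h 1) (\<Sum>k | k \<le> n \<and> a k w \<noteq> 0. s (affine_pow h n k) (a k w))"
proof -
  interpret vector_space s by fact
  have a: "coeff h 1 \<noteq> 0" using assms(1) by (metis leading_coeff_0_iff degree_0 zero_neq_one)
  have P: "affine_pow (m_inv affine_group h) (- k - 1) (- n - 1) = coeff h 1 * affine_pow h n k" for k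
    using affine_pow_inverse[OF a, of "coeff h 0" k n] linear_poly_eq[OF assms(1)]
    by (simp add: affine_group_inv[OF assms(1)])
  have "field_subst s a (m_inv affine_group h) n w =
      (\<Sum>m | - n - 1 \<le> m \<and> a (- m - 1) w \<noteq> 0. s (affine_pow (m_inv affine_group h) m (- n - 1)) (a (- m - 1) w))"
    by (simp add: field_subst_def subst_affine_def apply_field_def)
  also have "\<dots> = (\<Sum>k | k \<le> n \<and> a k w \<noteq> 0. s (affine_pow (m_inv affine_group h) (- k - 1) (- n - 1)) (a k w))"
    by (rule sum.reindex_bij_witness[of _ "\<lambda>k. - k - 1" "\<lambda>m. - m - 1"]) auto
  finally show ?thesis by (simp add: P scale_sum_right)
qed

text \<open>
  The Taylor expansion of \<open>p(x\<^sub>2 + x\<^sub>0, x\<^sub>2)\<close> in \<open>x\<^sub>0\<close>, up to first order.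
\<close>

lemma bipoly_shift_coeffs:
  "coeff (bipoly_shift p) 0 = poly p [:0, 1:]"
  "coeff (bipoly_shift p) 1 = poly (pderiv p) [:0, 1:]"
proof -
  show "coeff (bipoly_shift p) 0 = poly p [:0, 1:]"
    by (simp add: bipoly_shift_def coeff_pcompose_0)
  have "coeff (bipoly_shift p) 1 = coeff (pderiv (bipoly_shift p)) 0"
    by (simp add: coeff_pderiv)
  also have "pderiv (bipoly_shift p) = pcompose (pderiv p) [:[:0, 1:], 1:]"
    by (simp add: bipoly_shift_def pderiv_pcompose pderiv_pCons)
  finally show "coeff (bipoly_shift p) 1 = poly (pderiv p) [:0, 1:]"
    by (simp add: coeff_pcompose_0)
qed

theorem theorem3p4:
  fixes s :: "complex \<Rightarrow> 'g::ab_group_add \<Rightarrow> 'g"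
    and br :: "'g \<Rightarrow> 'g \<Rightarrow> 'g"
    and form :: "'g \<Rightarrow> 'g \<Rightarrow> complex"
    and \<Gamma> :: "('g \<Rightarrow> 'g) set"
    and \<Psi> :: "('g \<Rightarrow> 'g) \<Rightarrow> complex poly"
    and \<phi> :: "('g \<Rightarrow> 'g) \<Rightarrow> complex"
    and l :: complex
    and Y :: "'g affine free_alg set \<Rightarrow> int \<Rightarrow> 'g affine free_alg set \<Rightarrow> 'g affine free_alg set"
    and R L :: "('g \<Rightarrow> 'g) \<Rightarrow> 'g affine free_alg set \<Rightarrow> 'g affine free_alg set"
    and sW :: "complex \<Rightarrow> 'w::ab_group_add \<Rightarrow> 'w"
    and YW :: "'g affine free_alg set \<Rightarrow> int \<Rightarrow> 'w \<Rightarrow> 'w"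
  assumes "lie_algebra s br"
    and "nondeg_sym_invariant_form s br form"
    and "subgroup \<Gamma> (aut_group s br form)"
    and "\<And>u v. finite {g \<in> \<Gamma>. \<not> (br (g u) v = 0 \<and> form (g u) v = 0)}"
    and "\<Psi> \<in> hom (sub_group (aut_group s br form) \<Gamma>) affine_group"
    and "\<And>g. g \<in> \<Gamma> \<Longrightarrow> \<phi> g = lead_coeff (\<Psi> g)"
    and "affine_vertex_algebra s (opposite_bracket br) form (- l) Y"
    and "induced_action s (opposite_bracket br) form (- l) Y \<Gamma> R"
    and "twisted_action s (opposite_bracket br) form (- l) \<Gamma> \<phi> R L"
    and "quasi_module_at_infinity_Gamma
           (aff_space s (opposite_bracket br) form (- l)) Y
           (aff_vacuum s (opposite_bracket br) form (- l))
           (sub_group (aut_group s br form) \<Gamma>) L \<phi> sW YW \<Psi>"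
    and "inj_on \<Psi> \<Gamma>"
  shows "\<exists>\<rho>. lie_module (ginf_Gamma s br form \<Gamma> \<Psi>) sW \<rho> \<and>
           (\<forall>w. \<rho> (ginf_proj s \<Gamma> \<Psi> (0, 1)) w = sW l w) \<and>
           (\<forall>a n w. \<rho> (ginf_proj s \<Gamma> \<Psi> (tens s a (tpow n), 0)) w =
                      YW (aff_emb s (opposite_bracket br) form (- l) a) n w)"
proof -
  let ?ob = "opposite_bracket br" and ?G = "sub_group (aut_group s br form) \<Gamma>"
  let ?V = "aff_space s ?ob form (- l)" and ?vac = "aff_vacuum s ?ob form (- l)"
  let ?emb = "aff_emb s ?ob form (- l)"
  have vs: "vector_space s" and br: "bilinear_map s s br" and alt: "\<And>x. br x x = 0"
    using assms(1) by (auto simp: lie_algebra_def)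
  have form: "bilinear_map s (*) form"
    using assms(2) by (simp add: nondeg_sym_invariant_form_def)
  have ob: "bilinear_map s s ?ob"
    using br unfolding bilinear_map_def opposite_bracket_def[abs_def] by blast
  interpret M: quasi_module_at_infinity_Gamma ?V Y ?vac ?G L \<phi> sW YW \<Psi>
    by (rule assms(10))
  interpret E: affine_space_data s ?ob form "- l"
    by unfold_locales (rule ob form)+
  interpret AG: group affine_group by (rule affine_group_group)
  have G: "group ?G" by unfold_locales
  interpret H: group_hom ?G affine_group \<Psi>
    by unfold_locales (rule assms(5))
  interpret W: complex_space sW
    unfolding complex_space_def by (rule M.W_vector_space)
  define A where "A a = YW (?emb a)" for a
  have skew: "br b a = - br a b" for a b
  proof -
    have add: "br (x + x') y = br x y + br x' y" "br x (y + y') = br x y + br x y'" for x x' y y'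
      using br linear_props(3)[of s s "br x"] linear_props(3)[of s s "\<lambda>x. br x y"]
      unfolding bilinear_map_def by blast+
    have "br a b + br b a = br (a + b) (a + b)" unfolding add by (simp add: alt)
    then have "br a b + br b a = 0" by (simp only: alt)
    then show ?thesis by (rule minus_unique[symmetric])
  qed
  have degree: "degree (\<Psi> g) = 1" if "g \<in> \<Gamma>" for g
    using H.hom_closed[of g] that by (simp add: affine_group_def)
  have A_add: "A (a + b) n w = A a n w + A b n w" for a b n w
    unfolding A_def E.emb_add by (rule M.YW_add[OF E.emb_closed E.emb_closed])
  have A_scale: "A (s c a) n w = sW c (A a n w)" for c a n w
    unfolding A_def E.emb_scale[OF vs] by (rule M.YW_scale[OF E.emb_closed])
  have A_neg: "A (- a) n w = - A a n w" for a n w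
  proof -
    have "A 0 n w = 0" using A_add[of 0 0 n w] by simp
    then have "A a n w + A (- a) n w = 0" using A_add[of a "- a" n w] by simp
    then show ?thesis by (rule minus_unique[symmetric])
  qed
  interpret F: covariant_Gamma_fields sW s br form \<Gamma> \<Psi> "m_inv ?G" l A
  proof (intro covariant_Gamma_fields.intro covariant_Gamma_fields_axioms.intro
      covariant_fields.intro covariant_fields_axioms.intro W.complex_space_axioms)
    show "vector_space s" "bilinear_map s s br" "bilinear_map s (*) form" by fact+
    show sub: "\<Gamma> \<subseteq> carrier (aut_group s br form)"
      using assms(3) by (rule subgroup.subset)
    show "Vector_Spaces.linear s s g" if "g \<in> \<Gamma>" for g
      using sub that by (auto simp: aut_group_def)
    show "m_inv ?G g \<in> \<Gamma>" if "g \<in> \<Gamma>" for g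
      using group.inv_closed[OF G, of g] that by simp
    show "m_inv ?G g (g a) = a" if "g \<in> \<Gamma>" for g a
    proof -
      have "m_inv ?G g \<circ> g = id"
        using group.l_inv[OF G, of g] that by (simp add: aut_group_def)
      then show ?thesis by (simp add: fun_eq_iff)
    qed
    show "m_inv ?G (m_inv ?G g) = g" if "g \<in> \<Gamma>" for g
      using group.inv_inv[OF G, of g] that by simp
    show "finite {g \<in> \<Gamma>. \<not> (br (g a) b = 0 \<and> form (g a) b = 0)}" for a b by (rule assms(4))
    show "degree (\<Psi> g) = 1" if "g \<in> \<Gamma>" for g by (rule degree[OF that])
    show "pcompose (\<Psi> g) (\<Psi> (m_inv ?G g)) = [:0, 1:]" if "g \<in> \<Gamma>" for g
    proof -
      have "\<Psi> g \<otimes>\<^bsub>affine_group\<^esub> m_inv affine_group (\<Psi> g) = \<one>\<^bsub>affine_group\<^esub>"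
        using that H.hom_closed[of g] by (intro AG.r_inv) simp
      then show ?thesis using H.hom_inv[of g] that by (simp add: affine_group_def)
    qed
    show "inj_on \<Psi> \<Gamma>" by fact
    show "A (a + b) n w = A a n w + A b n w" for a b n w by (rule A_add)
    show "A (s c a) n w = sW c (A a n w)" for c a n w by (rule A_scale)
    show "A a \<in> Eo sW" for a unfolding A_def by (rule M.YW_Eo[OF E.emb_closed])
    show "A (g a) n w = (\<Sum>k | k \<le> n \<and> A a k w \<noteq> 0. sW (affine_pow (\<Psi> g) n k) (A a k w))"
      if g: "g \<in> \<Gamma>" for g a n w
    proof -
      have \<phi>: "\<phi> g = coeff (\<Psi> g) 1" "\<phi> g \<noteq> 0"
        using assms(6)[OF g] degree[OF g] M.\<phi>_nonzero[of g] g by simp_all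
      have "L g (?emb a) = (\<phi> g powi 1) \<odot>\<^bsub>?V\<^esub> R g (?emb a)"
        using assms(9) g E.emb_degree unfolding twisted_action_def by blast
      also have "R g (?emb a) = ?emb (g a)"
        using assms(8) g unfolding induced_action_def by blast
      finally have "YW (L g (?emb a)) n w = sW (\<phi> g) (A (g a) n w)"
        using M.YW_scale[OF E.emb_closed] by (simp add: A_def)
      moreover have "YW (L g (?emb a)) n w = field_subst sW (YW (?emb a)) (m_inv affine_group (\<Psi> g)) n w"
        by (rule M.YW_L[OF _ E.emb_closed]) (simp add: g)
      moreover have "\<dots> = sW (\<phi> g) (\<Sum>k | k \<le> n \<and> A a k w \<noteq> 0. sW (affine_pow (\<Psi> g) n k) (A a k w))"
        unfolding field_subst_inverse[OF degree[OF g] M.W_vector_space] \<phi>(1) A_def ..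
      ultimately have "sW (\<phi> g) (A (g a) n w) =
          sW (\<phi> g) (\<Sum>k | k \<le> n \<and> A a k w \<noteq> 0. sW (affine_pow (\<Psi> g) n k) (A a k w))"
        by (simp only:)
      then show ?thesis using \<phi>(2) by simp
    qed
    have local: "\<exists>hs. set hs \<subseteq> \<Psi> ` \<Gamma> \<and>
      (\<forall>w. bipoly_mult sW (prod_list (map (\<lambda>h. [:- h, 1:]) hs)) (field_comm (A a) (A b) w) = 0)" for a b
    proof -
      have "A a \<in> YW ` carrier ?V" "A b \<in> YW ` carrier ?V"
        unfolding A_def by (rule imageI[OF E.emb_closed])+
      with M.\<Gamma>_local obtain hs where "set hs \<subseteq> \<Psi> ` carrier ?G"
        "\<forall>w m n. bipoly_mult sW (prod_list (map (\<lambda>h. [:- h, 1:]) hs))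
          (\<lambda>m n. field_prod (A a) (A b) w m n - field_prod (A b) (A a) w n m) m n = 0"
        unfolding group_local_def by blast
      then show ?thesis by (intro exI[of _ hs]) (simp add: field_comm_def fun_eq_iff)
    qed
    then show "\<exists>hs. set hs \<subseteq> \<Psi> ` \<Gamma> \<and>
      (\<forall>w. bipoly_mult sW (prod_list (map (\<lambda>h. [:- h, 1:]) hs)) (field_comm (A a) (A b) w) = 0)" for a b .
    show "\<exists>T. poly T [:0, 1:] \<noteq> 0 \<and> (\<forall>w f.
      bipoly_mult sW (T * f) (field_comm (A a) (A b) w) (- 1) =
        poly_act sW (poly (T * f) [:0, 1:]) (apply_field (A (br a b)) w) +
        poly_act sW (poly (pderiv (T * f)) [:0, 1:])
          (\<lambda>n. if n = 0 then sW (l * form a b) w else 0))" for a b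
    proof -
      obtain hs where hs:
        "\<And>w. bipoly_mult sW (prod_list (map (\<lambda>h. [:- h, 1:]) hs)) (field_comm (A a) (A b) w) = 0"
        using local by blast
      have nz: "prod_list (map (\<lambda>h. [:- h, 1:]) hs) \<noteq> (0 :: complex poly poly)"
        by (auto simp: prod_list_zero_iff)
      obtain T where T: "poly T [:0, 1:] \<noteq> 0"
        "\<And>w f n. bipoly_mult sW (T * f) (field_comm (A a) (A b) w) (- 1) n =
          - (\<Sum>i\<le>degree (bipoly_shift (T * f)). poly_act sW (coeff (bipoly_shift (T * f)) i)
              (apply_field (YW (Y (?emb a) (int i) (?emb b))) w) n)"
        using M.commutator_near_diagonal[OF E.emb_closed E.emb_closed nz, of a b] hs
        unfolding A_def by blast
      define u where "u w i = apply_field (YW (Y (?emb a) (int i) (?emb b))) w" for w i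
      have vec0: "YW (E.vec 0) n w = 0" for n w
      proof -
        have "E.vec 0 = 0 \<odot>\<^bsub>?V\<^esub> E.vec 0" by (simp add: E.vec_smult free_scale_def)
        then have "YW (E.vec 0) n w = sW 0 (YW (E.vec 0) n w)"
          using M.YW_scale[OF E.vec_closed] by metis
        then show ?thesis by simp
      qed
      have vac: "?vac \<in> carrier ?V" by (simp add: E.vacuum_eq E.vec_closed)
      \<comment> \<open>the sign comes from the opposite bracket, and in the next step from the level \<open>- l\<close>\<close>
      have u0: "u w 0 = - apply_field (A (br a b)) w" for w
        using E.product_on_generators[OF assms(7), of a 0 b]
        by (simp add: u_def fun_eq_iff apply_field_def opposite_bracket_def skew[of b a] A_neg
            flip: A_def)
      have u1: "u w 1 = - (\<lambda>n. if n = 0 then sW (l * form a b) w else 0)" for w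
        using E.product_on_generators[OF assms(7), of a 1 b] M.YW_scale[OF vac]
        by (simp add: u_def fun_eq_iff apply_field_def M.YW_vacuum W.scale_minus_left)
      have u2: "u w i = 0" if "i \<ge> 2" for w i
        using E.product_on_generators[OF assms(7), of a i b] that
        by (simp add: u_def fun_eq_iff apply_field_def vec0)
      have "bipoly_mult sW (T * f) (field_comm (A a) (A b) w) (- 1) =
        poly_act sW (poly (T * f) [:0, 1:]) (apply_field (A (br a b)) w) +
        poly_act sW (poly (pderiv (T * f)) [:0, 1:])
          (\<lambda>n. if n = 0 then sW (l * form a b) w else 0)" for w f
      proof
        fix n
        let ?q = "bipoly_shift (T * f)"
        interpret pm: Modules.module "poly_act sW" by (rule W.u1.module_eval)
        have "(\<Sum>i\<le>degree ?q. poly_act sW (coeff ?q i) (u w i) n) =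
            (\<Sum>i\<le>max 1 (degree ?q). poly_act sW (coeff ?q i) (u w i) n)"
          by (rule sum.mono_neutral_left) (auto simp: coeff_eq_0)
        also have "\<dots> = (\<Sum>i\<in>{0, 1}. poly_act sW (coeff ?q i) (u w i) n)"
          by (rule sum.mono_neutral_right) (auto simp: u2)
        also have "\<dots> = poly_act sW (coeff ?q 0) (u w 0) n + poly_act sW (coeff ?q 1) (u w 1) n"
          by simp
        also have "\<dots> = - ((poly_act sW (poly (T * f) [:0, 1:]) (apply_field (A (br a b)) w) +
           poly_act sW (poly (pderiv (T * f)) [:0, 1:])
            (\<lambda>n. if n = 0 then sW (l * form a b) w else 0)) n)"
          unfolding u0 u1 bipoly_shift_coeffs pm.scale_minus_right by simp
        finally show "bipoly_mult sW (T * f) (field_comm (A a) (A b) w) (- 1) n =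
          (poly_act sW (poly (T * f) [:0, 1:]) (apply_field (A (br a b)) w) +
           poly_act sW (poly (pderiv (T * f)) [:0, 1:])
            (\<lambda>n. if n = 0 then sW (l * form a b) w else 0)) n"
          by (simp only: T(2) u_def[symmetric] minus_minus)
      qed
      with T(1) show ?thesis by blast
    qed
    show "m_inv ?G g = m_inv ?G g" if "g \<in> \<Gamma>" for g ..
  qed
  show ?thesis
    using F.ginf_Gamma_module by (intro exI[of _ F.\<rho>]) (simp add: A_def)
qed

end
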